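(* Let $k$ be an arbitrary field and let $G$ be a torsion soluble group. (a) If $G$ has a faithful irreducible representation over $k$, then for any abelian normal subgroup $A$ of $G$ we have $\mathrm{char}(k)\notin\Pi(A)$ and there is a subgroup $C$ of $A$ such that $A/C$ is locally cyclic and $\mathrm{core}_G(C)=1$. (b) If $G$ has a maximal abelian normal subgroup $A$ such that $\mathrm{char}(k)\notin\Pi(A)$ and there is a subgroup $C$ of $A$ such that $A/C$ is locally cyclic and $\mathrm{core}_G(C)=1$, then $G$ has a faithful irreducible representation over $k$.
   Context: Groups may be infinite and representations may be infinite dimensional; a representation of $G$ over $k$ corresponds to a left $kG$-module, where $kG$ is the group algebra. It is faithful if only the identity of $G$ acts trivially, and irreducible if the module is nonzero and has no submodules other than $0$ and itself. A maximal abelian normal subgroup of $G$ is a maximal element (under inclusion) of the set of subgroups of $G$ that are both abelian and normal in $G$. A group is locally cyclic if every finitely generated subgroup of it is cyclic. For a subgroup $C$ of $G$, $\mathrm{core}_G(C)$ is the largest normal subgroup of $G$ contained in $C$, i.e. $\bigcap_{g\in G} gCg^{-1}$. For a group $H$, $\Pi(H)$ is the set of all primes $p$ such that $a^p=1$ for some $a\in H$, $a\neq 1$. *)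

theory Defs
  imports "HOL-Algebra.Algebra"
begin

definition torsion_group :: "('g, 'n) monoid_scheme \<Rightarrow> bool" where
  "torsion_group G \<longleftrightarrow> group G \<and> (\<forall>g \<in> carrier G. \<exists>n::nat. n > 0 \<and> g [^]\<^bsub>G\<^esub> n = \<one>\<^bsub>G\<^esub>)"

text \<open>The additive order of the unit; \<open>group.ord\<close> is 0 on elements of infinite order, which gives
  the usual convention for characteristic zero.\<close>
definition ring_char :: "('k, 'm) ring_scheme \<Rightarrow> nat" where
  "ring_char K = group.ord (add_monoid K) \<one>\<^bsub>K\<^esub>"

definition prime_orders :: "('g, 'n) monoid_scheme \<Rightarrow> nat set" where
  "prime_orders H = {p. Factorial_Ring.prime p \<and> (\<exists>a \<in> carrier H. a \<noteq> \<one>\<^bsub>H\<^esub> \<and> a [^]\<^bsub>H\<^esub> p = \<one>\<^bsub>H\<^esub>)}"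

definition locally_cyclic :: "('g, 'n) monoid_scheme \<Rightarrow> bool" where
  "locally_cyclic H \<longleftrightarrow>
     group H \<and> (\<forall>S. finite S \<and> S \<subseteq> carrier H \<longrightarrow> cyclic_group (subgroup_generated H S))"

definition normal_core :: "('g, 'n) monoid_scheme \<Rightarrow> 'g set \<Rightarrow> 'g set" where
  "normal_core G C = (\<Inter>g \<in> carrier G. g <#\<^bsub>G\<^esub> C #>\<^bsub>G\<^esub> inv\<^bsub>G\<^esub> g)"

definition abelian_normal_subgroup :: "'g set \<Rightarrow> ('g, 'n) monoid_scheme \<Rightarrow> bool" where
  "abelian_normal_subgroup A G \<longleftrightarrow> A \<lhd> G \<and> comm_group (G\<lparr>carrier := A\<rparr>)"

definition maximal_abelian_normal_subgroup :: "'g set \<Rightarrow> ('g, 'n) monoid_scheme \<Rightarrow> bool" where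
  "maximal_abelian_normal_subgroup A G \<longleftrightarrow>
     abelian_normal_subgroup A G \<and>
     (\<forall>B. abelian_normal_subgroup B G \<and> A \<subseteq> B \<longrightarrow> B = A)"

text \<open>A representation of \<open>G\<close> over \<open>K\<close>: a \<open>K\<close>-vector space \<open>V\<close>, of any dimension, with a
  homomorphism \<open>\<phi>\<close> from \<open>G\<close> to the permutations of \<open>V\<close> whose values are linear.  Under the
  usual correspondence with left modules over the group algebra, the submodules are the
  \<open>G\<close>-invariant subspaces.\<close>
locale group_representation =
  field K + module K V + group_action G "carrier V" \<phi>
  for K :: "('k, 'm) ring_scheme" (structure)
    and G :: "('g, 'n) monoid_scheme"
    and V :: "('k, 'v, 'w) module_scheme"
    and \<phi> :: "'g \<Rightarrow> 'v \<Rightarrow> 'v" +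
  assumes rep_add:
    "\<lbrakk>g \<in> carrier G; x \<in> carrier V; y \<in> carrier V\<rbrakk>
       \<Longrightarrow> \<phi> g (x \<oplus>\<^bsub>V\<^esub> y) = \<phi> g x \<oplus>\<^bsub>V\<^esub> \<phi> g y"
    and rep_smult:
    "\<lbrakk>g \<in> carrier G; a \<in> carrier K; x \<in> carrier V\<rbrakk>
       \<Longrightarrow> \<phi> g (a \<odot>\<^bsub>V\<^esub> x) = a \<odot>\<^bsub>V\<^esub> \<phi> g x"

definition faithful_rep ::
  "('g, 'n) monoid_scheme \<Rightarrow> ('k, 'v, 'w) module_scheme \<Rightarrow> ('g \<Rightarrow> 'v \<Rightarrow> 'v) \<Rightarrow> bool" where
  "faithful_rep G V \<phi> \<longleftrightarrow>
     (\<forall>g \<in> carrier G. (\<forall>x \<in> carrier V. \<phi> g x = x) \<longrightarrow> g = \<one>\<^bsub>G\<^esub>)"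

definition subrep ::
  "'v set \<Rightarrow> ('k, 'm) ring_scheme \<Rightarrow> ('g, 'n) monoid_scheme \<Rightarrow> ('k, 'v, 'w) module_scheme
     \<Rightarrow> ('g \<Rightarrow> 'v \<Rightarrow> 'v) \<Rightarrow> bool" where
  "subrep W K G V \<phi> \<longleftrightarrow> submodule W K V \<and> (\<forall>g \<in> carrier G. \<forall>x \<in> W. \<phi> g x \<in> W)"

definition irreducible_rep ::
  "('k, 'm) ring_scheme \<Rightarrow> ('g, 'n) monoid_scheme \<Rightarrow> ('k, 'v, 'w) module_scheme
     \<Rightarrow> ('g \<Rightarrow> 'v \<Rightarrow> 'v) \<Rightarrow> bool" where
  "irreducible_rep K G V \<phi> \<longleftrightarrow>
     carrier V \<noteq> {\<zero>\<^bsub>V\<^esub>} \<and>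
     (\<forall>W. subrep W K G V \<phi> \<longrightarrow> W = {\<zero>\<^bsub>V\<^esub>} \<or> W = carrier V)"

text \<open>HOL cannot quantify over types inside a formula, so the type of the vectors is a parameter.
  An irreducible module is cyclic, hence isomorphic to a quotient of the group algebra by a left
  ideal, and the cosets forming that quotient are sets of functions from \<open>G\<close> to \<open>K\<close>.  So every
  irreducible representation has an isomorphic copy with vectors in \<open>('g \<Rightarrow> 'k) set\<close>, and
  existence at that type is existence at any type.\<close>
definition has_faithful_irreducible_rep ::
  "'v itself \<Rightarrow> ('k, 'm) ring_scheme \<Rightarrow> ('g, 'n) monoid_scheme \<Rightarrow> bool" where
  "has_faithful_irreducible_rep (_ :: 'v itself) K G \<longleftrightarrow>
     (\<exists>(V :: ('k, 'v) module) \<phi>.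
        group_representation K G V \<phi> \<and> faithful_rep G V \<phi> \<and> irreducible_rep K G V \<phi>)"

end

theory Submission
  imports Defs
begin

text \<open>
Both directions compare irreducible representations of \<open>G\<close> with simple modules of the abelian normal
subgroup \<open>A\<close>.  On a simple module \<open>A\<close> acts through the multiplicative group of a field that contains \<open>K\<close>; its image
is a torsion group, hence locally cyclic and without elements of order \<open>char K\<close>.

Suppose that \<open>V\<close> is faithful and irreducible.  If \<open>A\<close> had elements of order \<open>p = char K\<close>, those with \<open>a^p = 1\<close>
would form a normal subgroup \<open>P\<close>, whose augmentation ideal \<open>J\<close> satisfies \<open>J V = 0\<close> or \<open>J V = V\<close>.
The first makes \<open>P\<close> act trivially.  The second fails because \<open>J\<close> is locally nilpotent
and \<open>G\<close>, being torsion and soluble, is locally finite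
(\<open>torsion_solvable_imp_locally_finite\<close>, \<open>irreducible_imp_char_notin_prime_orders\<close>).
Next, choose a nonzero vector \<open>v\<close> and an \<open>A\<close>-invariant subspace \<open>W\<close> maximal with respect to avoiding \<open>v\<close>.  The image of \<open>v\<close> in
\<open>V/W\<close> generates a simple module, and \<open>C\<close> is taken to be the kernel of \<open>A\<close> on it, so \<open>A/C\<close> is locally cyclic.  Let \<open>N\<close>
be the core of \<open>C\<close>.  For \<open>n\<close> in \<open>N\<close> of order \<open>m\<close> the operator \<open>1 + n + ... + n^(m-1)\<close> acts on \<open>v\<close> modulo \<open>W\<close> as the
nonzero scalar \<open>m\<close>, so \<open>v\<close> is not killed by products of such operators.  The vectors killed by
products over distinct \<open>n\<close> form a submodule for \<open>G\<close>, which therefore vanishes; as it contains all \<open>n x - x\<close>, the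
group \<open>N\<close> acts trivially and is trivial (\<open>inertia_core_free\<close>).

Conversely, let \<open>C\<close> be given.  Among the functions on \<open>G\<close> consider the indicator function \<open>u\<close> of \<open>C\<close>, and for each prime \<open>p\<close>
that occurs in \<open>A/C\<close> an element \<open>d\<close> of \<open>A\<close> of order \<open>p\<close> modulo \<open>C\<close>.  The vectors \<open>u + d u + ... + d^(p-1) u\<close> lie in
an invariant subspace that does not contain \<open>u\<close> (\<open>indicator_notin_split_subrep\<close>).  Enlarge it to an
invariant subspace \<open>M\<close> maximal with respect to avoiding \<open>u\<close>.  The submodule generated by \<open>u\<close> modulo \<open>M\<close> is irreducible, and no
\<open>d\<close> fixes \<open>u\<close> modulo \<open>M\<close>, since \<open>p u\<close> would then lie in \<open>M\<close> although \<open>p\<close> is invertible.  As \<open>A/C\<close> is locally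
cyclic, each of its nontrivial subgroups contains the class of one of these \<open>d\<close>, so precisely the
elements of \<open>C\<close> fix \<open>u\<close> modulo \<open>M\<close>.  The kernel of the representation meets \<open>A\<close> in a normal subgroup of \<open>G\<close> inside \<open>C\<close>,
hence trivially, and in a soluble group a nontrivial normal subgroup meets
every maximal abelian normal subgroup nontrivially (\<open>maximal_abelian_normal_meets_normal\<close>).

The group algebra itself never appears.  Submodules are described by the vanishing of products of
commuting operators such as \<open>a - 1\<close> and \<open>1 + a + ... + a^(m-1)\<close>, which avoids spans and linear combinations.
\<close>

section \<open>Locally cyclic torsion groups\<close>

text \<open>For an abelian torsion group this condition is equivalent to being locally cyclic.  It is
the form in which local cyclicity interacts with representations, because it speaks about two
elements of the same prime order at a time.\<close>
definition unique_prime_order_subgroups :: "('g, 'n) monoid_scheme \<Rightarrow> bool" where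
  "unique_prime_order_subgroups H \<longleftrightarrow>
     (\<forall>q u v. Factorial_Ring.prime (q::nat) \<and> u \<in> carrier H \<and> v \<in> carrier H \<and> u \<noteq> \<one>\<^bsub>H\<^esub> \<and>
        u [^]\<^bsub>H\<^esub> q = \<one>\<^bsub>H\<^esub> \<and> v [^]\<^bsub>H\<^esub> q = \<one>\<^bsub>H\<^esub> \<longrightarrow> v \<in> generate H {u})"

lemma (in group) generate_eqI:
  assumes "S \<subseteq> carrier G" "T \<subseteq> carrier G" "S \<subseteq> generate G T" "T \<subseteq> generate G S"
  shows "generate G S = generate G T"
  using assms by (meson generate_is_subgroup generate_subgroup_incl subset_antisym)

lemma (in group) generate_insert_cong:
  assumes "S \<subseteq> carrier G" "T \<subseteq> carrier G" "s \<in> carrier G" "generate G S = generate G T"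
  shows "generate G (insert s S) = generate G (insert s T)"
proof (rule generate_eqI)
  have "generate G S \<subseteq> generate G (insert s S)" "generate G T \<subseteq> generate G (insert s T)"
    by (auto intro!: mono_generate)
  moreover have "S \<subseteq> generate G S" "T \<subseteq> generate G T"
    by (auto intro: generate.incl)
  ultimately show "insert s S \<subseteq> generate G (insert s T)" "insert s T \<subseteq> generate G (insert s S)"
    using assms(4) by (auto intro: generate.incl)
qed (use assms in auto)

text \<open>Here \<open>x\<close> and \<open>y\<close> generate a cyclic group because a generator can be written down.  If \<open>p\<close> does not
divide \<open>m\<close>, Bezout gives \<open>u p + w m = 1\<close>, and \<open>g = x^u y^w\<close> satisfies \<open>g^p = x\<close> and \<open>g^m = y\<close>.
If \<open>p\<close> divides \<open>m\<close>, then \<open>y\<close> differs from a power of \<open>x\<close> by an element \<open>z\<close> with \<open>z^p = 1\<close>.  When \<open>p\<close>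
divides the order of \<open>x\<close>, uniqueness puts \<open>z\<close> inside the group generated by \<open>x\<close>; otherwise \<open>z\<close> and \<open>x\<close>
have coprime orders and \<open>z x\<close> is a generator.\<close>
lemma (in comm_group) generate_two_prime_root:
  assumes x: "x \<in> carrier G" and y: "y \<in> carrier G" and p: "Factorial_Ring.prime (p::nat)"
    and root: "y [^] p = x [^] (m::int)"
    and tors: "n > 0" "x [^] (n::nat) = \<one>"
    and uniq: "unique_prime_order_subgroups G"
  shows "\<exists>h\<in>carrier G. generate G {x, y} = generate G {h}"
proof -
  have mem: "\<exists>h\<in>carrier G. generate G {x, y} = generate G {h}"
    if h: "h = x [^] (a::int) \<otimes> y [^] (b::int)" "x = h [^] (c::int)" "y = h [^] (d::int)" for h a b c d
  proof (intro bexI generate_eqI)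
    show "h \<in> carrier G" using h(1) x y by simp
    show "{x, y} \<subseteq> generate G {h}"
      using generate_pow[OF \<open>h \<in> carrier G\<close>] h(2,3) by blast
    have "subgroup (generate G {x, y}) G" using x y by (intro generate_is_subgroup) auto
    then have "x [^] a \<in> generate G {x, y}" "y [^] b \<in> generate G {x, y}"
      using generate.incl[of x "{x, y}" G] generate.incl[of y "{x, y}" G] subgroup_int_pow_closed by auto
    then show "{h} \<subseteq> generate G {x, y}"
      by (simp add: h(1) generate.eng)
  qed (use h(1) x y in auto)
  have rootz: "y [^] (int p) = x [^] m"
    using root by (simp add: int_pow_int)
  show ?thesis
  proof (cases "int p dvd m")
    case True
    then obtain m' where m': "m = int p * m'" by blast
    define z where "z = y \<otimes> x [^] (- m')"
    have zc: "z \<in> carrier G" using x y by (simp add: z_def)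
    have yz: "y = z \<otimes> x [^] m'"
      using x y by (simp add: z_def m_assoc int_pow_mult[symmetric])
    have zp: "z [^] (int p) = \<one>"
      using x y rootz by (simp add: z_def int_pow_mult_distrib[OF m_comm] int_pow_pow m' int_pow_mult[symmetric] mult.commute)
    show ?thesis
    proof (cases "p dvd ord x")
      case True
      have ordpos: "ord x > 0" using tors x
        by (metis gcd_nat.extremum_strict gcd_nat.not_eq_extremum gr0I pow_eq_id)
      define u where "u = x [^] (ord x div p)"
      have uc: "u \<in> carrier G" using x by (simp add: u_def)
      have "u [^] p = \<one>" using True x
        by (simp add: u_def nat_pow_pow)
      moreover have "u \<noteq> \<one>"
      proof
        assume "u = \<one>"
        then have "ord x dvd ord x div p" using x by (simp add: u_def pow_eq_id)
        moreover have "ord x div p < ord x" "ord x div p > 0"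
          using ordpos prime_gt_1_nat[OF p] True by (auto elim!: dvdE)
        ultimately show False by (meson nat_dvd_not_less)
      qed
      moreover have "z [^] p = \<one>" using zp by (simp add: int_pow_int)
      ultimately have "z \<in> generate G {u}"
        using uniq p uc zc unfolding unique_prime_order_subgroups_def by blast
      then obtain i :: int where "z = u [^] i"
        using generate_pow[OF uc] by blast
      then have "z = x [^] (int (ord x div p) * i)"
        using x by (simp add: u_def int_pow_int[symmetric] int_pow_pow)
      then have "y = x [^] (int (ord x div p) * i + m')"
        using yz x by (simp add: int_pow_mult)
      then show ?thesis
        by (intro mem[of x 1 0 1 "int (ord x div p) * i + m'"]) (use x y in \<open>auto simp: int_pow_1\<close>)
    next
      case False
      have "coprime (int p) (int (ord x))"
        using False p by (simp add: prime_imp_coprime)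
      then obtain r s where rs: "r * int p + s * int (ord x) = 1"
        by (metis bezout_int coprime_iff_gcd_eq_1)
      define h where "h = z \<otimes> x"
      have hc: "h \<in> carrier G" using zc x by (simp add: h_def)
      have xs: "x [^] (s * int (ord x)) = \<one>"
      proof -
        have "x [^] (int (ord x) * s) = \<one>"
          using x by (simp add: int_pow_pow[symmetric] int_pow_int)
        then show ?thesis by (simp add: mult.commute)
      qed
      have "h [^] (int p) = x [^] (int p)"
        using zc x zp by (simp add: h_def int_pow_mult_distrib[OF m_comm])
      then have "h [^] (int p * r) = x [^] (int p * r)"
        using hc x by (simp add: int_pow_pow[symmetric])
      also have "\<dots> = x [^] (r * int p) \<otimes> x [^] (s * int (ord x))"
        using x xs by (simp add: mult.commute)
      also have "\<dots> = x"
        using x rs by (simp add: int_pow_mult[symmetric])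
      finally have xh: "x = h [^] (int p * r)" ..
      have "z = h \<otimes> inv x" using zc x by (simp add: h_def m_assoc)
      then have "y = h \<otimes> inv x \<otimes> x [^] m'" using yz by simp
      also have "\<dots> = h [^] (1::int) \<otimes> x [^] (m' - 1)"
        using hc x by (simp add: m_assoc int_pow_diff m_comm[of "inv x"])
      also have "\<dots> = h [^] (1::int) \<otimes> h [^] (int p * r * (m' - 1))"
        by (metis xh hc int_pow_pow)
      also have "\<dots> = h [^] (1 + int p * r * (m' - 1))"
        using hc by (simp only: int_pow_mult)
      finally have yh: "y = h [^] (1 + int p * r * (m' - 1))" .
      have "h = x [^] (1 - m') \<otimes> y [^] (1::int)"
        using x y by (simp add: h_def z_def m_assoc int_pow_diff int_pow_neg m_comm m_lcomm)
      then show ?thesis using xh yh by (rule mem)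
    qed
  next
    case False
    have "coprime (int p) m"
      using False p by (simp add: prime_imp_coprime)
    then obtain u w where uw: "u * int p + w * m = 1"
      by (metis bezout_int coprime_iff_gcd_eq_1)
    define g where "g = x [^] u \<otimes> y [^] w"
    have gc: "g \<in> carrier G" using x y by (simp add: g_def)
    have "g [^] (int p) = x [^] (u * int p) \<otimes> (y [^] (int p)) [^] w"
      using x y by (simp add: g_def int_pow_mult_distrib[OF m_comm] int_pow_pow mult.commute)
    also have "\<dots> = x [^] (u * int p + w * m)"
      using x by (simp add: rootz int_pow_pow int_pow_mult mult.commute)
    finally have xg: "x = g [^] (int p)" using uw x by simp
    have "g [^] m = (x [^] m) [^] u \<otimes> y [^] (w * m)"
      using x y by (simp add: g_def int_pow_mult_distrib[OF m_comm] int_pow_pow mult.commute)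
    also have "\<dots> = y [^] (u * int p + w * m)"
      using y by (simp add: rootz[symmetric] int_pow_pow int_pow_mult mult.commute)
    finally have yg: "y = g [^] m" using uw y by simp
    show ?thesis using g_def xg yg by (rule mem)
  qed
qed

text \<open>Some power \<open>y^k\<close> lies in the group generated by \<open>x\<close>, and the prime factors of \<open>k\<close> are removed one by
one: adjoin \<open>y^(k/p)\<close> to \<open>x\<close>, replace \<open>x\<close> by a generator of the result, and repeat with \<open>k/p\<close>.\<close>
lemma (in comm_group) generate_two_root:
  assumes "x \<in> carrier G" and "y \<in> carrier G" and "k > 0" and "y [^] (k::nat) \<in> generate G {x}"
    and tors: "torsion_group G" and uniq: "unique_prime_order_subgroups G"
  shows "\<exists>h\<in>carrier G. generate G {x, y} = generate G {h}"
  using assms(1-4)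
proof (induction k arbitrary: x rule: less_induct)
  case (less k)
  note x = less.prems(1) and y = less.prems(2)
  show ?case
  proof (cases "k = 1")
    case True
    then have "generate G {x, y} = generate G {x}"
      using less.prems by (intro generate_eqI) (auto intro: generate.incl)
    then show ?thesis using x by blast
  next
    case False
    then obtain p where p: "Factorial_Ring.prime p" "p dvd k" using prime_factor_nat by blast
    define k' where "k' = k div p"
    have k: "k = k' * p" "0 < k'" "k' < k"
      using p less.prems(3) prime_gt_1_nat[OF p(1)] by (auto simp: k'_def elim!: dvdE)
    obtain m :: int where "y [^] k = x [^] m"
      using less.prems(4) generate_pow[OF x] by blast
    then have "(y [^] k') [^] p = x [^] m" using y by (simp add: k(1) nat_pow_pow)
    moreover obtain n :: nat where "n > 0" "x [^] n = \<one>"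
      using tors x by (auto simp: torsion_group_def)
    ultimately obtain h where h: "h \<in> carrier G" "generate G {x, y [^] k'} = generate G {h}"
      using generate_two_prime_root[OF x _ p(1) _ _ _ uniq, of "y [^] k'" m n] y by auto
    have "y [^] k' \<in> generate G {h}" unfolding h(2)[symmetric] by (auto intro: generate.incl)
    then obtain h' where h': "h' \<in> carrier G" "generate G {h, y} = generate G {h'}"
      using less.IH[OF k(3) h(1) y k(2)] by blast
    have "generate G {h, y} = generate G {y, x, y [^] k'}"
      using generate_insert_cong[OF _ _ y h(2)] x y h(1) by (simp add: insert_commute)
    also have "\<dots> = generate G {x, y}"
    proof (rule generate_eqI)
      have "subgroup (generate G {x, y}) G" using x y by (intro generate_is_subgroup) auto
      then have "y [^] int k' \<in> generate G {x, y}"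
        using generate.incl[of y "{x, y}" G] subgroup_int_pow_closed by auto
      then show "{y, x, y [^] k'} \<subseteq> generate G {x, y}"
        by (auto intro: generate.incl simp: int_pow_int)
    qed (use x y in \<open>auto intro: generate.incl\<close>)
    finally show ?thesis using h' by auto
  qed
qed

lemma (in comm_group) unique_prime_order_subgroups_imp_locally_cyclic:
  assumes tors: "torsion_group G" and uniq: "unique_prime_order_subgroups G"
  shows "locally_cyclic G"
proof -
  have ex: "\<exists>h\<in>carrier G. generate G S = generate G {h}" if "finite S" "S \<subseteq> carrier G" for S
    using that
  proof (induction S)
    case empty
    have "generate G {} = generate G {\<one>}"
      by (rule generate_eqI) (auto intro: generate.one)
    then show ?case by blast
  next
    case (insert s S)
    then obtain h where h: "h \<in> carrier G" "generate G S = generate G {h}" by auto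
    obtain n :: nat where "n > 0" "s [^] n = \<one>"
      using tors insert.prems by (auto simp: torsion_group_def)
    then have "\<exists>h'\<in>carrier G. generate G {h, s} = generate G {h'}"
      using insert.prems h(1) by (intro generate_two_root[OF _ _ _ _ tors uniq, of _ _ n]) (auto intro: generate.one)
    then show ?case
      using generate_insert_cong[OF _ _ _ h(2), of s] insert.prems h(1) by (auto simp: insert_commute)
  qed
  have "cyclic_group (subgroup_generated G S)" if S: "finite S" "S \<subseteq> carrier G" for S
  proof -
    obtain h where h: "h \<in> carrier G" "generate G S = generate G {h}" using ex[OF S] by blast
    then have "subgroup_generated G S = subgroup_generated G {h}"
      using S by (simp add: subgroup_generated_def Int_absorb1)
    then show ?thesis by (simp add: cyclic_group_generated)
  qed
  then show ?thesis by (simp add: locally_cyclic_def is_group)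
qed


section \<open>Local finiteness of torsion soluble groups\<close>

text \<open>Stated for a subset of an ambient group, and with the finite subgroup inside that subset, so that it
can be carried along a subnormal series whose terms all live in the same type.\<close>
definition locally_finite_subset :: "('g, 'n) monoid_scheme \<Rightarrow> 'g set \<Rightarrow> bool" where
  "locally_finite_subset G H \<longleftrightarrow>
     (\<forall>S. finite S \<and> S \<subseteq> H \<longrightarrow> (\<exists>F. finite F \<and> subgroup F G \<and> S \<subseteq> F \<and> F \<subseteq> H))"

lemma (in group) finite_generate_singleton:
  assumes "x \<in> carrier G" "n > 0" "x [^] (n::nat) = \<one>"
  shows "finite (generate G {x})"
proof -
  \<comment> \<open>Powers of \<open>x\<close> depend on the exponent modulo \<open>n\<close> only.\<close>
  have "x [^] (i::int) \<in> (\<lambda>k. x [^] k) ` {0..<int n}" for i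
  proof
    have "x [^] (int n * (i div int n)) = \<one>"
      using assms by (simp add: int_pow_pow[symmetric] int_pow_int)
    then have "x [^] (int n * (i div int n) + i mod int n) = x [^] (i mod int n)"
      using assms(1) by (simp only: int_pow_mult int_pow_closed l_one)
    then show "x [^] i = x [^] (i mod int n)" by simp
    show "i mod int n \<in> {0..<int n}" using assms by simp
  qed
  then have "generate G {x} \<subseteq> (\<lambda>k. x [^] k) ` {0..<int n}"
    unfolding generate_pow[OF assms(1)] by auto
  then show ?thesis by (rule finite_subset) simp
qed

lemma (in comm_group) torsion_imp_locally_finite:
  assumes tors: "torsion_group G"
  shows "locally_finite_subset G (carrier G)"
proof -
  have "\<exists>F. finite F \<and> subgroup F G \<and> S \<subseteq> F" if "finite S" "S \<subseteq> carrier G" for S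
    using that
  proof (induction S)
    case empty
    then show ?case using triv_subgroup by blast
  next
    case (insert s S)
    then obtain F where F: "finite F" "subgroup F G" "S \<subseteq> F" by auto
    have s: "s \<in> carrier G" using insert.prems by simp
    obtain n :: nat where "n > 0" "s [^] n = \<one>" using tors s by (auto simp: torsion_group_def)
    then have fin: "finite (generate G {s})" by (rule finite_generate_singleton[OF s])
    have sub: "subgroup (generate G {s}) G" using s by (intro generate_is_subgroup) auto
    have "\<one> \<otimes> s \<in> F <#> generate G {s}"
      unfolding set_mult_def using subgroup.one_closed[OF F(2)] generate.incl[of s "{s}" G] by blast
    then have "s \<in> F <#> generate G {s}" using s by simp
    moreover have "S \<subseteq> F <#> generate G {s}"
    proof
      fix t assume t: "t \<in> S"
      then have "t \<otimes> \<one> \<in> F <#> generate G {s}"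
        unfolding set_mult_def using F(3) generate.one[of G "{s}"] by blast
      then show "t \<in> F <#> generate G {s}" using insert.prems t by auto
    qed
    moreover have "finite (F <#> generate G {s})"
      using F(1) fin unfolding set_mult_def by simp
    ultimately show ?case using mult_subgroups[OF F(2) sub] by blast
  qed
  then show ?thesis unfolding locally_finite_subset_def by (meson subgroup.subset)
qed

lemma (in normal) torsion_group_FactGroup:
  assumes tors: "torsion_group G"
  shows "torsion_group (G Mod H)"
proof -
  interpret \<pi>: group_hom G "G Mod H" "\<lambda>x. H #> x"
    by (intro group_hom.intro group_hom_axioms.intro is_group factorgroup_is_group r_coset_hom_Mod)
  show ?thesis
    unfolding torsion_group_def
  proof (intro conjI ballI)
    fix q assume "q \<in> carrier (G Mod H)"
    then obtain x where x: "x \<in> carrier G" "q = H #> x" by (auto simp: FactGroup_def RCOSETS_def)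
    obtain n :: nat where n: "n > 0" "x [^] n = \<one>"
      using tors x by (auto simp: torsion_group_def)
    have "q [^]\<^bsub>G Mod H\<^esub> n = H #> (x [^] n)" using x \<pi>.hom_nat_pow[of x n] by simp
    also have "\<dots> = \<one>\<^bsub>G Mod H\<^esub>" using n(2) \<pi>.hom_one by simp
    finally show "\<exists>n>0. q [^]\<^bsub>G Mod H\<^esub> (n::nat) = \<one>\<^bsub>G Mod H\<^esub>"
      using n(1) by (intro exI[of _ n]) simp
  qed (rule factorgroup_is_group)
qed

lemma (in group) torsion_group_subgroup:
  assumes "torsion_group G" "subgroup H G"
  shows "torsion_group (G\<lparr>carrier := H\<rparr>)"
  using assms subgroup_imp_group[OF assms(2)] subgroup.subset[OF assms(2)]
  by (auto simp: torsion_group_def nat_pow_consistent[symmetric])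

text \<open>The set \<open>Y\<close> contains the orbit of \<open>\<one>\<close> under right multiplication by \<open>S\<close>.  Finiteness takes care of
inverses: right multiplication by \<open>s\<close> maps \<open>Y\<close> injectively into itself, hence onto itself.\<close>
lemma (in group) finite_right_invariant_imp_finite_generate:
  assumes Y: "finite Y" "Y \<subseteq> carrier G" "\<one> \<in> Y" and S: "S \<subseteq> carrier G"
    and inv: "\<And>x s. x \<in> Y \<Longrightarrow> s \<in> S \<Longrightarrow> x \<otimes> s \<in> Y"
  shows "finite (generate G S)"
proof -
  have "\<forall>x\<in>Y. x \<otimes> h \<in> Y" if "h \<in> generate G S" for h
    using that
  proof induction
    case one
    then show ?case using Y by auto
  next
    case (incl h)
    then show ?case using inv by blast
  next
    case (inv h)
    have h: "h \<in> carrier G" using inv S by blast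
    have "inj_on (\<lambda>x. x \<otimes> h) Y" using inj_on_multc[OF h] Y(2) by (rule inj_on_subset)
    moreover have "(\<lambda>x. x \<otimes> h) ` Y \<subseteq> Y" using assms(5) inv by blast
    ultimately have img: "(\<lambda>x. x \<otimes> h) ` Y = Y" using Y(1) by (metis endo_inj_surj)
    show ?case
    proof
      fix x assume "x \<in> Y"
      then obtain y where y: "y \<in> Y" "x = y \<otimes> h" using img by blast
      then have "x \<otimes> inv h = y" using Y h by (auto simp: m_assoc)
      then show "x \<otimes> inv h \<in> Y" using y by simp
    qed
  next
    case (eng h1 h2)
    have "h1 \<in> carrier G" "h2 \<in> carrier G"
      using eng.hyps generate_in_carrier[OF S] by auto
    then show ?case using eng.IH Y by (auto simp: m_assoc[symmetric])
  qed
  then have "generate G S \<subseteq> Y"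
    using Y generate_in_carrier[OF S] by (metis l_one subsetI)
  then show ?thesis using Y finite_subset by blast
qed

text \<open>A Schreier-type argument.  Let \<open>T\<close> be a finite set of representatives in \<open>H\<close> for a finite subgroup of
the quotient that contains the image of \<open>S\<close>.  Each product \<open>t s\<close> equals \<open>k t'\<close> with \<open>t'\<close> in \<open>T\<close> and \<open>k\<close> in
\<open>N\<close>; only finitely many \<open>k\<close> arise, so they lie in a finite subgroup \<open>M\<close> of \<open>N\<close>, and the finite set
\<open>M T\<close> is stable under right multiplication by \<open>S\<close>.\<close>
lemma (in group) locally_finite_extension:
  assumes H: "subgroup H G" and N: "N \<lhd> G\<lparr>carrier := H\<rparr>"
    and comm: "comm_group (G\<lparr>carrier := H\<rparr> Mod N)" and tors: "torsion_group G"
    and lf: "locally_finite_subset G N"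
  shows "locally_finite_subset G H"
  unfolding locally_finite_subset_def
proof (intro allI impI)
  fix S assume S: "finite S \<and> S \<subseteq> H"
  let ?H = "G\<lparr>carrier := H\<rparr>" and ?Q = "G\<lparr>carrier := H\<rparr> Mod N"
  let ?\<pi> = "\<lambda>x. N #>\<^bsub>?H\<^esub> x"
  interpret H: group ?H using H by (rule subgroup_imp_group)
  interpret N: normal N ?H by (rule N)
  interpret Q: comm_group ?Q by (rule comm)
  interpret \<pi>: group_hom ?H ?Q ?\<pi>
    by unfold_locales (rule N.r_coset_hom_Mod)
  have HG: "H \<subseteq> carrier G" using H by (rule subgroup.subset)
  have surj: "?\<pi> ` H = carrier ?Q"
    by (auto simp: FactGroup_def RCOSETS_def)
  have "torsion_group ?Q"
    using tors H by (intro N.torsion_group_FactGroup torsion_group_subgroup)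
  then have "locally_finite_subset ?Q (carrier ?Q)" by (rule Q.torsion_imp_locally_finite)
  moreover have "finite (?\<pi> ` S)" "?\<pi> ` S \<subseteq> carrier ?Q" using S surj by auto
  ultimately obtain Y where Y: "finite Y" "subgroup Y ?Q" "?\<pi> ` S \<subseteq> Y" "Y \<subseteq> carrier ?Q"
    unfolding locally_finite_subset_def by metis
  then obtain T0 where T0: "T0 \<subseteq> H" "finite T0" "Y = ?\<pi> ` T0"
    using finite_subset_image[of Y ?\<pi> H] surj by metis
  \<comment> \<open>\<open>\<one>\<close> is added because the orbit argument starts from it.\<close>
  define T where "T = insert \<one> T0"
  have T: "T \<subseteq> H" "finite T" "?\<pi> ` T \<subseteq> Y" "\<one> \<in> T"
    using T0 \<pi>.hom_one subgroup.one_closed[OF Y(2)] subgroup.one_closed[OF H] by (auto simp: T_def)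
  have "\<exists>t'\<in>T. t \<otimes> s \<otimes> inv t' \<in> N" if ts: "t \<in> T" "s \<in> S" for t s
  proof -
    have tsH: "t \<in> H" "s \<in> H" using ts T S by auto
    have "?\<pi> t \<otimes>\<^bsub>?Q\<^esub> ?\<pi> s \<in> Y" using ts T Y subgroup.m_closed[OF Y(2)] by blast
    then have "?\<pi> (t \<otimes> s) \<in> Y" using tsH \<pi>.hom_mult[of t s] by simp
    then obtain t' where t': "t' \<in> T0" "?\<pi> (t \<otimes> s) = ?\<pi> t'" unfolding T0(3) by blast
    have t'H: "t' \<in> H" using t' T0 by blast
    have "t \<otimes> s \<in> ?\<pi> t'"
      using t'(2) H.rcos_self[of "t \<otimes> s" N] tsH N.is_subgroup subgroup.m_closed[OF H] by auto
    then obtain n where n: "n \<in> N" "t \<otimes> s = n \<otimes> t'" by (auto simp: r_coset_def)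
    have "n \<in> carrier G" "t' \<in> carrier G" using n(1) N.subset t'H HG by auto
    then have "t \<otimes> s \<otimes> inv t' \<in> N" using n by (simp add: m_assoc)
    then show ?thesis using t' by (auto simp: T_def)
  qed
  then obtain \<tau> where \<tau>: "\<And>t s. t \<in> T \<Longrightarrow> s \<in> S \<Longrightarrow> \<tau> t s \<in> T \<and> t \<otimes> s \<otimes> inv \<tau> t s \<in> N"
    by metis
  define E where "E = (\<lambda>(t, s). t \<otimes> s \<otimes> inv \<tau> t s) ` (T \<times> S)"
  have "finite E" using T S by (simp add: E_def)
  moreover have "E \<subseteq> N" using \<tau> by (auto simp: E_def)
  ultimately obtain M where M: "finite M" "subgroup M G" "M \<subseteq> N" "E \<subseteq> M"
    using lf unfolding locally_finite_subset_def by metis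
  have MG: "M \<subseteq> carrier G" using M by (simp add: subgroup.subset)
  have "finite (generate G S)"
  proof (rule finite_right_invariant_imp_finite_generate)
    show "finite (M <#> T)" using M T by (simp add: set_mult_def)
    show "M <#> T \<subseteq> carrier G" using MG T HG by (intro set_mult_closed) auto
    have "\<one> \<otimes> \<one> \<in> M <#> T" unfolding set_mult_def using subgroup.one_closed[OF M(2)] T(4) by blast
    then show "\<one> \<in> M <#> T" by simp
    show "S \<subseteq> carrier G" using S HG by blast
    fix x s assume "x \<in> M <#> T" and s: "s \<in> S"
    then obtain m t where mt: "m \<in> M" "t \<in> T" "x = m \<otimes> t" by (auto simp: set_mult_def)
    have c: "m \<in> carrier G" "t \<in> carrier G" "s \<in> carrier G" "\<tau> t s \<in> carrier G"
      using mt MG T S HG s \<tau>[of t s] by auto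
    have "x \<otimes> s = (m \<otimes> (t \<otimes> s \<otimes> inv \<tau> t s)) \<otimes> \<tau> t s"
      using c by (simp add: mt m_assoc)
    moreover have "t \<otimes> s \<otimes> inv \<tau> t s \<in> E"
      unfolding E_def using mt s by (intro image_eqI[of _ _ "(t, s)"]) auto
    then have "m \<otimes> (t \<otimes> s \<otimes> inv \<tau> t s) \<in> M"
      using subgroup.m_closed[OF M(2)] M(4) mt by blast
    ultimately show "x \<otimes> s \<in> M <#> T"
      unfolding set_mult_def using \<tau>[of t s] mt(2) s by blast
  qed
  then show "\<exists>F. finite F \<and> subgroup F G \<and> S \<subseteq> F \<and> F \<subseteq> H"
    using S HG H generate_is_subgroup[of S] generate_subgroup_incl[of S H] generate.incl[of _ S G]
    by (intro exI[of _ "generate G S"]) auto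
qed

theorem (in group) torsion_solvable_imp_locally_finite:
  assumes "torsion_group G" "solvable G"
  shows "locally_finite_subset G (carrier G)"
proof -
  have "locally_finite_subset G H" if "solvable_seq G H" for H
    using that
  proof induction
    case unity
    show ?case unfolding locally_finite_subset_def
      using triv_subgroup by blast
  next
    case (extension N H)
    then show ?case using locally_finite_extension assms(1) by blast
  qed
  then show ?thesis using assms(2) by (simp add: solvable_def)
qed


section \<open>Prime orders in quotients\<close>

lemma (in group) subgroup_pow_coprime:
  assumes C: "subgroup C G" and d: "d \<in> carrier G"
    and pow: "d [^] (p::nat) \<in> C" "d [^] (j::nat) \<in> C" and cop: "coprime p j"
  shows "d \<in> C"
proof -
  obtain r s where rs: "r * int p + s * int j = 1"
    using cop by (metis bezout_int coprime_iff_gcd_eq_1 coprime_int_iff)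
  have "(d [^] p) [^] r \<in> C" "(d [^] j) [^] s \<in> C"
    using subgroup_int_pow_closed[OF C] pow by auto
  then have "(d [^] p) [^] r \<otimes> (d [^] j) [^] s \<in> C"
    by (rule subgroup.m_closed[OF C])
  also have "(d [^] p) [^] r \<otimes> (d [^] j) [^] s = d [^] (r * int p + s * int j)"
    using d by (simp add: int_pow_int[symmetric] int_pow_pow int_pow_mult mult.commute)
  finally show ?thesis using rs d by simp
qed

lemma (in group) prime_dvd_ord_imp_prime_order:
  assumes A: "subgroup A G" and a: "a \<in> A" and p: "Factorial_Ring.prime (p::nat)"
    and dvd: "p dvd ord a" and pos: "ord a > 0"
  shows "p \<in> prime_orders (G\<lparr>carrier := A\<rparr>)"
proof -
  have aG: "a \<in> carrier G" using a A by (auto dest: subgroup.subset)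
  obtain m where m: "ord a = p * m" using dvd by blast
  have "m < ord a" "m > 0" using m pos prime_gt_1_nat[OF p] by auto
  then have "a [^] m \<noteq> \<one>" using aG by (auto simp: pow_eq_id dest: nat_dvd_not_less)
  moreover have "(a [^] m) [^] p = \<one>"
    using aG m by (simp add: nat_pow_pow mult.commute pow_eq_id)
  moreover have "a [^] m \<in> A"
    using subgroup_int_pow_closed[OF A a, of "int m"] by (simp add: int_pow_int)
  ultimately show ?thesis
    using p unfolding prime_orders_def by (auto simp: nat_pow_consistent[symmetric])
qed

lemma (in group) torsion_imp_ord_pos:
  assumes "torsion_group G" "a \<in> carrier G"
  shows "ord a > 0"
  using assms by (metis gr0I ord_eq_0 torsion_group_def less_numeral_extra(3))

text \<open>An element of order \<open>p\<close> modulo \<open>C\<close> has order divisible by \<open>p\<close>: otherwise it would be a power of its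
\<open>p\<close>-th power, which lies in \<open>C\<close>.  So primes of a quotient of \<open>A\<close> are already primes of \<open>A\<close>, and an
assumption on the characteristic passes from \<open>A\<close> to its quotients.\<close>
lemma (in group) prime_order_in_quotient_imp_prime_order:
  assumes tors: "torsion_group G" and C: "subgroup C G" and A: "subgroup A G"
    and d: "d \<in> A" "d \<notin> C" "d [^] p \<in> C" and p: "Factorial_Ring.prime (p::nat)"
  shows "p \<in> prime_orders (G\<lparr>carrier := A\<rparr>)"
proof -
  have dG: "d \<in> carrier G" using d A by (auto dest: subgroup.subset)
  have "p dvd ord d"
  proof (rule ccontr)
    assume "\<not> p dvd ord d"
    then have "coprime p (ord d)" using p by (simp add: prime_imp_coprime)
    then have "d \<in> C"
      using subgroup_pow_coprime[OF C dG d(3), of "ord d"] dG subgroup.one_closed[OF C] by simp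
    then show False using d by simp
  qed
  then show ?thesis
    using prime_dvd_ord_imp_prime_order[OF A d(1) p] torsion_imp_ord_pos[OF tors dG] by simp
qed

text \<open>The condition on \<open>G Mod C\<close> unfolded to elements of \<open>G\<close>, so that no cosets are needed when it is proved
or used.\<close>
lemma (in comm_group) unique_prime_order_subgroups_quotient_iff:
  assumes C: "subgroup C G"
  shows "unique_prime_order_subgroups (G Mod C) \<longleftrightarrow>
    (\<forall>q d b. Factorial_Ring.prime (q::nat) \<and> d \<in> carrier G - C \<and> b \<in> carrier G \<and>
       d [^] q \<in> C \<and> b [^] q \<in> C \<longrightarrow> (\<exists>i::int. b \<otimes> d [^] i \<in> C))" (is "?L \<longleftrightarrow> ?R")
proof -
  interpret N: normal C G using C by (rule subgroup_imp_normal)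
  interpret Q: group "G Mod C" by (rule N.factorgroup_is_group)
  interpret \<pi>: group_hom G "G Mod C" "\<lambda>x. C #> x"
    by unfold_locales (rule N.r_coset_hom_Mod)
  have surj: "(\<lambda>x. C #> x) ` carrier G = carrier (G Mod C)"
    by (auto simp: FactGroup_def RCOSETS_def)
  have one: "C #> x = \<one>\<^bsub>G Mod C\<^esub> \<longleftrightarrow> x \<in> C" if "x \<in> carrier G" for x
  proof -
    have "\<one>\<^bsub>G Mod C\<^esub> = C" by (simp add: FactGroup_def)
    then show ?thesis using coset_join1[OF _ that C] coset_join2[OF that C] by auto
  qed
  have pow: "(C #> x) [^]\<^bsub>G Mod C\<^esub> (q::nat) = \<one>\<^bsub>G Mod C\<^esub> \<longleftrightarrow> x [^] q \<in> C" if "x \<in> carrier G" for x q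
    using one[of "x [^] q"] \<pi>.hom_nat_pow[of x q] that by simp
  have gen: "C #> b \<in> generate (G Mod C) {C #> d} \<longleftrightarrow> (\<exists>i::int. b \<otimes> d [^] i \<in> C)"
    if bd: "b \<in> carrier G" "d \<in> carrier G" for b d
  proof -
    have eq: "C #> b = (C #> d) [^]\<^bsub>G Mod C\<^esub> (i::int) \<longleftrightarrow> b \<otimes> d [^] (- i) \<in> C" for i
    proof -
      have "(C #> d) [^]\<^bsub>G Mod C\<^esub> i = C #> (d [^] i)"
        by (rule \<pi>.hom_int_pow[OF bd(2), symmetric])
      moreover have "C #> b = C #> (d [^] i) \<longleftrightarrow> b \<in> C #> (d [^] i)"
        using repr_independence[of b C "d [^] i"] rcos_self[of b C] C bd by auto
      ultimately show ?thesis
        using subgroup.rcos_module[OF C is_group, of "d [^] i" b] bd by (simp add: int_pow_neg)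
    qed
    have "C #> d \<in> carrier (G Mod C)" using bd surj by auto
    then have "C #> b \<in> generate (G Mod C) {C #> d} \<longleftrightarrow> (\<exists>i::int. b \<otimes> d [^] (- i) \<in> C)"
      by (simp add: Q.generate_pow eq)
    also have "\<dots> \<longleftrightarrow> (\<exists>i::int. b \<otimes> d [^] i \<in> C)"
      by (metis minus_minus)
    finally show ?thesis .
  qed
  show ?thesis
  proof
    assume L: ?L
    show ?R
    proof (intro allI impI)
      fix q d b
      assume *: "Factorial_Ring.prime (q::nat) \<and> d \<in> carrier G - C \<and> b \<in> carrier G \<and> d [^] q \<in> C \<and> b [^] q \<in> C"
      then have "C #> b \<in> generate (G Mod C) {C #> d}"
        using L[unfolded unique_prime_order_subgroups_def, rule_format, of q "C #> d" "C #> b"] one pow surj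
        by blast
      then show "\<exists>i::int. b \<otimes> d [^] i \<in> C" using gen * by blast
    qed
  next
    assume R: ?R
    show ?L
      unfolding unique_prime_order_subgroups_def
    proof (intro allI impI)
      fix q :: nat and u v
      assume *: "Factorial_Ring.prime q \<and> u \<in> carrier (G Mod C) \<and> v \<in> carrier (G Mod C) \<and>
        u \<noteq> \<one>\<^bsub>G Mod C\<^esub> \<and> u [^]\<^bsub>G Mod C\<^esub> q = \<one>\<^bsub>G Mod C\<^esub> \<and> v [^]\<^bsub>G Mod C\<^esub> q = \<one>\<^bsub>G Mod C\<^esub>"
      then obtain d b where db: "d \<in> carrier G" "b \<in> carrier G" "u = C #> d" "v = C #> b"
        using surj by (metis imageE)
      then have "\<exists>i::int. b \<otimes> d [^] i \<in> C" using R * one pow by blast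
      then show "v \<in> generate (G Mod C) {u}" using gen db by blast
    qed
  qed
qed

lemma (in comm_group) generate_pow_eq_one:
  assumes "h \<in> generate G S" "S \<subseteq> carrier G" "\<And>s. s \<in> S \<Longrightarrow> s [^] (q::nat) = \<one>"
  shows "h [^] q = \<one>"
  using assms(1)
proof induction
  case (eng h1 h2)
  then show ?case using generate_in_carrier[OF assms(2)] by (simp add: nat_pow_distrib)
qed (use assms(2,3) in \<open>auto simp: nat_pow_inv subset_iff\<close>)

text \<open>If \<open>u\<close> and \<open>v\<close> have exponent \<open>q\<close>, so does a generator \<open>h\<close> of the cyclic group that they generate.
A nontrivial power \<open>u = h^i\<close> then has \<open>i\<close> prime to \<open>q\<close>, hence generates the same group as \<open>h\<close>.\<close>
lemma (in comm_group) locally_cyclic_imp_unique_prime_order_subgroups: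
  assumes lc: "locally_cyclic G"
  shows "unique_prime_order_subgroups G"
  unfolding unique_prime_order_subgroups_def
proof (intro allI impI)
  fix q :: nat and u v
  assume *: "Factorial_Ring.prime q \<and> u \<in> carrier G \<and> v \<in> carrier G \<and> u \<noteq> \<one> \<and> u [^] q = \<one> \<and> v [^] q = \<one>"
  then have q: "Factorial_Ring.prime q" and uv: "u \<in> carrier G" "v \<in> carrier G"
    and u: "u \<noteq> \<one>" "u [^] q = \<one>" "v [^] q = \<one>" by auto
  let ?S = "subgroup_generated G {u, v}"
  interpret S: group ?S by simp
  have car: "carrier ?S = generate G {u, v}"
    using uv by (simp add: carrier_subgroup_generated Int_absorb1)
  have "cyclic_group ?S" using lc uv by (simp add: locally_cyclic_def)
  then obtain h where h: "h \<in> carrier ?S" "carrier ?S = range (\<lambda>n::int. h [^]\<^bsub>?S\<^esub> n)"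
    unfolding S.cyclic_group by blast
  have hS: "h \<in> generate G {u, v}" using h(1) car by simp
  have hG: "h \<in> carrier G" using generate_in_carrier[OF _ hS] uv by blast
  have range: "generate G {u, v} = range (\<lambda>n::int. h [^] n)"
    using h(2) unfolding car int_pow_subgroup_generated[OF h(1)] .
  have hq: "h [^] q = \<one>"
    by (rule generate_pow_eq_one[OF hS]) (use uv u in auto)
  have mem: "u \<in> generate G {u, v}" "v \<in> generate G {u, v}"
    by (auto intro: generate.incl)
  then obtain i j :: int where ij: "u = h [^] i" "v = h [^] j" unfolding range by blast
  have hqi: "h [^] (int q * k) = \<one>" for k :: int
    using hG hq by (simp add: int_pow_pow[symmetric] int_pow_int)
  have "\<not> int q dvd i"
    using hqi ij(1) u(1) by blast
  then have "coprime (int q) i" using q by (simp add: prime_imp_coprime)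
  then obtain r s where rs: "r * int q + s * i = 1"
    by (metis bezout_int coprime_iff_gcd_eq_1)
  have "h = h [^] (int q * r + i * s)" using rs hG by (simp add: mult.commute)
  also have "\<dots> = u [^] s"
    unfolding int_pow_mult[OF hG] hqi using hG by (simp add: ij int_pow_pow)
  finally have "v = u [^] (s * j)" using ij(2) uv by (simp add: int_pow_pow)
  then show "v \<in> generate G {u}" using generate_pow[OF uv(1)] by blast
qed

section \<open>Commuting linear operators on a module\<close>

context module
begin

definition linear_op :: "('c \<Rightarrow> 'c) \<Rightarrow> bool" where
  "linear_op T \<longleftrightarrow> (\<forall>x \<in> carrier M. T x \<in> carrier M) \<and>
     (\<forall>x \<in> carrier M. \<forall>y \<in> carrier M. T (x \<oplus>\<^bsub>M\<^esub> y) = T x \<oplus>\<^bsub>M\<^esub> T y) \<and>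
     (\<forall>a \<in> carrier R. \<forall>x \<in> carrier M. T (a \<odot>\<^bsub>M\<^esub> x) = a \<odot>\<^bsub>M\<^esub> T x)"

definition commuting_ops :: "('i \<Rightarrow> 'c \<Rightarrow> 'c) \<Rightarrow> 'i set \<Rightarrow> bool" where
  "commuting_ops f I \<longleftrightarrow> (\<forall>i \<in> I. linear_op (f i)) \<and>
     (\<forall>i \<in> I. \<forall>j \<in> I. \<forall>v \<in> carrier M. f i (f j v) = f j (f i v))"

text \<open>For commuting operators these are the vectors killed by a product of finitely many distinct ones.
The formulation by all longer products makes closure under addition
a matter of taking the union of two finite sets.\<close>
definition eventual_kernel :: "('i \<Rightarrow> 'c \<Rightarrow> 'c) \<Rightarrow> 'i set \<Rightarrow> 'c set" where
  "eventual_kernel f I = {v \<in> carrier M. \<exists>F. finite F \<and> F \<subseteq> I \<and>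
     (\<forall>xs. F \<subseteq> set xs \<and> set xs \<subseteq> I \<longrightarrow> foldr f xs v = \<zero>\<^bsub>M\<^esub>)}"

lemma linear_op_closed: "linear_op T \<Longrightarrow> x \<in> carrier M \<Longrightarrow> T x \<in> carrier M"
  and linear_op_add: "linear_op T \<Longrightarrow> x \<in> carrier M \<Longrightarrow> y \<in> carrier M \<Longrightarrow> T (x \<oplus>\<^bsub>M\<^esub> y) = T x \<oplus>\<^bsub>M\<^esub> T y"
  and linear_op_smult: "linear_op T \<Longrightarrow> a \<in> carrier R \<Longrightarrow> x \<in> carrier M \<Longrightarrow> T (a \<odot>\<^bsub>M\<^esub> x) = a \<odot>\<^bsub>M\<^esub> T x"
  by (auto simp: linear_op_def)

lemma linear_op_zero: "linear_op T \<Longrightarrow> T \<zero>\<^bsub>M\<^esub> = \<zero>\<^bsub>M\<^esub>"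
  using linear_op_smult[of T \<zero> "\<zero>\<^bsub>M\<^esub>"] linear_op_closed[of T "\<zero>\<^bsub>M\<^esub>"] by simp

lemma linear_op_neg:
  assumes "linear_op T" "x \<in> carrier M" shows "T (\<ominus>\<^bsub>M\<^esub> x) = \<ominus>\<^bsub>M\<^esub> T x"
proof -
  have "T (\<ominus>\<^bsub>M\<^esub> x) \<oplus>\<^bsub>M\<^esub> T x = \<zero>\<^bsub>M\<^esub>"
    using linear_op_add[OF assms(1), of "\<ominus>\<^bsub>M\<^esub> x" x] assms by (simp add: M.l_neg linear_op_zero)
  then show ?thesis using assms by (intro M.minus_equality[symmetric]) (auto simp: linear_op_closed)
qed

lemma linear_op_diff:
  "linear_op T \<Longrightarrow> x \<in> carrier M \<Longrightarrow> y \<in> carrier M \<Longrightarrow> T (x \<ominus>\<^bsub>M\<^esub> y) = T x \<ominus>\<^bsub>M\<^esub> T y"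
  by (simp add: a_minus_def linear_op_add linear_op_neg)

lemma linear_op_finsum:
  assumes T: "linear_op T" and f: "\<And>i. i \<in> I \<Longrightarrow> f i \<in> carrier M"
  shows "T (\<Oplus>\<^bsub>M\<^esub>i\<in>I. f i) = (\<Oplus>\<^bsub>M\<^esub>i\<in>I. T (f i))"
proof (cases "finite I")
  case True
  then show ?thesis using f
  proof (induction I)
    case (insert i I)
    then have "f \<in> I \<rightarrow> carrier M" "(\<lambda>i. T (f i)) \<in> I \<rightarrow> carrier M"
      using T by (auto intro: linear_op_closed)
    then show ?case using insert T by (simp add: M.finsum_insert linear_op_add linear_op_closed)
  qed (simp add: T linear_op_zero)
qed (simp add: T linear_op_zero M.finsum_infinite)

lemma linear_op_foldr: "(\<And>i. i \<in> set xs \<Longrightarrow> linear_op (f i)) \<Longrightarrow> linear_op (foldr f xs)"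
  by (induction xs) (auto simp: linear_op_def)

lemma commuting_ops_linear: "commuting_ops f I \<Longrightarrow> i \<in> I \<Longrightarrow> linear_op (f i)"
  by (simp add: commuting_ops_def)

lemma commuting_ops_foldr: "commuting_ops f I \<Longrightarrow> set xs \<subseteq> I \<Longrightarrow> linear_op (foldr f xs)"
  by (rule linear_op_foldr) (auto simp: commuting_ops_def)

text \<open>A group element \<open>g\<close> intertwines the operator of \<open>a\<close> with that of its conjugate by \<open>g\<close>; this rule extends
the relation to products and so yields the invariance under \<open>G\<close> of subspaces defined by products.\<close>
lemma foldr_intertwine:
  assumes "\<And>i. i \<in> set xs \<Longrightarrow> linear_op (f i)" "v \<in> carrier M"
    and "\<And>i w. i \<in> set xs \<Longrightarrow> w \<in> carrier M \<Longrightarrow> T (f i w) = f (c i) (T w)"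
  shows "T (foldr f xs v) = foldr f (map c xs) (T v)"
  using assms
proof (induction xs)
  case (Cons i xs)
  then have "foldr f xs v \<in> carrier M" by (intro linear_op_closed[OF linear_op_foldr]) auto
  then show ?case using Cons by simp
qed simp

lemma foldr_commute:
  assumes f: "commuting_ops f I" and i: "i \<in> I" and xs: "set xs \<subseteq> I" and v: "v \<in> carrier M"
  shows "f i (foldr f xs v) = foldr f xs (f i v)"
  using foldr_intertwine[of xs f v "f i" "\<lambda>j. j"] f i xs v
  by (auto simp: commuting_ops_def subset_iff)

lemma foldr_eq_zero:
  assumes f: "commuting_ops f I" and v: "v \<in> carrier M"
    and i: "i \<in> set xs" "f i v = \<zero>\<^bsub>M\<^esub>" and xs: "set xs \<subseteq> I"
  shows "foldr f xs v = \<zero>\<^bsub>M\<^esub>"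
  using i(1) xs
proof (induction xs)
  case (Cons j xs)
  then have j: "j \<in> I" "linear_op (f j)" using commuting_ops_linear[OF f] by auto
  show ?case
  proof (cases "i = j")
    case True
    then have "foldr f (j # xs) v = foldr f xs (f i v)"
      using foldr_commute[OF f j(1) _ v] Cons.prems by simp
    then show ?thesis
      using i(2) Cons.prems linear_op_zero[OF commuting_ops_foldr[OF f, of xs]] by simp
  next
    case False
    then show ?thesis using Cons j by (simp add: linear_op_zero)
  qed
qed simp

lemma foldr_eq_funpow:
  assumes f: "commuting_ops f I" and v: "v \<in> carrier M" and i: "i \<in> I" and xs: "set xs \<subseteq> I"
  shows "foldr f xs v = foldr f (filter (\<lambda>j. j \<noteq> i) xs) ((f i ^^ count_list xs i) v)"
  using xs
proof (induction xs)
  case (Cons j xs)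
  have pow: "(f i ^^ n) v \<in> carrier M" for n
    using v commuting_ops_linear[OF f i] by (induction n) (auto intro: linear_op_closed)
  show ?case
    using Cons foldr_commute[OF f i, of "filter (\<lambda>j. j \<noteq> i) xs", OF _ pow] by auto
qed simp

lemma eventual_kernelI:
  assumes "v \<in> carrier M" "finite F" "F \<subseteq> I"
    and "\<And>xs. F \<subseteq> set xs \<Longrightarrow> set xs \<subseteq> I \<Longrightarrow> foldr f xs v = \<zero>\<^bsub>M\<^esub>"
  shows "v \<in> eventual_kernel f I"
  unfolding eventual_kernel_def using assms by blast

lemma eventual_kernelE:
  assumes "v \<in> eventual_kernel f I"
  obtains F where "v \<in> carrier M" "finite F" "F \<subseteq> I"
    "\<And>xs. F \<subseteq> set xs \<Longrightarrow> set xs \<subseteq> I \<Longrightarrow> foldr f xs v = \<zero>\<^bsub>M\<^esub>"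
  using assms unfolding eventual_kernel_def by blast

lemma eventual_kernel_mem:
  assumes f: "commuting_ops f I" and v: "v \<in> carrier M" and i: "i \<in> I" "f i v = \<zero>\<^bsub>M\<^esub>"
  shows "v \<in> eventual_kernel f I"
  by (rule eventual_kernelI[of _ "{i}"]) (use foldr_eq_zero[OF f v _ i(2)] v i(1) in auto)

lemma submodule_eventual_kernel:
  assumes f: "commuting_ops f I"
  shows "submodule (eventual_kernel f I) R M"
proof (rule submoduleI)
  show "eventual_kernel f I \<subseteq> carrier M" by (auto simp: eventual_kernel_def)
  show "\<zero>\<^bsub>M\<^esub> \<in> eventual_kernel f I"
    using linear_op_zero[OF commuting_ops_foldr[OF f]] by (intro eventual_kernelI[of _ "{}"]) auto
next
  fix v assume "v \<in> eventual_kernel f I"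
  then obtain F where v: "v \<in> carrier M" "finite F" "F \<subseteq> I"
      "\<And>xs. F \<subseteq> set xs \<Longrightarrow> set xs \<subseteq> I \<Longrightarrow> foldr f xs v = \<zero>\<^bsub>M\<^esub>"
    by (rule eventual_kernelE) blast
  show "\<ominus>\<^bsub>M\<^esub> v \<in> eventual_kernel f I"
    by (rule eventual_kernelI[OF _ v(2,3)])
       (use v linear_op_neg[OF commuting_ops_foldr[OF f] v(1)] in simp_all)
next
  fix v w assume "v \<in> eventual_kernel f I" and "w \<in> eventual_kernel f I"
  from \<open>v \<in> eventual_kernel f I\<close> obtain F1 where v: "v \<in> carrier M" "finite F1" "F1 \<subseteq> I"
      "\<And>xs. F1 \<subseteq> set xs \<Longrightarrow> set xs \<subseteq> I \<Longrightarrow> foldr f xs v = \<zero>\<^bsub>M\<^esub>"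
    by (rule eventual_kernelE) blast
  from \<open>w \<in> eventual_kernel f I\<close> obtain F2 where w: "w \<in> carrier M" "finite F2" "F2 \<subseteq> I"
      "\<And>xs. F2 \<subseteq> set xs \<Longrightarrow> set xs \<subseteq> I \<Longrightarrow> foldr f xs w = \<zero>\<^bsub>M\<^esub>"
    by (rule eventual_kernelE) blast
  show "v \<oplus>\<^bsub>M\<^esub> w \<in> eventual_kernel f I"
    by (rule eventual_kernelI[of _ "F1 \<union> F2"])
       (use v w linear_op_add[OF commuting_ops_foldr[OF f] v(1) w(1)] in simp_all)
next
  fix a v assume a: "a \<in> carrier R" and "v \<in> eventual_kernel f I"
  from \<open>v \<in> eventual_kernel f I\<close> obtain F where v: "v \<in> carrier M" "finite F" "F \<subseteq> I"
      "\<And>xs. F \<subseteq> set xs \<Longrightarrow> set xs \<subseteq> I \<Longrightarrow> foldr f xs v = \<zero>\<^bsub>M\<^esub>"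
    by (rule eventual_kernelE) blast
  show "a \<odot>\<^bsub>M\<^esub> v \<in> eventual_kernel f I"
    by (rule eventual_kernelI[OF _ v(2,3)])
       (use a v linear_op_smult[OF commuting_ops_foldr[OF f] a v(1)] in simp_all)
qed

lemma diff_eq_zero_iff:
  assumes "x \<in> carrier M" "y \<in> carrier M"
  shows "x \<ominus>\<^bsub>M\<^esub> y = \<zero>\<^bsub>M\<^esub> \<longleftrightarrow> x = y"
proof
  assume "x \<ominus>\<^bsub>M\<^esub> y = \<zero>\<^bsub>M\<^esub>"
  then have "\<ominus>\<^bsub>M\<^esub> (\<ominus>\<^bsub>M\<^esub> y) = x"
    using assms by (intro M.minus_equality) (auto simp: a_minus_def)
  then show "x = y" using assms by simp
qed (use assms in \<open>simp add: a_minus_def M.r_neg\<close>)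

lemma diff_zero: "x \<in> carrier M \<Longrightarrow> x \<ominus>\<^bsub>M\<^esub> \<zero>\<^bsub>M\<^esub> = x"
proof -
  have "\<ominus>\<^bsub>M\<^esub> \<zero>\<^bsub>M\<^esub> = \<zero>\<^bsub>M\<^esub>" by (rule M.minus_equality) auto
  then show "x \<in> carrier M \<Longrightarrow> x \<ominus>\<^bsub>M\<^esub> \<zero>\<^bsub>M\<^esub> = x" by (simp add: a_minus_def)
qed

lemma add_diff_cancel:
  assumes "x \<in> carrier M" "y \<in> carrier M"
  shows "(x \<oplus>\<^bsub>M\<^esub> y) \<ominus>\<^bsub>M\<^esub> x = y"
proof -
  have "(x \<oplus>\<^bsub>M\<^esub> y) \<ominus>\<^bsub>M\<^esub> x = y \<oplus>\<^bsub>M\<^esub> (x \<oplus>\<^bsub>M\<^esub> \<ominus>\<^bsub>M\<^esub> x)"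
    using assms by (simp add: a_minus_def M.a_comm[of x y] M.a_assoc)
  then show ?thesis using assms by (simp add: M.r_neg)
qed

lemma submodule_zero: "submodule {\<zero>\<^bsub>M\<^esub>} R M"
  by (rule submoduleI) auto

lemma submodule_diff:
  "submodule W R M \<Longrightarrow> x \<in> W \<Longrightarrow> y \<in> W \<Longrightarrow> x \<ominus>\<^bsub>M\<^esub> y \<in> W"
  by (simp add: a_minus_def submoduleE)

lemma submodule_zero_mem: "submodule W R M \<Longrightarrow> \<zero>\<^bsub>M\<^esub> \<in> W"
  using subgroup.one_closed[OF submodule.axioms(1)[of W R M]] by simp

lemma submodule_finsum:
  assumes W: "submodule W R M" and f: "\<And>i. i \<in> I \<Longrightarrow> f i \<in> W"
  shows "(\<Oplus>\<^bsub>M\<^esub>i\<in>I. f i) \<in> W"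
proof (cases "finite I")
  case True
  then show ?thesis using f
  proof (induction I)
    case (insert i I)
    then have "f \<in> I \<rightarrow> carrier M" "f i \<in> carrier M" using submoduleE(1)[OF W] by auto
    then show ?case using insert submoduleE(5)[OF W] by (simp add: M.finsum_insert)
  qed (simp add: submodule_zero_mem[OF W])
qed (simp add: submodule_zero_mem[OF W] M.finsum_infinite)

lemma submodule_preimage:
  assumes T: "linear_op T" and W: "submodule W R M"
  shows "submodule {x \<in> carrier M. T x \<in> W} R M"
  by (rule submoduleI)
     (auto simp: linear_op_zero[OF T] linear_op_neg[OF T] linear_op_add[OF T] linear_op_smult[OF T]
        submodule_zero_mem[OF W] submoduleE[OF W])

text \<open>Zorn's lemma.  The group \<open>H\<close> enters through its carrier alone, so the lemma covers invariance under a
subgroup of the group that is represented.\<close>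
lemma subrep_maximal_avoiding:
  assumes L: "subrep L R H M \<phi>" and v: "v \<notin> L"
  obtains W where "subrep W R H M \<phi>" "L \<subseteq> W" "v \<notin> W"
    "\<And>W'. subrep W' R H M \<phi> \<Longrightarrow> W \<subset> W' \<Longrightarrow> v \<in> W'"
proof -
  let ?\<A> = "{W. subrep W R H M \<phi> \<and> L \<subseteq> W \<and> v \<notin> W}"
  have "\<exists>W\<in>?\<A>. \<forall>Y\<in>?\<A>. W \<subseteq> Y \<longrightarrow> Y = W"
  proof (rule subset_Zorn_nonempty)
    show "?\<A> \<noteq> {}" using L v by blast
    fix \<C> assume ne: "\<C> \<noteq> {}" and ch: "subset.chain ?\<A> \<C>"
    have sub: "submodule W R M" and inv: "\<And>g x. g \<in> carrier H \<Longrightarrow> x \<in> W \<Longrightarrow> \<phi> g x \<in> W"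
      and LW: "L \<subseteq> W" and vW: "v \<notin> W" if "W \<in> \<C>" for W
      using ch that unfolding subset.chain_def subrep_def by auto
    have tot: "W1 \<subseteq> W2 \<or> W2 \<subseteq> W1" if "W1 \<in> \<C>" "W2 \<in> \<C>" for W1 W2
      using ch that unfolding subset.chain_def by blast
    have "submodule (\<Union>\<C>) R M"
    proof (rule submoduleI)
      show "\<Union>\<C> \<subseteq> carrier M" using sub submoduleE(1) by blast
      show "\<zero>\<^bsub>M\<^esub> \<in> \<Union>\<C>" using ne sub submodule_zero_mem by blast
      show "\<ominus>\<^bsub>M\<^esub> a \<in> \<Union>\<C>" if "a \<in> \<Union>\<C>" for a using that sub submoduleE(3) by blast
      show "a \<odot>\<^bsub>M\<^esub> x \<in> \<Union>\<C>" if "a \<in> carrier R" "x \<in> \<Union>\<C>" for a x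
        using that sub submoduleE(4) by blast
      show "a \<oplus>\<^bsub>M\<^esub> b \<in> \<Union>\<C>" if ab: "a \<in> \<Union>\<C>" "b \<in> \<Union>\<C>" for a b
      proof -
        obtain W1 W2 where W: "W1 \<in> \<C>" "a \<in> W1" "W2 \<in> \<C>" "b \<in> W2" using ab by blast
        then obtain W where "W \<in> \<C>" "a \<in> W" "b \<in> W" using tot by blast
        then show ?thesis using sub submoduleE(5) by blast
      qed
    qed
    moreover have "\<forall>g \<in> carrier H. \<forall>x \<in> \<Union>\<C>. \<phi> g x \<in> \<Union>\<C>" using inv by blast
    moreover have "L \<subseteq> \<Union>\<C>" using ne LW by blast
    moreover have "v \<notin> \<Union>\<C>" using vW by blast
    ultimately show "\<Union>\<C> \<in> ?\<A>" by (simp add: subrep_def)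
  qed
  then obtain W where W: "W \<in> ?\<A>" "\<forall>Y\<in>?\<A>. W \<subseteq> Y \<longrightarrow> Y = W" by (rule bexE)
  show ?thesis
  proof (rule that)
    show "subrep W R H M \<phi>" "L \<subseteq> W" "v \<notin> W" using W(1) by auto
    fix W' assume W': "subrep W' R H M \<phi>" "W \<subset> W'"
    then have "L \<subseteq> W'" using W(1) by auto
    then show "v \<in> W'" using W(2) W' by auto
  qed
qed

lemma finsum_swap:
  assumes "finite A" "finite B" "\<And>i j. i \<in> A \<Longrightarrow> j \<in> B \<Longrightarrow> f i j \<in> carrier M"
  shows "(\<Oplus>\<^bsub>M\<^esub>i\<in>A. \<Oplus>\<^bsub>M\<^esub>j\<in>B. f i j) = (\<Oplus>\<^bsub>M\<^esub>j\<in>B. \<Oplus>\<^bsub>M\<^esub>i\<in>A. f i j)"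
  using assms(1,3)
proof (induction A)
  case (insert i A)
  have c: "(\<lambda>j. f i j) \<in> B \<rightarrow> carrier M" "(\<lambda>j. \<Oplus>\<^bsub>M\<^esub>i\<in>A. f i j) \<in> B \<rightarrow> carrier M"
      "(\<lambda>i. \<Oplus>\<^bsub>M\<^esub>j\<in>B. f i j) \<in> A \<rightarrow> carrier M" "(\<Oplus>\<^bsub>M\<^esub>j\<in>B. f i j) \<in> carrier M"
    using insert.prems by (auto intro!: M.finsum_closed)
  have "(\<Oplus>\<^bsub>M\<^esub>j\<in>B. \<Oplus>\<^bsub>M\<^esub>i\<in>insert i A. f i j) = (\<Oplus>\<^bsub>M\<^esub>j\<in>B. f i j \<oplus>\<^bsub>M\<^esub> (\<Oplus>\<^bsub>M\<^esub>i\<in>A. f i j))"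
    using insert.hyps insert.prems by (intro M.finsum_cong') (auto intro!: M.finsum_insert M.finsum_closed)
  also have "\<dots> = (\<Oplus>\<^bsub>M\<^esub>j\<in>B. f i j) \<oplus>\<^bsub>M\<^esub> (\<Oplus>\<^bsub>M\<^esub>j\<in>B. \<Oplus>\<^bsub>M\<^esub>i\<in>A. f i j)"
    using c by (intro M.finsum_addf) auto
  finally show ?case using insert c by (simp add: M.finsum_insert)
qed (simp add: M.finsum_zero)

lemma add_pow_smult:
  assumes "v \<in> carrier M"
  shows "[(n::nat)] \<cdot>\<^bsub>M\<^esub> v = ([n] \<cdot>\<^bsub>R\<^esub> \<one>\<^bsub>R\<^esub>) \<odot>\<^bsub>M\<^esub> v"
  using assms by (induction n) (simp_all add: smult_l_distr)

end

lemma (in field) add_pow_one_eq_zero_iff: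
  "[(n::nat)] \<cdot> \<one> = \<zero> \<longleftrightarrow> ring_char R dvd n"
  using add.pow_eq_id[of \<one> n] by (simp add: ring_char_def)

lemma (in ring) add_pow_one_add: "[(m + n :: nat)] \<cdot> \<one> = [m] \<cdot> \<one> \<oplus> [n] \<cdot> \<one>"
  by (simp add: add.nat_pow_mult)

lemma (in field) add_pow_prime_one_eq_zero_iff:
  assumes "Factorial_Ring.prime (p::nat)"
  shows "[p] \<cdot> \<one> = \<zero> \<longleftrightarrow> p = ring_char R"
proof -
  have "ring_char R \<noteq> 1"
    using add_pow_one_eq_zero_iff[of 1] one_not_zero by auto
  then show ?thesis
    using assms unfolding add_pow_one_eq_zero_iff by (auto simp: prime_nat_iff)
qed

section \<open>Operators attached to group elements\<close>

lemma (in group) conjugate_pow: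
  assumes g: "g \<in> carrier G" and a: "a \<in> carrier G"
  shows "(g \<otimes> a \<otimes> inv g) [^] (i::nat) = g \<otimes> a [^] i \<otimes> inv g"
proof (induction i)
  case (Suc i)
  have "inv g \<otimes> (g \<otimes> y) = y" if "y \<in> carrier G" for y
    using that g by (simp add: m_assoc[symmetric])
  then show ?case using Suc a g by (simp add: m_assoc)
qed (use g in simp)

lemma (in group) conjugate_inv_conjugate:
  assumes "g \<in> carrier G" "b \<in> carrier G"
  shows "g \<otimes> (inv g \<otimes> b \<otimes> g) \<otimes> inv g = b"
proof -
  have "g \<otimes> (inv g \<otimes> b \<otimes> g) \<otimes> inv g = (g \<otimes> inv g) \<otimes> b \<otimes> (g \<otimes> inv g)"
    using assms by (simp only: m_assoc m_closed inv_closed)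
  then show ?thesis using assms by simp
qed

lemma (in group) ord_conjugate:
  assumes g: "g \<in> carrier G" and a: "a \<in> carrier G"
  shows "ord (g \<otimes> a \<otimes> inv g) = ord a"
proof -
  have "(g \<otimes> a \<otimes> inv g) [^] (i::nat) = \<one> \<longleftrightarrow> ord a dvd i" for i
  proof -
    have "(g \<otimes> a \<otimes> inv g) [^] i = \<one> \<longleftrightarrow> g \<otimes> a [^] i = \<one> \<otimes> g"
      unfolding conjugate_pow[OF g a] using g a by (intro inv_solve_right') auto
    also have "\<dots> \<longleftrightarrow> a [^] i = \<one>"
      using g a l_cancel[of g "a [^] i" \<one>] by simp
    finally show ?thesis using a by (simp add: pow_eq_id)
  qed
  then show ?thesis
    using g a ord_unique[of "g \<otimes> a \<otimes> inv g" "ord a"] by simp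
qed

sublocale group_representation \<subseteq> G: group G
  using group_hom by (rule group_hom.axioms)

context group_representation
begin

lemma act_closed: "g \<in> carrier G \<Longrightarrow> x \<in> carrier V \<Longrightarrow> \<phi> g x \<in> carrier V"
  by (rule element_image) auto

lemma act_one: "x \<in> carrier V \<Longrightarrow> \<phi> \<one>\<^bsub>G\<^esub> x = x"
  using id_eq_one by (metis restrict_apply')

lemma linear_op_act: "g \<in> carrier G \<Longrightarrow> linear_op (\<phi> g)"
  by (simp add: linear_op_def act_closed rep_add rep_smult)

lemma act_conj:
  assumes "g \<in> carrier G" "a \<in> carrier G" "x \<in> carrier V"
  shows "\<phi> g (\<phi> a x) = \<phi> (g \<otimes>\<^bsub>G\<^esub> a \<otimes>\<^bsub>G\<^esub> inv\<^bsub>G\<^esub> g) (\<phi> g x)"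
proof -
  have "\<phi> (g \<otimes>\<^bsub>G\<^esub> a \<otimes>\<^bsub>G\<^esub> inv\<^bsub>G\<^esub> g) (\<phi> g x) = \<phi> (g \<otimes>\<^bsub>G\<^esub> a \<otimes>\<^bsub>G\<^esub> inv\<^bsub>G\<^esub> g \<otimes>\<^bsub>G\<^esub> g) x"
    using assms by (simp add: composition_rule)
  also have "g \<otimes>\<^bsub>G\<^esub> a \<otimes>\<^bsub>G\<^esub> inv\<^bsub>G\<^esub> g \<otimes>\<^bsub>G\<^esub> g = g \<otimes>\<^bsub>G\<^esub> a"
    using assms by (simp add: G.m_assoc)
  finally show ?thesis using assms by (simp add: composition_rule)
qed

text \<open>The action of \<open>a - 1\<close> and of \<open>1 + a + ... + a^(m-1)\<close> in the group algebra.  Their product is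
\<open>a^m - 1\<close>, and apart from group elements the proof uses no other operators.\<close>
definition shift :: "'g \<Rightarrow> 'v \<Rightarrow> 'v" where
  "shift a x = \<phi> a x \<ominus>\<^bsub>V\<^esub> x"

definition power_sum :: "nat \<Rightarrow> 'g \<Rightarrow> 'v \<Rightarrow> 'v" where
  "power_sum m a x = (\<Oplus>\<^bsub>V\<^esub>i\<in>{..<m}. \<phi> (a [^]\<^bsub>G\<^esub> i) x)"

lemma power_sum_closed: "a \<in> carrier G \<Longrightarrow> x \<in> carrier V \<Longrightarrow> power_sum m a x \<in> carrier V"
  unfolding power_sum_def by (auto intro!: M.finsum_closed act_closed)

lemma shift_closed: "a \<in> carrier G \<Longrightarrow> x \<in> carrier V \<Longrightarrow> shift a x \<in> carrier V"
  by (simp add: shift_def act_closed)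

lemma shift_eq_zero_iff:
  assumes "a \<in> carrier G" "x \<in> carrier V"
  shows "shift a x = \<zero>\<^bsub>V\<^esub> \<longleftrightarrow> \<phi> a x = x"
  using assms by (simp add: shift_def act_closed diff_eq_zero_iff)

lemma linear_op_shift:
  assumes "a \<in> carrier G" shows "linear_op (shift a)"
proof -
  have "shift a (x \<oplus>\<^bsub>V\<^esub> y) = shift a x \<oplus>\<^bsub>V\<^esub> shift a y" if "x \<in> carrier V" "y \<in> carrier V" for x y
    using that assms act_closed[OF assms]
    by (simp add: shift_def rep_add a_minus_def M.minus_add M.a_ac)
  moreover have "shift a (c \<odot>\<^bsub>V\<^esub> x) = c \<odot>\<^bsub>V\<^esub> shift a x" if "c \<in> carrier K" "x \<in> carrier V" for c x
    using that assms act_closed[OF assms]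
    by (simp add: shift_def rep_smult a_minus_def smult_r_distr smult_r_minus)
  ultimately show ?thesis using assms by (simp add: linear_op_def shift_closed)
qed

lemma linear_op_power_sum:
  assumes a: "a \<in> carrier G" shows "linear_op (power_sum m a)"
proof -
  have c: "\<phi> (a [^]\<^bsub>G\<^esub> i) x \<in> carrier V" if "x \<in> carrier V" for x and i :: nat
    using a that by (simp add: act_closed)
  have "power_sum m a (x \<oplus>\<^bsub>V\<^esub> y) = power_sum m a x \<oplus>\<^bsub>V\<^esub> power_sum m a y"
    if "x \<in> carrier V" "y \<in> carrier V" for x y
  proof -
    have "power_sum m a (x \<oplus>\<^bsub>V\<^esub> y) = (\<Oplus>\<^bsub>V\<^esub>i\<in>{..<m}. \<phi> (a [^]\<^bsub>G\<^esub> i) x \<oplus>\<^bsub>V\<^esub> \<phi> (a [^]\<^bsub>G\<^esub> i) y)"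
      unfolding power_sum_def using a that c by (intro M.finsum_cong') (auto simp: rep_add)
    then show ?thesis
      unfolding power_sum_def using c that by (subst (asm) M.finsum_addf) auto
  qed
  moreover have "power_sum m a (k \<odot>\<^bsub>V\<^esub> x) = k \<odot>\<^bsub>V\<^esub> power_sum m a x"
    if "k \<in> carrier K" "x \<in> carrier V" for k x
  proof -
    have "power_sum m a (k \<odot>\<^bsub>V\<^esub> x) = (\<Oplus>\<^bsub>V\<^esub>i\<in>{..<m}. k \<odot>\<^bsub>V\<^esub> \<phi> (a [^]\<^bsub>G\<^esub> i) x)"
      unfolding power_sum_def using a that c by (intro M.finsum_cong') (auto simp: rep_smult)
    then show ?thesis
      unfolding power_sum_def using c that by (subst finsum_smult_ldistr) auto
  qed
  ultimately show ?thesis using a by (simp add: linear_op_def power_sum_closed)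
qed

lemma act_power_sum:
  assumes g: "g \<in> carrier G" and a: "a \<in> carrier G" and x: "x \<in> carrier V"
  shows "\<phi> g (power_sum m a x) = power_sum m (g \<otimes>\<^bsub>G\<^esub> a \<otimes>\<^bsub>G\<^esub> inv\<^bsub>G\<^esub> g) (\<phi> g x)"
proof -
  note conj_pow = G.conjugate_pow[OF g a]
  have "\<phi> g (power_sum m a x) = (\<Oplus>\<^bsub>V\<^esub>i\<in>{..<m}. \<phi> g (\<phi> (a [^]\<^bsub>G\<^esub> i) x))"
    unfolding power_sum_def using g a x by (intro linear_op_finsum linear_op_act) (auto simp: act_closed)
  also have "\<dots> = power_sum m (g \<otimes>\<^bsub>G\<^esub> a \<otimes>\<^bsub>G\<^esub> inv\<^bsub>G\<^esub> g) (\<phi> g x)"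
    unfolding power_sum_def conj_pow using g a x
    by (intro M.finsum_cong') (auto simp: act_conj[OF g] act_closed)
  finally show ?thesis .
qed

lemma act_shift:
  assumes g: "g \<in> carrier G" and a: "a \<in> carrier G" and x: "x \<in> carrier V"
  shows "\<phi> g (shift a x) = shift (g \<otimes>\<^bsub>G\<^esub> a \<otimes>\<^bsub>G\<^esub> inv\<^bsub>G\<^esub> g) (\<phi> g x)"
  using assms by (simp add: shift_def linear_op_diff linear_op_act act_closed act_conj[symmetric])

lemma shift_power_sum:
  assumes a: "a \<in> carrier G" and x: "x \<in> carrier V"
  shows "shift a (power_sum m a x) = shift (a [^]\<^bsub>G\<^esub> m) x"
proof (induction m)
  case 0
  then show ?case
    using x act_one[OF x] linear_op_zero[OF linear_op_shift[OF a]] shift_eq_zero_iff[of "\<one>\<^bsub>G\<^esub>" x]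
    by (simp add: power_sum_def)
next
  case (Suc m)
  have c: "\<phi> (a [^]\<^bsub>G\<^esub> i) x \<in> carrier V" for i :: nat
    using a x by (simp add: act_closed)
  have "power_sum (Suc m) a x = \<phi> (a [^]\<^bsub>G\<^esub> m) x \<oplus>\<^bsub>V\<^esub> power_sum m a x"
    unfolding power_sum_def lessThan_Suc using c by (subst M.finsum_insert) auto
  moreover have "\<phi> a (\<phi> (a [^]\<^bsub>G\<^esub> m) x) = \<phi> (a [^]\<^bsub>G\<^esub> Suc m) x"
    using a x by (simp add: composition_rule[symmetric] G.nat_pow_mult G.nat_pow_comm flip: G.nat_pow_Suc2)
  ultimately have "shift a (power_sum (Suc m) a x) =
      (\<phi> (a [^]\<^bsub>G\<^esub> Suc m) x \<ominus>\<^bsub>V\<^esub> \<phi> (a [^]\<^bsub>G\<^esub> m) x) \<oplus>\<^bsub>V\<^esub> (\<phi> (a [^]\<^bsub>G\<^esub> m) x \<ominus>\<^bsub>V\<^esub> x)"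
    using Suc.IH c a x linear_op_add[OF linear_op_shift[OF a], of "\<phi> (a [^]\<^bsub>G\<^esub> m) x" "power_sum m a x"]
    by (simp add: power_sum_closed) (simp add: shift_def)
  also have "\<dots> = \<phi> (a [^]\<^bsub>G\<^esub> Suc m) x \<ominus>\<^bsub>V\<^esub> x"
    using c[of m] c[of "Suc m"] x by (simp add: a_minus_def M.a_assoc M.r_neg1)
  finally show ?case by (simp add: shift_def)
qed

lemma power_sum_one:
  assumes "x \<in> carrier V"
  shows "power_sum m \<one>\<^bsub>G\<^esub> x = ([m] \<cdot>\<^bsub>K\<^esub> \<one>\<^bsub>K\<^esub>) \<odot>\<^bsub>V\<^esub> x"
proof -
  have "power_sum m \<one>\<^bsub>G\<^esub> x = [m] \<cdot>\<^bsub>V\<^esub> x"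
    unfolding power_sum_def using assms M.add.finprod_const[of x "{..<m}"] by (simp add: act_one)
  then show ?thesis using assms by (simp add: add_pow_smult)
qed

lemma submodule_cancel_smult:
  assumes W: "submodule W K V" and x: "x \<in> carrier V" and c: "c \<in> carrier K" "c \<noteq> \<zero>"
    and mem: "c \<odot>\<^bsub>V\<^esub> x \<in> W"
  shows "x \<in> W"
proof -
  have "inv c \<in> carrier K" "inv c \<otimes> c = \<one>"
    using c field_Units by (auto intro: Units_inv_closed Units_l_inv)
  then show ?thesis
    using submoduleE(4)[OF W, of "inv c" "c \<odot>\<^bsub>V\<^esub> x"] mem c x by (simp add: smult_assoc1[symmetric])
qed

lemma conj_commute:
  assumes "g \<in> carrier G" "a \<in> carrier G" "g \<otimes>\<^bsub>G\<^esub> a = a \<otimes>\<^bsub>G\<^esub> g"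
  shows "g \<otimes>\<^bsub>G\<^esub> a \<otimes>\<^bsub>G\<^esub> inv\<^bsub>G\<^esub> g = a"
  using assms by (simp add: G.m_assoc)

lemma commuting_ops_shift:
  assumes A: "A \<subseteq> carrier G" and comm: "\<And>a b. a \<in> A \<Longrightarrow> b \<in> A \<Longrightarrow> a \<otimes>\<^bsub>G\<^esub> b = b \<otimes>\<^bsub>G\<^esub> a"
  shows "commuting_ops shift A"
proof -
  have "shift a (shift b x) = shift b (shift a x)" if "a \<in> A" "b \<in> A" "x \<in> carrier V" for a b x
  proof -
    have "a \<in> carrier G" "b \<in> carrier G" using that A by auto
    then have "shift a (shift b x) = shift b (\<phi> a x) \<ominus>\<^bsub>V\<^esub> shift b x"
      using that act_shift[of a b x] conj_commute[of a b] comm[of a b]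
      by (simp add: shift_def[of a "shift b x"])
    also have "\<dots> = shift b (shift a x)"
      using \<open>a \<in> carrier G\<close> \<open>b \<in> carrier G\<close> that(3)
      by (simp add: shift_def[of a x] linear_op_diff[OF linear_op_shift] act_closed)
    finally show ?thesis .
  qed
  then show ?thesis using A by (auto simp: commuting_ops_def intro: linear_op_shift)
qed

lemma commuting_ops_power_sum:
  assumes A: "A \<subseteq> carrier G" and comm: "\<And>a b. a \<in> A \<Longrightarrow> b \<in> A \<Longrightarrow> a \<otimes>\<^bsub>G\<^esub> b = b \<otimes>\<^bsub>G\<^esub> a"
  shows "commuting_ops (\<lambda>a. power_sum (n a) a) A"
proof -
  have "power_sum (n a) a (power_sum (n b) b x) = power_sum (n b) b (power_sum (n a) a x)"
    if ab: "a \<in> A" "b \<in> A" and x: "x \<in> carrier V" for a b x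
  proof -
    have c: "a \<in> carrier G" "b \<in> carrier G" using ab A by auto
    have "a [^]\<^bsub>G\<^esub> i \<otimes>\<^bsub>G\<^esub> b = b \<otimes>\<^bsub>G\<^esub> a [^]\<^bsub>G\<^esub> i" for i :: nat
    proof (induction i)
      case (Suc i)
      then show ?case using c comm[OF ab] by (metis G.m_assoc G.nat_pow_Suc G.nat_pow_closed)
    qed (use c in simp)
    then have "\<phi> (a [^]\<^bsub>G\<^esub> i) (power_sum (n b) b x) = power_sum (n b) b (\<phi> (a [^]\<^bsub>G\<^esub> i) x)" for i :: nat
      using act_power_sum[of "a [^]\<^bsub>G\<^esub> i" b x "n b"] conj_commute[of "a [^]\<^bsub>G\<^esub> i" b] c x by simp
    then have "power_sum (n a) a (power_sum (n b) b x) = (\<Oplus>\<^bsub>V\<^esub>i\<in>{..<n a}. power_sum (n b) b (\<phi> (a [^]\<^bsub>G\<^esub> i) x))"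
      by (simp add: power_sum_def[of "n a"])
    also have "\<dots> = power_sum (n b) b (power_sum (n a) a x)"
      unfolding power_sum_def[of "n a"] using c x
      by (intro linear_op_finsum[OF linear_op_power_sum, symmetric]) (auto simp: act_closed)
    finally show ?thesis .
  qed
  then show ?thesis using A by (auto simp: commuting_ops_def intro: linear_op_power_sum)
qed

end

section \<open>The characteristic is not the order of an element of an abelian normal subgroup\<close>

context group_representation
begin

lemma funpow_shift_closed:
  "a \<in> carrier G \<Longrightarrow> x \<in> carrier V \<Longrightarrow> (shift a ^^ n) x \<in> carrier V"
  by (induction n) (auto intro: shift_closed)

text \<open>The binomial expansion of \<open>a^n = (1 + (a - 1))^n\<close>.\<close>
lemma act_pow_binomial:
  assumes a: "a \<in> carrier G" and x: "x \<in> carrier V"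
  shows "\<phi> (a [^]\<^bsub>G\<^esub> n) x = (\<Oplus>\<^bsub>V\<^esub>i\<in>{..n}. ([(n choose i)] \<cdot>\<^bsub>K\<^esub> \<one>\<^bsub>K\<^esub>) \<odot>\<^bsub>V\<^esub> (shift a ^^ i) x)"
proof (induction n)
  case 0
  then show ?case using x by (simp add: act_one M.finsum_0)
next
  case (Suc n)
  define D where "D i = (shift a ^^ i) x" for i
  define c where "c m i = [(m choose i)] \<cdot>\<^bsub>K\<^esub> \<one>\<^bsub>K\<^esub>" for m i
  have D: "D i \<in> carrier V" "shift a (D i) = D (Suc i)" for i
    using a x by (auto simp: D_def intro: funpow_shift_closed)
  have c: "c m i \<in> carrier K" for m i by (simp add: c_def)
  have pascal: "c (Suc n) (Suc i) = c n i \<oplus> c n (Suc i)" for i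
    by (simp only: c_def binomial_Suc_Suc add_pow_one_add)
  have cD: "c m i \<odot>\<^bsub>V\<^esub> D j \<in> carrier V" for m i j using c D by simp
  define y where "y = \<phi> (a [^]\<^bsub>G\<^esub> n) x"
  have y: "y \<in> carrier V" using a x by (simp add: y_def act_closed)
  have y_sum: "y = (\<Oplus>\<^bsub>V\<^esub>i\<in>{..n}. c n i \<odot>\<^bsub>V\<^esub> D i)"
    using Suc by (simp add: y_def c_def D_def)
  have "\<phi> (a [^]\<^bsub>G\<^esub> Suc n) x = \<phi> a y"
    using a x G.nat_pow_Suc2[OF a, of n] composition_rule[of x a "a [^]\<^bsub>G\<^esub> n"] by (simp add: y_def)
  also have "\<dots> = shift a y \<oplus>\<^bsub>V\<^esub> y"
    using a y act_closed[OF a y] by (simp add: shift_def a_minus_def M.a_assoc M.l_neg)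
  also have "shift a y = (\<Oplus>\<^bsub>V\<^esub>i\<in>{..n}. c n i \<odot>\<^bsub>V\<^esub> D (Suc i))"
    unfolding y_sum using cD c D
    by (subst linear_op_finsum[OF linear_op_shift[OF a]])
       (auto intro!: M.finsum_cong' simp: linear_op_smult[OF linear_op_shift[OF a]])
  also have "y = (\<Oplus>\<^bsub>V\<^esub>i\<in>{..Suc n}. c n i \<odot>\<^bsub>V\<^esub> D i)"
  proof -
    have "c n (Suc n) = \<zero>" by (simp add: c_def binomial_eq_0)
    then show ?thesis unfolding y_sum using cD D(1)
      by (subst M.finsum_Suc) (auto intro!: M.finsum_closed)
  qed
  also have "\<dots> = (\<Oplus>\<^bsub>V\<^esub>i\<in>{..n}. c n (Suc i) \<odot>\<^bsub>V\<^esub> D (Suc i)) \<oplus>\<^bsub>V\<^esub> D 0"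
    using cD D(1) by (subst M.finsum_Suc2) (auto simp: c_def)
  also have "(\<Oplus>\<^bsub>V\<^esub>i\<in>{..n}. c n i \<odot>\<^bsub>V\<^esub> D (Suc i)) \<oplus>\<^bsub>V\<^esub>
      ((\<Oplus>\<^bsub>V\<^esub>i\<in>{..n}. c n (Suc i) \<odot>\<^bsub>V\<^esub> D (Suc i)) \<oplus>\<^bsub>V\<^esub> D 0) =
      (\<Oplus>\<^bsub>V\<^esub>i\<in>{..n}. c n i \<odot>\<^bsub>V\<^esub> D (Suc i) \<oplus>\<^bsub>V\<^esub> c n (Suc i) \<odot>\<^bsub>V\<^esub> D (Suc i)) \<oplus>\<^bsub>V\<^esub> D 0"
    using cD D(1) by (subst M.finsum_addf) (auto simp: M.a_assoc intro!: M.finsum_closed)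
  also have "\<dots> = (\<Oplus>\<^bsub>V\<^esub>i\<in>{..n}. c (Suc n) (Suc i) \<odot>\<^bsub>V\<^esub> D (Suc i)) \<oplus>\<^bsub>V\<^esub> D 0"
    using c D(1) by (simp add: pascal smult_l_distr)
  also have "\<dots> = (\<Oplus>\<^bsub>V\<^esub>i\<in>{..Suc n}. c (Suc n) i \<odot>\<^bsub>V\<^esub> D i)"
    using cD D(1) by (subst M.finsum_Suc2) (auto simp: c_def)
  finally show ?case by (simp only: c_def D_def)
qed

text \<open>In characteristic \<open>p\<close> the expansion of \<open>a^p\<close> reduces to \<open>1 + (a - 1)^p\<close>.\<close>
lemma shift_funpow_char:
  assumes a: "a \<in> carrier G" and x: "x \<in> carrier V" and p: "Factorial_Ring.prime p" "p = ring_char K"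
    and ap: "a [^]\<^bsub>G\<^esub> p = \<one>\<^bsub>G\<^esub>"
  shows "(shift a ^^ p) x = \<zero>\<^bsub>V\<^esub>"
proof -
  define t where "t i = ([(p choose i)] \<cdot>\<^bsub>K\<^esub> \<one>\<^bsub>K\<^esub>) \<odot>\<^bsub>V\<^esub> (shift a ^^ i) x" for i
  have t: "t i \<in> carrier V" for i
    using funpow_shift_closed[OF a x] by (simp add: t_def)
  have "t i = \<zero>\<^bsub>V\<^esub>" if "i \<in> {0<..<p}" for i
    using that p dvd_choose_prime[of i p] funpow_shift_closed[OF a x]
    by (simp add: t_def iffD2[OF add_pow_one_eq_zero_iff])
  then have zero: "(\<Oplus>\<^bsub>V\<^esub>i\<in>{0<..<p}. t i) = \<zero>\<^bsub>V\<^esub>"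
    by (rule M.add.finprod_one_eqI)
  have "{..p} = insert 0 (insert p {0<..<p})"
    using prime_gt_0_nat[OF p(1)] by auto
  then have "(\<Oplus>\<^bsub>V\<^esub>i\<in>{..p}. t i) = t 0 \<oplus>\<^bsub>V\<^esub> (t p \<oplus>\<^bsub>V\<^esub> \<zero>\<^bsub>V\<^esub>)"
    using t prime_gt_0_nat[OF p(1)] by (simp add: M.finsum_insert zero)
  also have "(\<Oplus>\<^bsub>V\<^esub>i\<in>{..p}. t i) = x"
    using act_pow_binomial[OF a x, of p] by (simp add: t_def ap act_one x)
  finally have "x = x \<oplus>\<^bsub>V\<^esub> (shift a ^^ p) x"
    using x funpow_shift_closed[OF a x] by (simp add: t_def)
  then show ?thesis
    using x funpow_shift_closed[OF a x] by (metis M.add.l_cancel_one)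
qed

text \<open>The vector \<open>x\<close> is annihilated by the \<open>r\<close>-th power of the augmentation ideal of the group algebra of \<open>B\<close>.\<close>
definition shifts_vanish :: "'g set \<Rightarrow> nat \<Rightarrow> 'v \<Rightarrow> bool" where
  "shifts_vanish B r x \<longleftrightarrow> (\<forall>bs. set bs \<subseteq> B \<and> length bs = r \<longrightarrow> foldr shift bs x = \<zero>\<^bsub>V\<^esub>)"

lemma shifts_vanish_act:
  assumes B: "B \<subseteq> carrier G" and g: "g \<in> carrier G" and x: "x \<in> carrier V"
    and norm: "\<And>b. b \<in> B \<Longrightarrow> inv\<^bsub>G\<^esub> g \<otimes>\<^bsub>G\<^esub> b \<otimes>\<^bsub>G\<^esub> g \<in> B"
    and van: "shifts_vanish B r x"
  shows "shifts_vanish B r (\<phi> g x)"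
  unfolding shifts_vanish_def
proof (intro allI impI)
  fix bs assume bs: "set bs \<subseteq> B \<and> length bs = r"
  define c where "c b = inv\<^bsub>G\<^esub> g \<otimes>\<^bsub>G\<^esub> b \<otimes>\<^bsub>G\<^esub> g" for b
  have cB: "set (map c bs) \<subseteq> B" using bs norm by (auto simp: c_def)
  have undo: "g \<otimes>\<^bsub>G\<^esub> c b \<otimes>\<^bsub>G\<^esub> inv\<^bsub>G\<^esub> g = b" if "b \<in> B" for b
    unfolding c_def using g that B by (intro G.conjugate_inv_conjugate) auto
  have "\<phi> g (foldr shift (map c bs) x) =
      foldr shift (map (\<lambda>b. g \<otimes>\<^bsub>G\<^esub> b \<otimes>\<^bsub>G\<^esub> inv\<^bsub>G\<^esub> g) (map c bs)) (\<phi> g x)"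
    using cB B g x by (intro foldr_intertwine) (auto intro!: linear_op_shift act_shift)
  also have "map (\<lambda>b. g \<otimes>\<^bsub>G\<^esub> b \<otimes>\<^bsub>G\<^esub> inv\<^bsub>G\<^esub> g) (map c bs) = bs"
    unfolding map_map using bs undo by (intro map_idI) (auto simp: subset_iff)
  also have "foldr shift (map c bs) x = \<zero>\<^bsub>V\<^esub>"
    using van cB bs by (simp add: shifts_vanish_def)
  finally show "foldr shift bs (\<phi> g x) = \<zero>\<^bsub>V\<^esub>"
    using linear_op_zero[OF linear_op_act[OF g]] by simp
qed

text \<open>For a finite abelian group of exponent \<open>p\<close> in characteristic \<open>p\<close> the augmentation ideal is nilpotent:
a long enough product of factors \<open>b - 1\<close> contains one of them at least \<open>p\<close> times.\<close>
lemma ex_shifts_vanish: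
  assumes B: "finite B" "B \<subseteq> carrier G" and comm: "\<And>a b. a \<in> B \<Longrightarrow> b \<in> B \<Longrightarrow> a \<otimes>\<^bsub>G\<^esub> b = b \<otimes>\<^bsub>G\<^esub> a"
    and p: "Factorial_Ring.prime p" "p = ring_char K" and Bp: "\<And>a. a \<in> B \<Longrightarrow> a [^]\<^bsub>G\<^esub> p = \<one>\<^bsub>G\<^esub>"
  shows "\<exists>r. \<forall>x\<in>carrier V. shifts_vanish B r x"
proof (intro exI ballI)
  fix x assume x: "x \<in> carrier V"
  have ops: "commuting_ops shift B" using B(2) comm by (rule commuting_ops_shift)
  show "shifts_vanish B (Suc (card B * p)) x"
    unfolding shifts_vanish_def
  proof (intro allI impI)
    fix bs assume bs: "set bs \<subseteq> B \<and> length bs = Suc (card B * p)"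
    have "\<exists>b\<in>set bs. p \<le> count_list bs b"
    proof (rule ccontr)
      assume "\<not> ?thesis"
      then have "length bs \<le> (\<Sum>b\<in>set bs. p)"
        unfolding sum_count_set[of bs "set bs", OF order_refl, symmetric, simplified]
        by (intro sum_mono) (auto simp: not_le)
      also have "\<dots> \<le> card B * p"
        using bs B card_mono[of B "set bs"] by simp
      finally show False using bs by simp
    qed
    then obtain b where b: "b \<in> set bs" "p \<le> count_list bs b" by blast
    have bB: "b \<in> B" "b \<in> carrier G" using b bs B by auto
    have "(shift b ^^ count_list bs b) x = (shift b ^^ (count_list bs b - p)) ((shift b ^^ p) x)"
      using b(2) funpow_add[of "count_list bs b - p" p "shift b"] by simp
    also have "\<dots> = \<zero>\<^bsub>V\<^esub>"
    proof -
      have "(shift b ^^ n) \<zero>\<^bsub>V\<^esub> = \<zero>\<^bsub>V\<^esub>" for n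
        by (induction n) (simp_all add: linear_op_zero[OF linear_op_shift[OF bB(2)]])
      then show ?thesis using shift_funpow_char[OF bB(2) x p Bp[OF bB(1)]] by simp
    qed
    finally show "foldr shift bs x = \<zero>\<^bsub>V\<^esub>"
      using foldr_eq_funpow[OF ops x bB(1), of bs] bs linear_op_zero[OF commuting_ops_foldr[OF ops, of "filter (\<lambda>j. j \<noteq> b) bs"]]
      by (auto simp: subset_iff)
  qed
qed

text \<open>Let \<open>p\<close> be the characteristic and \<open>P\<close> the group of elements of \<open>A\<close> with \<open>a^p = 1\<close>, which is normal in \<open>G\<close>.
For the augmentation ideal \<open>J\<close> of \<open>P\<close>, the subspace \<open>J V\<close> is invariant under \<open>G\<close>, so it is \<open>0\<close> or \<open>V\<close>.  If it is
\<open>0\<close> then \<open>P\<close> acts trivially, against faithfulness.  If it is \<open>V\<close>, a vector \<open>v\<close> is a combination of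
vectors \<open>(a - 1) g v\<close>; as \<open>G\<close> is locally finite, all \<open>a\<close> and \<open>g\<close> involved lie in one finite subgroup \<open>F\<close>,
and the span of \<open>F v\<close> equals its product with the augmentation ideal of the finite group \<open>F \<inter> P\<close>, which
contradicts nilpotency.

The proof replaces \<open>J V\<close> by the larger subspace \<open>T\<close> of all \<open>t\<close> such that, for every sufficiently large finite
subgroup \<open>F\<close> and every \<open>r\<close>, if all products of \<open>r + 1\<close> factors \<open>b - 1\<close> kill \<open>F v\<close>, then all products of \<open>r\<close>
factors kill \<open>t\<close>.  It contains \<open>(a - 1) v\<close> and is invariant, and it misses \<open>v\<close> by minimality of the
nilpotency degree; no linear combinations have to be written down.\<close>
theorem irreducible_imp_char_notin_prime_orders:
  assumes irr: "irreducible_rep K G V \<phi>" and faith: "faithful_rep G V \<phi>"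
    and lf: "locally_finite_subset G (carrier G)"
    and A: "abelian_normal_subgroup A G"
  shows "ring_char K \<notin> prime_orders (G\<lparr>carrier := A\<rparr>)"
proof
  define p where "p = ring_char K"
  assume "ring_char K \<in> prime_orders (G\<lparr>carrier := A\<rparr>)"
  then obtain a0 where p: "Factorial_Ring.prime p" and a0: "a0 \<in> A" "a0 \<noteq> \<one>\<^bsub>G\<^esub>" "a0 [^]\<^bsub>G\<^esub> p = \<one>\<^bsub>G\<^esub>"
    by (auto simp: prime_orders_def p_def G.nat_pow_consistent[symmetric])
  have nA: "A \<lhd> G" and cA: "comm_group (G\<lparr>carrier := A\<rparr>)"
    using A by (auto simp: abelian_normal_subgroup_def)
  interpret A: normal A G by (rule nA)
  define P where "P = {a \<in> A. a [^]\<^bsub>G\<^esub> p = \<one>\<^bsub>G\<^esub>}"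
  have PG: "P \<subseteq> carrier G" using A.subset by (auto simp: P_def)
  have comm: "a \<otimes>\<^bsub>G\<^esub> b = b \<otimes>\<^bsub>G\<^esub> a" if "a \<in> P" "b \<in> P" for a b
    using comm_group.axioms(1)[OF cA] that comm_monoid.m_comm[of "G\<lparr>carrier := A\<rparr>" a b]
    by (simp add: P_def)
  have conjP: "inv\<^bsub>G\<^esub> g \<otimes>\<^bsub>G\<^esub> b \<otimes>\<^bsub>G\<^esub> g \<in> P" if gb: "g \<in> carrier G" "b \<in> P" for g b
  proof -
    have b: "b \<in> A" "b \<in> carrier G" "b [^]\<^bsub>G\<^esub> p = \<one>\<^bsub>G\<^esub>" using gb PG by (auto simp: P_def)
    have "inv\<^bsub>G\<^esub> g \<otimes>\<^bsub>G\<^esub> b \<otimes>\<^bsub>G\<^esub> g \<in> A" using A.inv_op_closed1[OF gb(1) b(1)] .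
    moreover have "(inv\<^bsub>G\<^esub> g \<otimes>\<^bsub>G\<^esub> b \<otimes>\<^bsub>G\<^esub> g) [^]\<^bsub>G\<^esub> p = \<one>\<^bsub>G\<^esub>"
      using G.conjugate_pow[of "inv\<^bsub>G\<^esub> g" b p] gb b by simp
    ultimately show ?thesis by (simp add: P_def)
  qed
  obtain v where v: "v \<in> carrier V" "v \<noteq> \<zero>\<^bsub>V\<^esub>" "\<phi> a0 v \<noteq> v"
    using faith a0 A.subset linear_op_zero[OF linear_op_act, of a0] unfolding faithful_rep_def by blast
  define Q where "Q F t \<longleftrightarrow> (\<forall>r. (\<forall>g\<in>F. shifts_vanish (F \<inter> P) (Suc r) (\<phi> g v)) \<longrightarrow>
     shifts_vanish (F \<inter> P) r t)" for F t
  \<comment> \<open>\<open>F0\<close> witnesses that the condition on \<open>t\<close> holds for all large finite subgroups.\<close>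
  define E where "E t F0 \<longleftrightarrow> finite F0 \<and> F0 \<subseteq> carrier G \<and>
     (\<forall>F. finite F \<and> subgroup F G \<and> F0 \<subseteq> F \<longrightarrow> Q F t)" for t F0
  have EI: "E t F0" if "finite F0" "F0 \<subseteq> carrier G"
      "\<And>F. finite F \<Longrightarrow> subgroup F G \<Longrightarrow> F0 \<subseteq> F \<Longrightarrow> Q F t" for t F0
    using that by (simp add: E_def)
  have ED: "finite F0" "F0 \<subseteq> carrier G"
      "\<And>F. finite F \<Longrightarrow> subgroup F G \<Longrightarrow> F0 \<subseteq> F \<Longrightarrow> Q F t" if "E t F0" for t F0
    using that by (simp_all add: E_def)
  define T where "T = {t \<in> carrier V. \<exists>F0. E t F0}"
  have lin: "linear_op (foldr shift bs)" if "set bs \<subseteq> P" for bs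
    using that PG by (intro linear_op_foldr linear_op_shift) auto
  have Q_zero: "Q F \<zero>\<^bsub>V\<^esub>" for F
    by (simp add: Q_def shifts_vanish_def linear_op_zero[OF lin])
  have Q_neg: "Q F (\<ominus>\<^bsub>V\<^esub> t)" if "t \<in> carrier V" "Q F t" for F t
    using that(2) by (simp add: Q_def shifts_vanish_def linear_op_neg[OF lin that(1)])
  have Q_add: "Q F (s \<oplus>\<^bsub>V\<^esub> t)" if "s \<in> carrier V" "t \<in> carrier V" "Q F s" "Q F t" for F s t
    using that(3,4) by (simp add: Q_def shifts_vanish_def linear_op_add[OF lin that(1,2)])
  have Q_smult: "Q F (c \<odot>\<^bsub>V\<^esub> t)" if "c \<in> carrier K" "t \<in> carrier V" "Q F t" for F c t
    using that(1,3) by (simp add: Q_def shifts_vanish_def linear_op_smult[OF lin that(1,2)])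
  have conjF: "inv\<^bsub>G\<^esub> g \<otimes>\<^bsub>G\<^esub> b \<otimes>\<^bsub>G\<^esub> g \<in> F \<inter> P"
    if F: "subgroup F G" and "g \<in> F" "b \<in> F \<inter> P" for F g b
  proof
    show "inv\<^bsub>G\<^esub> g \<otimes>\<^bsub>G\<^esub> b \<otimes>\<^bsub>G\<^esub> g \<in> F"
      using that(2,3) by (auto intro: subgroup.m_closed[OF F] subgroup.m_inv_closed[OF F])
    show "inv\<^bsub>G\<^esub> g \<otimes>\<^bsub>G\<^esub> b \<otimes>\<^bsub>G\<^esub> g \<in> P"
      using that(2,3) subgroup.subset[OF F] by (intro conjP) auto
  qed
  have Q_act: "Q F (\<phi> h t)" if F: "subgroup F G" and h: "h \<in> F" and t: "t \<in> carrier V" "Q F t" for F h t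
    unfolding Q_def
  proof (intro allI impI)
    fix r assume "\<forall>g\<in>F. shifts_vanish (F \<inter> P) (Suc r) (\<phi> g v)"
    then have "shifts_vanish (F \<inter> P) r t" using t(2) by (simp add: Q_def)
    then show "shifts_vanish (F \<inter> P) r (\<phi> h t)"
      using h t(1) PG subgroup.subset[OF F] conjF[OF F h] by (intro shifts_vanish_act) auto
  qed
  have TV: "T \<subseteq> carrier V" by (auto simp: T_def)
  have "submodule T K V"
  proof (rule submoduleI)
    show "T \<subseteq> carrier V" by (rule TV)
    have "E \<zero>\<^bsub>V\<^esub> {}" by (rule EI) (auto simp: Q_zero)
    then show "\<zero>\<^bsub>V\<^esub> \<in> T" by (auto simp: T_def)
  next
    fix t assume "t \<in> T"
    then obtain F0 where t: "t \<in> carrier V" "E t F0" by (auto simp: T_def)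
    have "E (\<ominus>\<^bsub>V\<^esub> t) F0" using ED[OF t(2)] t(1) by (intro EI Q_neg)
    then show "\<ominus>\<^bsub>V\<^esub> t \<in> T" using t by (auto simp: T_def)
  next
    fix s t assume "s \<in> T" "t \<in> T"
    then obtain F0 F1 where s: "s \<in> carrier V" "E s F0" and t: "t \<in> carrier V" "E t F1"
      by (auto simp: T_def)
    have "E (s \<oplus>\<^bsub>V\<^esub> t) (F0 \<union> F1)"
      using ED[OF s(2)] ED[OF t(2)] s(1) t(1) by (intro EI Q_add) auto
    then show "s \<oplus>\<^bsub>V\<^esub> t \<in> T" using s t by (auto simp: T_def)
  next
    fix c t assume c: "c \<in> carrier K" and "t \<in> T"
    then obtain F0 where t: "t \<in> carrier V" "E t F0" by (auto simp: T_def)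
    have "E (c \<odot>\<^bsub>V\<^esub> t) F0" using ED[OF t(2)] t(1) c by (intro EI Q_smult)
    then show "c \<odot>\<^bsub>V\<^esub> t \<in> T" using t c by (auto simp: T_def)
  qed
  moreover have "\<phi> h t \<in> T" if h: "h \<in> carrier G" and "t \<in> T" for h t
  proof -
    obtain F0 where t: "t \<in> carrier V" "E t F0" using \<open>t \<in> T\<close> by (auto simp: T_def)
    have "E (\<phi> h t) (insert h F0)"
      using ED[OF t(2)] t(1) h by (intro EI Q_act) auto
    then show ?thesis using t h by (auto simp: T_def act_closed)
  qed
  ultimately have "subrep T K G V \<phi>" by (simp add: subrep_def)
  then have "T = {\<zero>\<^bsub>V\<^esub>} \<or> T = carrier V" using irr by (simp add: irreducible_rep_def)
  moreover have "v \<notin> T"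
  proof
    assume "v \<in> T"
    then obtain F0 where "E v F0" by (auto simp: T_def)
    note F0 = ED[OF this]
    obtain F where F: "finite F" "subgroup F G" "F0 \<subseteq> F"
      using lf[unfolded locally_finite_subset_def, rule_format, OF conjI, OF F0(1,2)] by (elim exE conjE)
    have FG: "F \<subseteq> carrier G" using F(2) by (rule subgroup.subset)
    have Q: "Q F v" using F by (rule F0(3))
    define B where "B = F \<inter> P"
    have "\<exists>r. \<forall>x\<in>carrier V. shifts_vanish B r x"
      unfolding B_def using F(1) FG comm p by (intro ex_shifts_vanish) (auto simp: p_def[symmetric] P_def)
    then have ex: "\<exists>r. \<forall>g\<in>F. shifts_vanish B r (\<phi> g v)"
      using FG v(1) act_closed by blast
    \<comment> \<open>The nilpotency degree on \<open>F v\<close>; membership of \<open>v\<close> in \<open>T\<close> lowers it by one.\<close>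
    define r where "r = (LEAST r. \<forall>g\<in>F. shifts_vanish B r (\<phi> g v))"
    have r: "\<forall>g\<in>F. shifts_vanish B r (\<phi> g v)" unfolding r_def using ex by (rule LeastI_ex)
    show False
    proof (cases r)
      case 0
      then have "shifts_vanish B 0 (\<phi> \<one>\<^bsub>G\<^esub> v)" using r subgroup.one_closed[OF F(2)] by blast
      then have "foldr shift [] (\<phi> \<one>\<^bsub>G\<^esub> v) = \<zero>\<^bsub>V\<^esub>"
        unfolding shifts_vanish_def by (elim allE[of _ "[]"]) simp
      then show False using v by (simp add: act_one)
    next
      case (Suc r')
      then have vr': "shifts_vanish B r' v" using Q r by (simp add: Q_def B_def)
      have "shifts_vanish B r' (\<phi> g v)" if g: "g \<in> F" for g
        using g FG conjF[OF F(2) g] by (intro shifts_vanish_act[OF _ _ v(1) _ vr']) (auto simp: B_def)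
      then have "r \<le> r'" unfolding r_def by (intro Least_le) blast
      then show False using Suc by simp
    qed
  qed
  ultimately have T0: "T = {\<zero>\<^bsub>V\<^esub>}" using v(1) by blast
  have a0P: "a0 \<in> P" "a0 \<in> carrier G" using a0 A.subset by (auto simp: P_def)
  have "E (shift a0 v) {a0}"
  proof (rule EI)
    fix F assume F: "finite F" "subgroup F G" "{a0} \<subseteq> F"
    show "Q F (shift a0 v)"
      unfolding Q_def shifts_vanish_def
    proof (intro allI impI)
      fix r bs
      assume "\<forall>g\<in>F. \<forall>bs. set bs \<subseteq> F \<inter> P \<and> length bs = Suc r \<longrightarrow> foldr shift bs (\<phi> g v) = \<zero>\<^bsub>V\<^esub>"
        and bs: "set bs \<subseteq> F \<inter> P \<and> length bs = r"
      moreover have "\<one>\<^bsub>G\<^esub> \<in> F" "set (bs @ [a0]) \<subseteq> F \<inter> P" "length (bs @ [a0]) = Suc r"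
        using F bs a0P subgroup.one_closed[OF F(2)] by auto
      ultimately have "foldr shift (bs @ [a0]) (\<phi> \<one>\<^bsub>G\<^esub> v) = \<zero>\<^bsub>V\<^esub>" by blast
      then show "foldr shift bs (shift a0 v) = \<zero>\<^bsub>V\<^esub>" using v by (simp add: act_one)
    qed
  qed (use a0P in auto)
  then have "shift a0 v \<in> T" using a0P v by (auto simp: T_def shift_closed)
  then show False using T0 v a0P by (simp add: shift_eq_zero_iff)
qed

end

section \<open>A core-free subgroup with locally cyclic quotient\<close>

context group_representation
begin

text \<open>The elements of \<open>A\<close> that fix \<open>v\<close> modulo \<open>W\<close>.  For commutative \<open>A\<close> they fix the whole submodule generated
by \<open>v\<close> modulo \<open>W\<close>.\<close>
definition inertia :: "'g set \<Rightarrow> 'v set \<Rightarrow> 'v \<Rightarrow> 'g set" where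
  "inertia A W v = {a \<in> A. shift a v \<in> W}"

lemma shift_mult:
  assumes "a \<in> carrier G" "b \<in> carrier G" "x \<in> carrier V"
  shows "shift (a \<otimes>\<^bsub>G\<^esub> b) x = \<phi> a (shift b x) \<oplus>\<^bsub>V\<^esub> shift a x"
proof -
  have c: "\<phi> a x \<in> carrier V" "\<phi> a (\<phi> b x) \<in> carrier V" using assms by (simp_all add: act_closed)
  have "\<phi> a (shift b x) = \<phi> a (\<phi> b x) \<ominus>\<^bsub>V\<^esub> \<phi> a x"
    using assms by (simp add: shift_def linear_op_diff[OF linear_op_act] act_closed)
  then show ?thesis
    using assms c by (simp add: shift_def composition_rule a_minus_def M.a_assoc M.r_neg1)
qed

lemma shift_inv:
  assumes "a \<in> carrier G" "x \<in> carrier V"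
  shows "shift (inv\<^bsub>G\<^esub> a) x = \<ominus>\<^bsub>V\<^esub> \<phi> (inv\<^bsub>G\<^esub> a) (shift a x)"
proof -
  have "\<phi> (inv\<^bsub>G\<^esub> a) (shift a x) \<oplus>\<^bsub>V\<^esub> shift (inv\<^bsub>G\<^esub> a) x = \<zero>\<^bsub>V\<^esub>"
    using shift_mult[of "inv\<^bsub>G\<^esub> a" a x] assms shift_eq_zero_iff[of "\<one>\<^bsub>G\<^esub>" x] by (simp add: act_one)
  then have "shift (inv\<^bsub>G\<^esub> a) x \<oplus>\<^bsub>V\<^esub> \<phi> (inv\<^bsub>G\<^esub> a) (shift a x) = \<zero>\<^bsub>V\<^esub>"
    using assms by (simp add: M.a_comm act_closed shift_closed)
  then show ?thesis
    using assms by (intro M.minus_equality[symmetric]) (auto simp: act_closed shift_closed)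
qed

lemma subgroup_inertia:
  assumes A: "subgroup A G" and W: "subrep W K (G\<lparr>carrier := A\<rparr>) V \<phi>" and v: "v \<in> carrier V"
  shows "subgroup (inertia A W v) G"
proof (rule G.subgroupI)
  have sW: "submodule W K V" and iW: "\<And>a x. a \<in> A \<Longrightarrow> x \<in> W \<Longrightarrow> \<phi> a x \<in> W"
    using W by (auto simp: subrep_def)
  show "inertia A W v \<subseteq> carrier G" using subgroup.subset[OF A] by (auto simp: inertia_def)
  have "shift \<one>\<^bsub>G\<^esub> v = \<zero>\<^bsub>V\<^esub>" using v by (simp add: shift_eq_zero_iff act_one)
  then have "\<one>\<^bsub>G\<^esub> \<in> inertia A W v"
    using subgroup.one_closed[OF A] submodule_zero_mem[OF sW] by (simp add: inertia_def)
  then show "inertia A W v \<noteq> {}" by blast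
  fix a assume a: "a \<in> inertia A W v"
  then have aG: "a \<in> carrier G" using subgroup.subset[OF A] by (auto simp: inertia_def)
  show "inv\<^bsub>G\<^esub> a \<in> inertia A W v"
    using a aG v iW[of "inv\<^bsub>G\<^esub> a"] subgroup.m_inv_closed[OF A] submoduleE(3)[OF sW]
    by (auto simp: inertia_def shift_inv)
  fix b assume b: "b \<in> inertia A W v"
  then have "b \<in> carrier G" using subgroup.subset[OF A] by (auto simp: inertia_def)
  then show "a \<otimes>\<^bsub>G\<^esub> b \<in> inertia A W v"
    using a b aG v iW[of a] subgroup.m_closed[OF A] submoduleE(5)[OF sW]
    by (auto simp: inertia_def shift_mult)
qed

text \<open>Modulo \<open>W\<close> the element \<open>n\<close> fixes \<open>u\<close>, so its power sum acts on \<open>u\<close> as the scalar \<open>m\<close>.\<close>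
lemma power_sum_cancel:
  assumes subA: "subgroup A G" and W: "subrep W K (G\<lparr>carrier := A\<rparr>) V \<phi>"
    and n: "n \<in> A" and u: "u \<in> carrier V" "shift n u \<in> W"
    and sum: "power_sum m n u \<in> W" and m: "[m] \<cdot>\<^bsub>K\<^esub> \<one>\<^bsub>K\<^esub> \<noteq> \<zero>"
  shows "u \<in> W"
proof -
  have nG: "n \<in> carrier G" using n subgroup.subset[OF subA] by blast
  have subW: "submodule W K V" using W by (simp add: subrep_def)
  have "n [^]\<^bsub>G\<^esub> (int i) \<in> inertia A W u" for i
    using G.subgroup_int_pow_closed[OF subgroup_inertia[OF subA W u(1)]] n u(2)
    by (simp add: inertia_def)
  then have sh: "shift (n [^]\<^bsub>G\<^esub> i) u \<in> W" for i :: nat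
    by (simp add: inertia_def int_pow_int)
  have c: "\<phi> (n [^]\<^bsub>G\<^esub> i) u \<in> carrier V" "shift (n [^]\<^bsub>G\<^esub> i) u \<in> carrier V" for i :: nat
    using nG u by (auto intro: act_closed shift_closed)
  have "power_sum m n u = (\<Oplus>\<^bsub>V\<^esub>i\<in>{..<m}. shift (n [^]\<^bsub>G\<^esub> i) u \<oplus>\<^bsub>V\<^esub> u)"
    unfolding power_sum_def using c u
    by (intro M.finsum_cong') (auto simp: shift_def a_minus_def M.a_assoc M.l_neg)
  also have "\<dots> = (\<Oplus>\<^bsub>V\<^esub>i\<in>{..<m}. shift (n [^]\<^bsub>G\<^esub> i) u) \<oplus>\<^bsub>V\<^esub> (\<Oplus>\<^bsub>V\<^esub>i\<in>{..<m}. u)"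
    using c u by (intro M.finsum_addf) auto
  also have "(\<Oplus>\<^bsub>V\<^esub>i\<in>{..<m}. u) = power_sum m \<one>\<^bsub>G\<^esub> u"
    using u by (simp add: power_sum_def act_one)
  finally have eq: "power_sum m n u =
    (\<Oplus>\<^bsub>V\<^esub>i\<in>{..<m}. shift (n [^]\<^bsub>G\<^esub> i) u) \<oplus>\<^bsub>V\<^esub> power_sum m \<one>\<^bsub>G\<^esub> u" (is "_ = ?s \<oplus>\<^bsub>V\<^esub> ?h") .
  have s: "?s \<in> W" using sh by (intro submodule_finsum[OF subW])
  then have "(?s \<oplus>\<^bsub>V\<^esub> ?h) \<ominus>\<^bsub>V\<^esub> ?s \<in> W" using submodule_diff[OF subW sum] by (simp add: eq)
  moreover have "?h \<in> carrier V" "?s \<in> carrier V"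
    using u s submoduleE(1)[OF subW] by (auto intro: power_sum_closed)
  ultimately have "?h \<in> W" by (simp add: M.a_comm[of ?s ?h] a_minus_def M.a_assoc M.r_neg)
  then show ?thesis
    using u m by (intro submodule_cancel_smult[OF subW u(1), of "[m] \<cdot>\<^bsub>K\<^esub> \<one>\<^bsub>K\<^esub>"]) (auto simp: power_sum_one)
qed

end

text \<open>If \<open>W\<close> is maximal among the \<open>A\<close>-invariant subspaces that avoid \<open>v\<close>, every nonzero \<open>A\<close>-invariant subspace of
\<open>V/W\<close> contains the image of \<open>v\<close>.  That image therefore generates a simple module, whose annihilator
is a maximal ideal of the group algebra of \<open>A\<close>; the group \<open>C\<close> below is the kernel of \<open>A\<close> acting on it.\<close>
locale maximal_avoiding_subrep = group_representation K G V \<phi>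
  for K :: "('k, 'm) ring_scheme" (structure) and G :: "('g, 'n) monoid_scheme"
    and V :: "('k, 'v, 'w) module_scheme" and \<phi> :: "'g \<Rightarrow> 'v \<Rightarrow> 'v" +
  fixes A :: "'g set" and W :: "'v set" and v :: 'v
  assumes subA: "subgroup A G"
    and commA: "\<And>a b. a \<in> A \<Longrightarrow> b \<in> A \<Longrightarrow> a \<otimes>\<^bsub>G\<^esub> b = b \<otimes>\<^bsub>G\<^esub> a"
    and v: "v \<in> carrier V"
    and W: "subrep W K (G\<lparr>carrier := A\<rparr>) V \<phi>" and vW: "v \<notin> W"
    and maxW: "\<And>W'. subrep W' K (G\<lparr>carrier := A\<rparr>) V \<phi> \<Longrightarrow> W \<subset> W' \<Longrightarrow> v \<in> W'"
begin

abbreviation "C \<equiv> inertia A W v"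

lemma subW: "submodule W K V" and actW: "\<And>a x. a \<in> A \<Longrightarrow> x \<in> W \<Longrightarrow> \<phi> a x \<in> W"
  using W by (auto simp: subrep_def)

lemma AG: "A \<subseteq> carrier G" using subA by (rule subgroup.subset)

lemma subC: "subgroup C G" using subA W v by (rule subgroup_inertia)

lemma pow_mem: "a \<in> A \<Longrightarrow> a [^]\<^bsub>G\<^esub> (n::nat) \<in> A"
  using G.subgroup_int_pow_closed[OF subA, of a "int n"] by (simp add: int_pow_int)

lemma shift_preserves_W: "a \<in> A \<Longrightarrow> x \<in> W \<Longrightarrow> shift a x \<in> W"
  unfolding shift_def using submodule_diff[OF subW] actW by blast

lemma power_sum_preserves_W: "a \<in> A \<Longrightarrow> x \<in> W \<Longrightarrow> power_sum m a x \<in> W"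
  unfolding power_sum_def by (intro submodule_finsum[OF subW] actW pow_mem)

text \<open>The annihilator of the image of \<open>v\<close> is prime: the vectors that \<open>a - 1\<close> maps into \<open>W\<close> form an
\<open>A\<close>-invariant subspace, and if it is strictly larger than \<open>W\<close> then it contains \<open>v\<close>.\<close>
lemma shift_prime:
  assumes a: "a \<in> A" and u: "u \<in> carrier V" "u \<notin> W" "shift a u \<in> W"
  shows "a \<in> C"
proof -
  have aG: "a \<in> carrier G" using a AG by blast
  let ?W' = "{x \<in> carrier V. shift a x \<in> W}"
  have "submodule ?W' K V" using linear_op_shift[OF aG] subW by (rule submodule_preimage)
  moreover have "\<phi> b x \<in> ?W'" if "b \<in> A" "x \<in> ?W'" for b x
  proof -
    have bG: "b \<in> carrier G" using that AG by blast
    have "shift a (\<phi> b x) = \<phi> b (shift a x)"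
      using act_shift[OF bG aG, of x] conj_commute[OF bG aG commA[OF that(1) a]] that by simp
    then show ?thesis using that actW bG by (auto intro: act_closed)
  qed
  ultimately have "subrep ?W' K (G\<lparr>carrier := A\<rparr>) V \<phi>" by (simp add: subrep_def)
  moreover have "W \<subset> ?W'"
    using u shift_preserves_W[OF a] submoduleE(1)[OF subW] by blast
  ultimately have "v \<in> ?W'" by (rule maxW)
  then show ?thesis using a by (simp add: inertia_def)
qed

lemma power_sum_mem_W:
  assumes a: "a \<in> A" "a \<notin> C" "a [^]\<^bsub>G\<^esub> (m::nat) \<in> C"
  shows "power_sum m a v \<in> W"
proof (rule ccontr)
  assume "power_sum m a v \<notin> W"
  moreover have "shift a (power_sum m a v) \<in> W"
    using a AG v by (subst shift_power_sum) (auto simp: inertia_def)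
  ultimately have "a \<in> C" using a AG v by (intro shift_prime[of a "power_sum m a v"]) (auto intro: power_sum_closed)
  then show False using a by simp
qed

text \<open>A finite subgroup of the multiplicative group of a field is cyclic; this is the fragment needed
here, with a proof that counts no roots of polynomials.  If \<open>b\<close> were not a power of \<open>d\<close> modulo \<open>C\<close>,
then \<open>b d^i\<close> and \<open>d^j\<close>, for \<open>j\<close> prime to \<open>p\<close>, would have order \<open>p\<close> modulo \<open>C\<close>, so their power sums would map
\<open>v\<close> into \<open>W\<close>.  Summing the power sums of the \<open>b d^i\<close> over \<open>i < p\<close> and sorting by powers of \<open>b\<close> gives
the terms \<open>b^j\<close> times the power sum of \<open>d^j\<close>, of which only the term \<open>p v\<close> for \<open>j = 0\<close> survives
modulo \<open>W\<close>.  Then \<open>v\<close> lies in \<open>W\<close>, as \<open>p\<close> is invertible.\<close>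
lemma ex_mult_power_mem_inertia:
  assumes p: "Factorial_Ring.prime p" "p \<noteq> ring_char K"
    and d: "d \<in> A" "d \<notin> C" "d [^]\<^bsub>G\<^esub> p \<in> C" and b: "b \<in> A" "b [^]\<^bsub>G\<^esub> p \<in> C"
  shows "\<exists>i::nat. b \<otimes>\<^bsub>G\<^esub> d [^]\<^bsub>G\<^esub> i \<in> C"
proof (rule ccontr)
  assume none: "\<not> ?thesis"
  have dG: "d \<in> carrier G" and bG: "b \<in> carrier G" using d b AG by auto
  have comm_pow: "(x \<otimes>\<^bsub>G\<^esub> y) [^]\<^bsub>G\<^esub> (n::nat) = x [^]\<^bsub>G\<^esub> n \<otimes>\<^bsub>G\<^esub> y [^]\<^bsub>G\<^esub> n" if "x \<in> A" "y \<in> A" for x y n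
    using that AG by (intro G.pow_mult_distrib commA) auto
  have "power_sum p (b \<otimes>\<^bsub>G\<^esub> d [^]\<^bsub>G\<^esub> i) v \<in> W" for i :: nat
  proof (rule power_sum_mem_W)
    show "b \<otimes>\<^bsub>G\<^esub> d [^]\<^bsub>G\<^esub> i \<in> A" using b d by (intro subgroup.m_closed[OF subA] pow_mem)
    show "b \<otimes>\<^bsub>G\<^esub> d [^]\<^bsub>G\<^esub> i \<notin> C" using none by blast
    have "(d [^]\<^bsub>G\<^esub> i) [^]\<^bsub>G\<^esub> p = (d [^]\<^bsub>G\<^esub> p) [^]\<^bsub>G\<^esub> (int i)"
      using dG by (simp add: G.nat_pow_pow mult.commute int_pow_int)
    then have "(d [^]\<^bsub>G\<^esub> i) [^]\<^bsub>G\<^esub> p \<in> C"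
      using G.subgroup_int_pow_closed[OF subC d(3)] by simp
    then show "(b \<otimes>\<^bsub>G\<^esub> d [^]\<^bsub>G\<^esub> i) [^]\<^bsub>G\<^esub> p \<in> C"
      using b d pow_mem by (simp add: comm_pow subgroup.m_closed[OF subC])
  qed
  then have "(\<Oplus>\<^bsub>V\<^esub>i\<in>{..<p}. power_sum p (b \<otimes>\<^bsub>G\<^esub> d [^]\<^bsub>G\<^esub> i) v) \<in> W"
    by (intro submodule_finsum[OF subW])
  also have "(\<Oplus>\<^bsub>V\<^esub>i\<in>{..<p}. power_sum p (b \<otimes>\<^bsub>G\<^esub> d [^]\<^bsub>G\<^esub> i) v) =
      (\<Oplus>\<^bsub>V\<^esub>j\<in>{..<p}. \<Oplus>\<^bsub>V\<^esub>i\<in>{..<p}. \<phi> ((b \<otimes>\<^bsub>G\<^esub> d [^]\<^bsub>G\<^esub> i) [^]\<^bsub>G\<^esub> j) v)"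
    unfolding power_sum_def using bG dG v by (intro finsum_swap) (auto intro!: act_closed)
  also have "\<dots> = (\<Oplus>\<^bsub>V\<^esub>j\<in>{..<p}. \<phi> (b [^]\<^bsub>G\<^esub> j) (power_sum p (d [^]\<^bsub>G\<^esub> j) v))"
  proof (rule M.finsum_cong')
    fix j assume "j \<in> {..<p}"
    have "\<phi> ((b \<otimes>\<^bsub>G\<^esub> d [^]\<^bsub>G\<^esub> i) [^]\<^bsub>G\<^esub> j) v = \<phi> (b [^]\<^bsub>G\<^esub> j) (\<phi> ((d [^]\<^bsub>G\<^esub> j) [^]\<^bsub>G\<^esub> i) v)" for i :: nat
      using b d pow_mem bG dG v by (simp add: comm_pow composition_rule G.nat_pow_pow mult.commute)
    then show "(\<Oplus>\<^bsub>V\<^esub>i\<in>{..<p}. \<phi> ((b \<otimes>\<^bsub>G\<^esub> d [^]\<^bsub>G\<^esub> i) [^]\<^bsub>G\<^esub> j) v) = \<phi> (b [^]\<^bsub>G\<^esub> j) (power_sum p (d [^]\<^bsub>G\<^esub> j) v)"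
      unfolding power_sum_def using bG dG v by (simp add: linear_op_finsum[OF linear_op_act] act_closed)
  qed (use bG dG v in \<open>auto intro!: act_closed power_sum_closed\<close>)
  also have "{..<p} = insert 0 {0<..<p}" using prime_gt_0_nat[OF p(1)] by auto
  also have "(\<Oplus>\<^bsub>V\<^esub>j\<in>insert 0 {0<..<p}. \<phi> (b [^]\<^bsub>G\<^esub> j) (power_sum p (d [^]\<^bsub>G\<^esub> j) v)) =
      power_sum p \<one>\<^bsub>G\<^esub> v \<oplus>\<^bsub>V\<^esub> (\<Oplus>\<^bsub>V\<^esub>j\<in>{0<..<p}. \<phi> (b [^]\<^bsub>G\<^esub> j) (power_sum p (d [^]\<^bsub>G\<^esub> j) v))" (is "_ = ?h \<oplus>\<^bsub>V\<^esub> ?t")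
    using bG dG v by (subst M.finsum_insert) (auto intro!: act_closed power_sum_closed simp: act_one power_sum_closed)
  finally have sum: "?h \<oplus>\<^bsub>V\<^esub> ?t \<in> W" .
  have "?t \<in> W"
  proof (rule submodule_finsum[OF subW])
    fix j assume j: "j \<in> {0<..<p}"
    have "power_sum p (d [^]\<^bsub>G\<^esub> j) v \<in> W"
    proof (rule power_sum_mem_W)
      show "d [^]\<^bsub>G\<^esub> j \<in> A" using d by (intro pow_mem)
      have "coprime p j" using p(1) j by (auto intro!: prime_imp_coprime dest: nat_dvd_not_less)
      then show "d [^]\<^bsub>G\<^esub> j \<notin> C"
        using G.subgroup_pow_coprime[OF subC dG d(3)] d(2) by blast
      have "(d [^]\<^bsub>G\<^esub> j) [^]\<^bsub>G\<^esub> p = (d [^]\<^bsub>G\<^esub> p) [^]\<^bsub>G\<^esub> (int j)"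
        using dG by (simp add: G.nat_pow_pow mult.commute int_pow_int)
      then show "(d [^]\<^bsub>G\<^esub> j) [^]\<^bsub>G\<^esub> p \<in> C"
        using G.subgroup_int_pow_closed[OF subC d(3)] by simp
    qed
    then show "\<phi> (b [^]\<^bsub>G\<^esub> j) (power_sum p (d [^]\<^bsub>G\<^esub> j) v) \<in> W"
      using b by (intro actW pow_mem)
  qed
  then have "(?h \<oplus>\<^bsub>V\<^esub> ?t) \<ominus>\<^bsub>V\<^esub> ?t \<in> W" by (rule submodule_diff[OF subW sum])
  moreover have "?h \<in> carrier V" "?t \<in> carrier V"
    using v \<open>?t \<in> W\<close> submoduleE(1)[OF subW] by (auto intro: power_sum_closed)
  ultimately have "?h \<in> W" by (simp add: a_minus_def M.a_assoc M.r_neg)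
  then have "v \<in> W"
    using v p by (intro submodule_cancel_smult[OF subW v, of "[p] \<cdot>\<^bsub>K\<^esub> \<one>\<^bsub>K\<^esub>"])
      (auto simp: power_sum_one add_pow_prime_one_eq_zero_iff)
  then show False using vW by simp
qed


text \<open>Modulo \<open>W\<close> each factor acts on \<open>v\<close> as an invertible scalar.\<close>
lemma power_sums_notin_W:
  assumes xs: "set xs \<subseteq> C" and ord: "\<And>a. a \<in> C \<Longrightarrow> [n a] \<cdot>\<^bsub>K\<^esub> \<one>\<^bsub>K\<^esub> \<noteq> \<zero>"
  shows "foldr (\<lambda>a. power_sum (n a) a) xs v \<notin> W"
  using xs
proof (induction xs)
  case Nil
  then show ?case using vW by simp
next
  case (Cons a xs)
  let ?S = "\<lambda>a. power_sum (n a) a"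
  have a: "a \<in> A" "a \<in> C" and aG: "a \<in> carrier G" and xsA: "set xs \<subseteq> A"
    using Cons.prems AG by (auto simp: inertia_def)
  have ops: "commuting_ops ?S A" using AG commA by (rule commuting_ops_power_sum)
  let ?u = "foldr ?S xs v"
  have u: "?u \<in> carrier V" using linear_op_closed[OF commuting_ops_foldr[OF ops xsA] v] .
  have presW: "foldr ?S ys w \<in> W" if "set ys \<subseteq> A" "w \<in> W" for ys w
    using that by (induction ys) (auto intro: power_sum_preserves_W)
  have "shift a (foldr ?S ys w) = foldr ?S ys (shift a w)" if "set ys \<subseteq> A" "w \<in> carrier V" for ys w
  proof -
    have "\<phi> a (foldr ?S ys w) = foldr ?S (map (\<lambda>b. b) ys) (\<phi> a w)"
    proof (rule foldr_intertwine)
      fix b w assume bw: "b \<in> set ys" "w \<in> carrier V"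
      then have "b \<in> A" "b \<in> carrier G" using that AG by auto
      then show "\<phi> a (?S b w) = ?S b (\<phi> a w)"
        using act_power_sum[of a b w] conj_commute[of a b] commA[of a b] a aG bw by simp
    qed (use that AG in \<open>auto intro: linear_op_power_sum\<close>)
    then show ?thesis
      using that aG by (simp add: shift_def linear_op_diff[OF commuting_ops_foldr[OF ops]] act_closed)
  qed
  then have "shift a ?u = foldr ?S xs (shift a v)" using xsA v by simp
  then have "shift a ?u \<in> W" using presW[OF xsA] a by (simp add: inertia_def)
  then show ?case
    using power_sum_cancel[OF subA W a(1) u _ _ ord[OF a(2)]] Cons by auto
qed

text \<open>The subspace \<open>Z\<close> of vectors killed by a product of power sums of distinct elements of \<open>N\<close> is invariant under \<open>G\<close>
because \<open>N\<close> is normalized by \<open>G\<close>.  It does not contain \<open>v\<close>, since power sums of elements of \<open>C\<close> act on \<open>v\<close>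
modulo \<open>W\<close> as invertible scalars.  So \<open>Z\<close> is zero.  But it contains every \<open>(n - 1) x\<close>, which the power
sum of \<open>n\<close> kills; hence \<open>N\<close> acts trivially.\<close>
lemma inertia_core_free:
  assumes irr: "irreducible_rep K G V \<phi>" and faith: "faithful_rep G V \<phi>"
    and ord: "\<And>a. a \<in> A \<Longrightarrow> [G.ord a] \<cdot>\<^bsub>K\<^esub> \<one>\<^bsub>K\<^esub> \<noteq> \<zero>"
    and N: "N \<subseteq> C" "\<And>g n. g \<in> carrier G \<Longrightarrow> n \<in> N \<Longrightarrow> inv\<^bsub>G\<^esub> g \<otimes>\<^bsub>G\<^esub> n \<otimes>\<^bsub>G\<^esub> g \<in> N"
  shows "N \<subseteq> {\<one>\<^bsub>G\<^esub>}"
proof -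
  let ?S = "\<lambda>a. power_sum (G.ord a) a"
  have CA: "C \<subseteq> A" by (auto simp: inertia_def)
  have NA: "N \<subseteq> A" and NG: "N \<subseteq> carrier G" using N(1) CA AG by auto
  have ops: "commuting_ops ?S N"
    using NA commA by (intro commuting_ops_power_sum NG) auto
  let ?Z = "eventual_kernel ?S N"
  have act: "\<phi> g t \<in> ?Z" if g: "g \<in> carrier G" and "t \<in> ?Z" for g t
  proof -
    from \<open>t \<in> ?Z\<close> obtain F where t: "t \<in> carrier V" "finite F" "F \<subseteq> N"
      "\<And>xs. F \<subseteq> set xs \<Longrightarrow> set xs \<subseteq> N \<Longrightarrow> foldr ?S xs t = \<zero>\<^bsub>V\<^esub>"
      by (rule eventual_kernelE) blast
    define c where "c n = inv\<^bsub>G\<^esub> g \<otimes>\<^bsub>G\<^esub> n \<otimes>\<^bsub>G\<^esub> g" for n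
    define d where "d n = g \<otimes>\<^bsub>G\<^esub> n \<otimes>\<^bsub>G\<^esub> inv\<^bsub>G\<^esub> g" for n
    have dN: "d n \<in> N" if "n \<in> N" for n
      using N(2)[of "inv\<^bsub>G\<^esub> g" n] g that by (simp add: d_def)
    have cN: "c n \<in> N" if "n \<in> N" for n using N(2)[OF g that] by (simp add: c_def)
    have cd: "c (d n) = n" "d (c n) = n" if "n \<in> N" for n
      using that g NG G.conjugate_inv_conjugate[of g n] G.conjugate_inv_conjugate[of "inv\<^bsub>G\<^esub> g" n]
      by (auto simp: c_def d_def)
    have ord_d: "G.ord (d n) = G.ord n" if "n \<in> N" for n
      unfolding d_def using g that NG by (intro G.ord_conjugate) auto
    show ?thesis
    proof (rule eventual_kernelI)
      show "\<phi> g t \<in> carrier V" using g t by (simp add: act_closed)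
      show "finite (d ` F)" "d ` F \<subseteq> N" using t dN by auto
      fix xs assume xs: "d ` F \<subseteq> set xs" "set xs \<subseteq> N"
      have cxs: "set (map c xs) \<subseteq> N" using xs cN by auto
      have "F \<subseteq> set (map c xs)"
      proof
        fix n assume "n \<in> F"
        then have "n = c (d n)" "d n \<in> set xs" using cd t(3) xs by auto
        then show "n \<in> set (map c xs)" by auto
      qed
      then have "foldr ?S (map c xs) t = \<zero>\<^bsub>V\<^esub>" using cxs by (rule t(4))
      moreover have "\<phi> g (foldr ?S (map c xs) t) = foldr ?S (map d (map c xs)) (\<phi> g t)"
      proof (rule foldr_intertwine)
        fix n w assume nw: "n \<in> set (map c xs)" "w \<in> carrier V"
        then have n: "n \<in> N" "n \<in> carrier G" using cxs NG by auto
        show "\<phi> g (?S n w) = ?S (d n) (\<phi> g w)"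
          unfolding ord_d[OF n(1)] unfolding d_def using g n(2) nw(2) by (rule act_power_sum)
      qed (use cxs NG t in \<open>auto intro!: linear_op_power_sum\<close>)
      moreover have "map d (map c xs) = xs"
        unfolding map_map using xs cd by (intro map_idI) (auto simp: subset_iff)
      ultimately show "foldr ?S xs (\<phi> g t) = \<zero>\<^bsub>V\<^esub>"
        using linear_op_zero[OF linear_op_act[OF g]] by simp
    qed
  qed
  have "subrep ?Z K G V \<phi>"
    using submodule_eventual_kernel[OF ops] act by (simp add: subrep_def)
  then have "?Z = {\<zero>\<^bsub>V\<^esub>} \<or> ?Z = carrier V" using irr by (simp add: irreducible_rep_def)
  moreover have "v \<notin> ?Z"
  proof
    assume "v \<in> ?Z"
    then obtain F where F: "v \<in> carrier V" "finite F" "F \<subseteq> N"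
      "\<And>xs. F \<subseteq> set xs \<Longrightarrow> set xs \<subseteq> N \<Longrightarrow> foldr ?S xs v = \<zero>\<^bsub>V\<^esub>"
      by (rule eventual_kernelE) blast
    obtain xs where xs: "set xs = F" using finite_list[OF F(2)] by blast
    have "foldr ?S xs v \<notin> W"
      using xs F(3) N(1) CA ord by (intro power_sums_notin_W) auto
    moreover have "foldr ?S xs v = \<zero>\<^bsub>V\<^esub>" using xs F(3) by (intro F(4)) auto
    ultimately show False using submodule_zero_mem[OF subW] by simp
  qed
  ultimately have Z: "?Z = {\<zero>\<^bsub>V\<^esub>}" using v by blast
  show ?thesis
  proof
    fix n assume n: "n \<in> N"
    then have nG: "n \<in> carrier G" using NG by blast
    have "shift n x = \<zero>\<^bsub>V\<^esub>" if x: "x \<in> carrier V" for x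
    proof -
      have c: "power_sum (G.ord n) n x \<in> carrier V" using nG x by (rule power_sum_closed)
      have "?S n (shift n x) = ?S n (\<phi> n x) \<ominus>\<^bsub>V\<^esub> ?S n x"
        using nG x by (simp add: shift_def linear_op_diff[OF linear_op_power_sum] act_closed)
      also have "?S n (\<phi> n x) = \<phi> n (?S n x)"
        using act_power_sum[OF nG nG x, of "G.ord n"] nG by (simp add: conj_commute)
      also have "\<phi> n (?S n x) \<ominus>\<^bsub>V\<^esub> ?S n x = shift (n [^]\<^bsub>G\<^esub> G.ord n) x"
        using shift_power_sum[OF nG x, of "G.ord n"] by (simp add: shift_def)
      also have "\<dots> = \<zero>\<^bsub>V\<^esub>" using nG x shift_eq_zero_iff[of "\<one>\<^bsub>G\<^esub>" x] by (simp add: act_one)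
      finally have "shift n x \<in> ?Z" using n nG x by (intro eventual_kernel_mem[OF ops]) (auto intro: shift_closed)
      then show ?thesis using Z by simp
    qed
    then have "\<forall>x\<in>carrier V. \<phi> n x = x" using nG by (simp add: shift_eq_zero_iff)
    then show "n \<in> {\<one>\<^bsub>G\<^esub>}" using faith nG by (simp add: faithful_rep_def)
  qed
qed

end

lemma (in field) ring_char_prime:
  assumes "ring_char R > 0"
  shows "Factorial_Ring.prime (ring_char R)"
proof -
  have ne1: "ring_char R \<noteq> 1"
    using add_pow_one_eq_zero_iff[of 1] one_not_zero by auto
  have "m = 1 \<or> m = ring_char R" if "m dvd ring_char R" for m
  proof -
    obtain n where n: "ring_char R = m * n" using \<open>m dvd ring_char R\<close> by blast
    have "([m] \<cdot> \<one>) \<otimes> ([n] \<cdot> \<one>) = [m] \<cdot> ([n] \<cdot> \<one>)"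
      by (simp add: add_pow_ldistr)
    also have "\<dots> = [(n * m)] \<cdot> \<one>" by (simp add: add.nat_pow_pow)
    also have "\<dots> = \<zero>" by (simp add: add_pow_one_eq_zero_iff n mult.commute)
    finally have "[m] \<cdot> \<one> = \<zero> \<or> [n] \<cdot> \<one> = \<zero>" by (simp add: integral_iff)
    then show ?thesis
      using n assms by (auto simp: add_pow_one_eq_zero_iff dest!: dvd_imp_le)
  qed
  then show ?thesis using ne1 assms by (simp add: prime_nat_iff)
qed

lemma (in group) mem_normal_core_iff:
  assumes "C \<subseteq> carrier G"
  shows "n \<in> normal_core G C \<longleftrightarrow> n \<in> carrier G \<and> (\<forall>g\<in>carrier G. inv g \<otimes> n \<otimes> g \<in> C)"
proof -
  have "n \<in> g <# C #> inv g \<longleftrightarrow> n \<in> carrier G \<and> inv g \<otimes> n \<otimes> g \<in> C" if g: "g \<in> carrier G" for g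
  proof
    assume "n \<in> g <# C #> inv g"
    then obtain c where c: "c \<in> C" "n = g \<otimes> c \<otimes> inv g" by (auto simp: l_coset_def r_coset_def)
    then have cG: "c \<in> carrier G" using assms by blast
    have "inv g \<otimes> n \<otimes> g = c"
      using g cG conjugate_inv_conjugate[of "inv g" c] by (simp add: c(2))
    then show "n \<in> carrier G \<and> inv g \<otimes> n \<otimes> g \<in> C" using c g cG by simp
  next
    assume n: "n \<in> carrier G \<and> inv g \<otimes> n \<otimes> g \<in> C"
    have "n = g \<otimes> (inv g \<otimes> n \<otimes> g) \<otimes> inv g"
      using g n by (simp add: conjugate_inv_conjugate)
    then show "n \<in> g <# C #> inv g" using n by (auto simp: l_coset_def r_coset_def)
  qed
  then show ?thesis unfolding normal_core_def by auto
qed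

lemma (in group) normal_core_conj:
  assumes C: "C \<subseteq> carrier G" and g: "g \<in> carrier G" and n: "n \<in> normal_core G C"
  shows "inv g \<otimes> n \<otimes> g \<in> normal_core G C"
  unfolding mem_normal_core_iff[OF C]
proof (intro conjI ballI)
  have nG: "n \<in> carrier G" using n mem_normal_core_iff[OF C] by blast
  then show "inv g \<otimes> n \<otimes> g \<in> carrier G" using g by simp
  fix h assume h: "h \<in> carrier G"
  have "inv h \<otimes> (inv g \<otimes> n \<otimes> g) \<otimes> h = inv (g \<otimes> h) \<otimes> n \<otimes> (g \<otimes> h)"
    using g h nG by (simp add: inv_mult_group m_assoc)
  then show "inv h \<otimes> (inv g \<otimes> n \<otimes> g) \<otimes> h \<in> C"
    using n g h mem_normal_core_iff[OF C, of n] by simp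
qed

lemma (in group) normal_core_subset:
  assumes C: "C \<subseteq> carrier G"
  shows "normal_core G C \<subseteq> C"
proof
  fix n assume "n \<in> normal_core G C"
  then have "n \<in> carrier G" "inv \<one> \<otimes> n \<otimes> \<one> \<in> C"
    using mem_normal_core_iff[OF C, of n] by blast+
  then show "n \<in> C" by simp
qed

lemma (in group) one_mem_normal_core:
  assumes C: "subgroup C G"
  shows "\<one> \<in> normal_core G C"
  using subgroup.one_closed[OF C] by (simp add: mem_normal_core_iff[OF subgroup.subset[OF C]])

text \<open>The subgroup is the inertia group of any nonzero vector modulo an \<open>A\<close>-invariant subspace maximal with
respect to avoiding it.\<close>
theorem (in group_representation) irreducible_imp_core_free_locally_cyclic_quotient:
  assumes irr: "irreducible_rep K G V \<phi>" and faith: "faithful_rep G V \<phi>"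
    and tors: "torsion_group G" and A: "abelian_normal_subgroup A G"
    and char: "ring_char K \<notin> prime_orders (G\<lparr>carrier := A\<rparr>)"
  shows "\<exists>C. subgroup C (G\<lparr>carrier := A\<rparr>) \<and> locally_cyclic (G\<lparr>carrier := A\<rparr> Mod C) \<and>
     normal_core G C = {\<one>\<^bsub>G\<^esub>}"
proof -
  let ?H = "G\<lparr>carrier := A\<rparr>"
  interpret A: normal A G using A by (simp add: abelian_normal_subgroup_def)
  interpret H: comm_group ?H using A by (simp add: abelian_normal_subgroup_def)
  have subA: "subgroup A G" by (rule A.is_subgroup)
  obtain v where v: "v \<in> carrier V" "v \<noteq> \<zero>\<^bsub>V\<^esub>"
    using irr M.zero_closed unfolding irreducible_rep_def by blast
  have "subrep {\<zero>\<^bsub>V\<^esub>} K ?H V \<phi>"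
    using A.subset by (auto simp: subrep_def submodule_zero linear_op_zero[OF linear_op_act])
  moreover have "v \<notin> {\<zero>\<^bsub>V\<^esub>}" using v by simp
  ultimately obtain W where W: "subrep W K ?H V \<phi>" "v \<notin> W"
      "\<And>W'. subrep W' K ?H V \<phi> \<Longrightarrow> W \<subset> W' \<Longrightarrow> v \<in> W'"
    by (rule subrep_maximal_avoiding) blast
  interpret maximal_avoiding_subrep K G V \<phi> A W v
    by unfold_locales (use subA H.m_comm v W in auto)
  have CA: "C \<subseteq> A" by (auto simp: inertia_def)
  have sub: "subgroup C ?H" using subC subA CA by (rule G.subgroup_incl)
  interpret C: normal C ?H using sub by (rule H.subgroup_imp_normal)
  interpret Q: comm_group "?H Mod C" using sub by (rule H.abelian_FactGroup)
  have torsH: "torsion_group ?H" using tors subA by (rule G.torsion_group_subgroup)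
  have "unique_prime_order_subgroups (?H Mod C)"
    unfolding H.unique_prime_order_subgroups_quotient_iff[OF sub]
  proof (intro allI impI)
    fix q :: nat and d b
    assume "Factorial_Ring.prime q \<and> d \<in> carrier ?H - C \<and> b \<in> carrier ?H \<and>
       d [^]\<^bsub>?H\<^esub> q \<in> C \<and> b [^]\<^bsub>?H\<^esub> q \<in> C"
    then have q: "Factorial_Ring.prime q" and d: "d \<in> A" "d \<notin> C" "d [^]\<^bsub>G\<^esub> q \<in> C"
      and b: "b \<in> A" "b [^]\<^bsub>G\<^esub> q \<in> C"
      by (auto simp: G.nat_pow_consistent[symmetric])
    have "q \<in> prime_orders ?H"
      using G.prime_order_in_quotient_imp_prime_order[OF tors subC subA d q] .
    then have "q \<noteq> ring_char K" using char by blast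
    then obtain i :: nat where "b \<otimes>\<^bsub>G\<^esub> d [^]\<^bsub>G\<^esub> i \<in> C"
      using ex_mult_power_mem_inertia[OF q _ d b] by blast
    then have "b \<otimes>\<^bsub>?H\<^esub> d [^]\<^bsub>?H\<^esub> int i \<in> C"
      using d(1) by (simp add: int_pow_int G.nat_pow_consistent[symmetric])
    then show "\<exists>i::int. b \<otimes>\<^bsub>?H\<^esub> d [^]\<^bsub>?H\<^esub> i \<in> C" by blast
  qed
  then have "locally_cyclic (?H Mod C)"
    using C.torsion_group_FactGroup[OF torsH] by (intro Q.unique_prime_order_subgroups_imp_locally_cyclic)
  moreover have "normal_core G C \<subseteq> {\<one>\<^bsub>G\<^esub>}"
  proof (rule inertia_core_free[OF irr faith])
    have CG: "C \<subseteq> carrier G" using subC by (rule subgroup.subset)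
    show "normal_core G C \<subseteq> C" using CG by (rule G.normal_core_subset)
    show "inv\<^bsub>G\<^esub> g \<otimes>\<^bsub>G\<^esub> n \<otimes>\<^bsub>G\<^esub> g \<in> normal_core G C" if "g \<in> carrier G" "n \<in> normal_core G C" for g n
      using CG that by (rule G.normal_core_conj)
    fix a assume a: "a \<in> A"
    show "[G.ord a] \<cdot>\<^bsub>K\<^esub> \<one>\<^bsub>K\<^esub> \<noteq> \<zero>\<^bsub>K\<^esub>"
    proof
      assume "[G.ord a] \<cdot>\<^bsub>K\<^esub> \<one>\<^bsub>K\<^esub> = \<zero>\<^bsub>K\<^esub>"
      then have dvd: "ring_char K dvd G.ord a" by (simp add: add_pow_one_eq_zero_iff)
      have pos: "G.ord a > 0" using tors a AG by (intro G.torsion_imp_ord_pos) auto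
      then have "ring_char K > 0" using dvd by (auto intro: Nat.gr0I)
      then have "ring_char K \<in> prime_orders ?H"
        using G.prime_dvd_ord_imp_prime_order[OF subA a ring_char_prime dvd pos] by simp
      then show False using char by simp
    qed
  qed
  ultimately show ?thesis using sub G.one_mem_normal_core[OF subC] by blast
qed

section \<open>Maximal abelian normal subgroups of soluble groups\<close>

lemma (in group) generate_commute:
  assumes S: "S \<subseteq> carrier G" and x: "x \<in> carrier G" and comm: "\<And>s. s \<in> S \<Longrightarrow> x \<otimes> s = s \<otimes> x"
    and h: "h \<in> generate G S"
  shows "x \<otimes> h = h \<otimes> x"
  using h
proof induction
  case (inv s)
  then have s: "s \<in> carrier G" using S by blast
  have "inv s \<otimes> (x \<otimes> s) \<otimes> inv s = inv s \<otimes> (s \<otimes> x) \<otimes> inv s" using comm[OF inv] by simp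
  moreover have "inv s \<otimes> (x \<otimes> s) \<otimes> inv s = inv s \<otimes> x"
    using s x by (simp add: m_assoc)
  moreover have "inv s \<otimes> (s \<otimes> x) \<otimes> inv s = x \<otimes> inv s"
    using s x by (simp add: m_assoc[symmetric])
  ultimately show ?case by simp
next
  case (eng h1 h2)
  then have "h1 \<in> carrier G" "h2 \<in> carrier G" using generate_in_carrier[OF S] by auto
  then show ?case using eng.IH x by (metis m_assoc)
qed (use x comm in auto)

lemma (in group) normal_exp_of_derived: "N \<lhd> G \<Longrightarrow> (derived G ^^ n) N \<lhd> G"
  by (induction n) (auto intro: derived_is_normal)

lemma (in group) exp_of_derived_incl: "subgroup N G \<Longrightarrow> (derived G ^^ n) N \<subseteq> N"
  by (induction n) (auto dest: derived_incl)

lemma (in group) derived_trivial_imp_commute: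
  assumes B: "B \<subseteq> carrier G" and triv: "derived G B = {\<one>}" and ab: "a \<in> B" "b \<in> B"
  shows "a \<otimes> b = b \<otimes> a"
proof -
  have c: "a \<in> carrier G" "b \<in> carrier G" using ab B by auto
  have "a \<otimes> b \<otimes> inv a \<otimes> inv b \<in> derived_set G B" using ab by blast
  then have "a \<otimes> b \<otimes> inv a \<otimes> inv b = \<one>"
    using triv generate.incl[of _ "derived_set G B" G] unfolding derived_def by blast
  then have "(a \<otimes> b) \<otimes> inv (b \<otimes> a) = \<one>" using c by (simp add: inv_mult_group m_assoc)
  then show ?thesis using c inv_solve_right'[of \<one> "a \<otimes> b" "b \<otimes> a"] by simp
qed

lemma (in group) abelian_normal_subgroup_generate:
  assumes S: "S \<subseteq> carrier G" and conj: "\<And>s g. s \<in> S \<Longrightarrow> g \<in> carrier G \<Longrightarrow> g \<otimes> s \<otimes> inv g \<in> S"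
    and comm: "\<And>s t. s \<in> S \<Longrightarrow> t \<in> S \<Longrightarrow> s \<otimes> t = t \<otimes> s"
  shows "abelian_normal_subgroup (generate G S) G"
proof -
  have gen: "h \<in> carrier G" if "h \<in> generate G S" for h using generate_in_carrier[OF S that] .
  have "s \<otimes> h = h \<otimes> s" if "s \<in> S" "h \<in> generate G S" for s h
    using generate_commute[OF S _ comm[OF that(1)] that(2)] that S by blast
  then have "h \<otimes> h' = h' \<otimes> h" if "h \<in> generate G S" "h' \<in> generate G S" for h h'
    using generate_commute[OF S gen[OF that(1)] _ that(2)] that(1) by metis
  then have "comm_group (G\<lparr>carrier := generate G S\<rparr>)"
    using subgroup_imp_group[OF generate_is_subgroup[OF S]]
    by (intro group.group_comm_groupI) auto
  then show ?thesis
    using normal_generateI[OF S conj] by (simp add: abelian_normal_subgroup_def)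
qed

text \<open>Otherwise the last nontrivial derived subgroup \<open>B\<close> of \<open>N\<close> is abelian and normal in \<open>G\<close>.  Commutators of \<open>A\<close>
and \<open>B\<close> lie in the intersection of \<open>A\<close> and \<open>N\<close>, so \<open>A\<close> and \<open>B\<close> commute, and the abelian normal subgroup that they
generate is \<open>A\<close> by maximality.  Then \<open>B\<close> lies in the trivial intersection of \<open>A\<close> and \<open>N\<close>.\<close>
lemma (in group) maximal_abelian_normal_meets_normal:
  assumes solv: "solvable G" and A: "maximal_abelian_normal_subgroup A G"
    and N: "N \<lhd> G" and meet: "N \<inter> A \<subseteq> {\<one>}"
  shows "N = {\<one>}"
proof (rule ccontr)
  assume ne: "N \<noteq> {\<one>}"
  have subN: "subgroup N G" using N by (rule normal_imp_subgroup)
  obtain n where "(derived G ^^ n) N = {\<one>}"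
    using solvable_imp_trivial_derived_seq[OF solvable_subgroup[OF subN solv]] by blast
  define k where "k = (LEAST n. (derived G ^^ n) N = {\<one>})"
  have k: "(derived G ^^ k) N = {\<one>}" unfolding k_def using \<open>(derived G ^^ n) N = {\<one>}\<close> by (rule LeastI)
  then obtain j where j: "k = Suc j" using ne by (cases k) auto
  define B where "B = (derived G ^^ j) N"
  have B_ne: "B \<noteq> {\<one>}"
    using not_less_Least[of j "\<lambda>n. (derived G ^^ n) N = {\<one>}"] j by (simp add: B_def k_def)
  have B_triv: "derived G B = {\<one>}" using k j by (simp add: B_def)
  have nB: "B \<lhd> G" unfolding B_def using N by (rule normal_exp_of_derived)
  have BN: "B \<subseteq> N" unfolding B_def using subN by (rule exp_of_derived_incl)
  have nA: "A \<lhd> G" and cA: "comm_group (G\<lparr>carrier := A\<rparr>)"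
    using A by (auto simp: maximal_abelian_normal_subgroup_def abelian_normal_subgroup_def)
  interpret A: normal A G by (rule nA)
  interpret B: normal B G by (rule nB)
  interpret N: normal N G by (rule N)
  interpret cA: comm_group "G\<lparr>carrier := A\<rparr>" by (rule cA)
  have AB: "a \<otimes> b = b \<otimes> a" if ab: "a \<in> A" "b \<in> B" for a b
  proof -
    have c: "a \<in> carrier G" "b \<in> carrier G" using ab A.subset B.subset by auto
    have "a \<otimes> b \<otimes> inv a \<in> B" using B.inv_op_closed2[OF c(1) ab(2)] .
    then have "(a \<otimes> b \<otimes> inv a) \<otimes> inv b \<in> N" using ab BN B.m_closed B.m_inv_closed by blast
    moreover have "b \<otimes> inv a \<otimes> inv b \<in> A" using A.inv_op_closed2[OF c(2)] ab(1) A.m_inv_closed by blast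
    then have "a \<otimes> (b \<otimes> inv a \<otimes> inv b) \<in> A" using ab(1) A.m_closed by blast
    then have "(a \<otimes> b \<otimes> inv a) \<otimes> inv b \<in> A" using c by (simp add: m_assoc)
    ultimately have "(a \<otimes> b \<otimes> inv a) \<otimes> inv b = \<one>" using meet by blast
    then have "(a \<otimes> b) \<otimes> inv (b \<otimes> a) = \<one>" using c by (simp add: inv_mult_group m_assoc)
    then show ?thesis using c inv_solve_right'[of \<one> "a \<otimes> b" "b \<otimes> a"] by simp
  qed
  have comm: "s \<otimes> t = t \<otimes> s" if "s \<in> A \<union> B" "t \<in> A \<union> B" for s t
    using that AB cA.m_comm derived_trivial_imp_commute[OF B.subset B_triv] by auto
  have "abelian_normal_subgroup (generate G (A \<union> B)) G"
    using A.subset B.subset A.inv_op_closed2 B.inv_op_closed2 comm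
    by (intro abelian_normal_subgroup_generate) auto
  moreover have sub: "A \<union> B \<subseteq> generate G (A \<union> B)" by (auto intro: generate.incl)
  ultimately have "generate G (A \<union> B) = A"
    using A unfolding maximal_abelian_normal_subgroup_def by blast
  then have "B \<subseteq> N \<inter> A" using sub BN by blast
  then have "B \<subseteq> {\<one>}" using meet by blast
  then show False using B_ne B.one_closed by blast
qed

section \<open>Irreducible subquotients\<close>

lemma group_actionI:
  assumes G: "group G" and ext: "\<And>g. g \<in> carrier G \<Longrightarrow> \<psi> g \<in> extensional E"
    and closed: "\<And>g x. g \<in> carrier G \<Longrightarrow> x \<in> E \<Longrightarrow> \<psi> g x \<in> E"
    and one: "\<And>x. x \<in> E \<Longrightarrow> \<psi> \<one>\<^bsub>G\<^esub> x = x"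
    and mult: "\<And>g h x. g \<in> carrier G \<Longrightarrow> h \<in> carrier G \<Longrightarrow> x \<in> E \<Longrightarrow> \<psi> (g \<otimes>\<^bsub>G\<^esub> h) x = \<psi> g (\<psi> h x)"
  shows "group_action G E \<psi>"
proof -
  interpret group G by (rule G)
  have Bij: "\<psi> g \<in> Bij E" if g: "g \<in> carrier G" for g
  proof -
    have "bij_betw (\<psi> g) E E"
    proof (rule bij_betwI)
      show "\<psi> g \<in> E \<rightarrow> E" "\<psi> (inv\<^bsub>G\<^esub> g) \<in> E \<rightarrow> E" using g closed by auto
      show "\<psi> (inv\<^bsub>G\<^esub> g) (\<psi> g x) = x" "\<psi> g (\<psi> (inv\<^bsub>G\<^esub> g) x) = x" if "x \<in> E" for x
        using mult[of "inv\<^bsub>G\<^esub> g" g x] mult[of g "inv\<^bsub>G\<^esub> g" x] g that one by auto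
    qed
    then show ?thesis using ext[OF g] by (simp add: Bij_def)
  qed
  have "\<psi> (g \<otimes>\<^bsub>G\<^esub> h) = compose E (\<psi> g) (\<psi> h)" if "g \<in> carrier G" "h \<in> carrier G" for g h
    using that ext mult by (intro extensionalityI[of _ E]) (auto simp: compose_def)
  then have "\<psi> \<in> hom G (BijGroup E)"
    using Bij by (auto simp: hom_def BijGroup_def)
  then show ?thesis
    by (intro group_action.intro group_hom.intro group_hom_axioms.intro G group_BijGroup)
qed

context group_representation
begin

lemma subrep_Inter:
  assumes "\<W> \<noteq> {}" "\<And>W. W \<in> \<W> \<Longrightarrow> subrep W K G V \<phi>"
  shows "subrep (\<Inter>\<W>) K G V \<phi>"
proof -
  have sub: "submodule W K V" if "W \<in> \<W>" for W using assms(2)[OF that] by (simp add: subrep_def)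
  have "submodule (\<Inter>\<W>) K V"
  proof (rule submoduleI)
    show "\<Inter>\<W> \<subseteq> carrier V" using assms(1) sub submoduleE(1) by blast
  qed (use sub in \<open>auto intro: submodule_zero_mem submoduleE\<close>)
  then show ?thesis using assms(2) by (auto simp: subrep_def)
qed

definition residue_class :: "'v set \<Rightarrow> 'v \<Rightarrow> 'v set" where
  "residue_class M x = (\<lambda>m. x \<oplus>\<^bsub>V\<^esub> m) ` M"

definition representative :: "'v set \<Rightarrow> 'v set \<Rightarrow> 'v set \<Rightarrow> 'v" where
  "representative U M Y = (SOME x. x \<in> U \<and> residue_class M x = Y)"

text \<open>The operations go through chosen representatives; they are well defined on classes when \<open>U\<close> and \<open>M\<close> are
nested invariant subspaces.\<close>
definition quotient_module :: "'v set \<Rightarrow> 'v set \<Rightarrow> ('k, 'v set) module" where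
  "quotient_module U M =
    \<lparr>carrier = residue_class M ` U, monoid.mult = undefined, one = undefined,
     ring.zero = residue_class M \<zero>\<^bsub>V\<^esub>,
     ring.add = (\<lambda>Y Z. residue_class M (representative U M Y \<oplus>\<^bsub>V\<^esub> representative U M Z)),
     smult = (\<lambda>c Y. residue_class M (c \<odot>\<^bsub>V\<^esub> representative U M Y))\<rparr>"

definition quotient_action :: "'v set \<Rightarrow> 'v set \<Rightarrow> 'g \<Rightarrow> 'v set \<Rightarrow> 'v set" where
  "quotient_action U M g =
     (\<lambda>Y \<in> residue_class M ` U. residue_class M (\<phi> g (representative U M Y)))"

lemma residue_class_eq_iff:
  assumes M: "submodule M K V" and x: "x \<in> carrier V" "y \<in> carrier V"
  shows "residue_class M x = residue_class M y \<longleftrightarrow> x \<ominus>\<^bsub>V\<^esub> y \<in> M"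
proof
  assume "residue_class M x = residue_class M y"
  moreover have "x \<in> residue_class M x"
    unfolding residue_class_def using submodule_zero_mem[OF M] x by (intro image_eqI[of _ _ "\<zero>\<^bsub>V\<^esub>"]) auto
  ultimately obtain m where m: "m \<in> M" "x = y \<oplus>\<^bsub>V\<^esub> m" by (auto simp: residue_class_def)
  have "m \<in> carrier V" using m submoduleE(1)[OF M] by blast
  then have "x \<ominus>\<^bsub>V\<^esub> y = m" using x(2) by (simp add: m(2) add_diff_cancel)
  then show "x \<ominus>\<^bsub>V\<^esub> y \<in> M" using m by simp
next
  have sub: "residue_class M x \<subseteq> residue_class M y"
    if d: "x \<ominus>\<^bsub>V\<^esub> y \<in> M" and x: "x \<in> carrier V" "y \<in> carrier V" for x y
  proof
    fix z assume "z \<in> residue_class M x"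
    then obtain m where m: "m \<in> M" "z = x \<oplus>\<^bsub>V\<^esub> m" by (auto simp: residue_class_def)
    have mV: "m \<in> carrier V" using m submoduleE(1)[OF M] by blast
    have "y \<oplus>\<^bsub>V\<^esub> ((x \<ominus>\<^bsub>V\<^esub> y) \<oplus>\<^bsub>V\<^esub> m) = z"
      using x mV by (simp add: m(2) a_minus_def M.a_ac M.r_neg)
    moreover have "(x \<ominus>\<^bsub>V\<^esub> y) \<oplus>\<^bsub>V\<^esub> m \<in> M" using d m submoduleE(5)[OF M] by blast
    ultimately show "z \<in> residue_class M y" unfolding residue_class_def by (metis image_eqI)
  qed
  assume d: "x \<ominus>\<^bsub>V\<^esub> y \<in> M"
  have "y \<ominus>\<^bsub>V\<^esub> x = \<ominus>\<^bsub>V\<^esub> (x \<ominus>\<^bsub>V\<^esub> y)" using x by (simp add: a_minus_def M.minus_add M.a_comm)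
  then have "y \<ominus>\<^bsub>V\<^esub> x \<in> M" using submoduleE(3)[OF M d] by simp
  then show "residue_class M x = residue_class M y" using sub d x by blast
qed

end

locale subrep_pair = group_representation K G V \<phi>
  for K :: "('k, 'm) ring_scheme" (structure) and G :: "('g, 'n) monoid_scheme"
    and V :: "('k, 'v, 'w) module_scheme" and \<phi> :: "'g \<Rightarrow> 'v \<Rightarrow> 'v" +
  fixes U :: "'v set" and M :: "'v set"
  assumes U: "subrep U K G V \<phi>" and M: "subrep M K G V \<phi>" and MU: "M \<subseteq> U"
begin

abbreviation "Q \<equiv> quotient_module U M"
abbreviation "\<pi> \<equiv> residue_class M"
abbreviation "\<psi> \<equiv> quotient_action U M"

lemma subU: "submodule U K V" and subM: "submodule M K V"
  and actU: "\<And>g x. g \<in> carrier G \<Longrightarrow> x \<in> U \<Longrightarrow> \<phi> g x \<in> U"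
  and actM: "\<And>g x. g \<in> carrier G \<Longrightarrow> x \<in> M \<Longrightarrow> \<phi> g x \<in> M"
  using U M by (auto simp: subrep_def)

lemma UV: "x \<in> U \<Longrightarrow> x \<in> carrier V" using submoduleE(1)[OF subU] by blast

lemma \<pi>_eq: "x \<in> U \<Longrightarrow> y \<in> U \<Longrightarrow> \<pi> x = \<pi> y \<longleftrightarrow> x \<ominus>\<^bsub>V\<^esub> y \<in> M"
  using residue_class_eq_iff[OF subM] UV by blast

lemma representative:
  assumes "x \<in> U"
  shows "representative U M (\<pi> x) \<in> U" "representative U M (\<pi> x) \<ominus>\<^bsub>V\<^esub> x \<in> M"
proof -
  have "representative U M (\<pi> x) \<in> U \<and> \<pi> (representative U M (\<pi> x)) = \<pi> x"
    unfolding representative_def by (rule someI[of _ x]) (use assms in simp)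
  then show "representative U M (\<pi> x) \<in> U" "representative U M (\<pi> x) \<ominus>\<^bsub>V\<^esub> x \<in> M"
    using \<pi>_eq assms by auto
qed

lemma carrier_Q: "carrier Q = \<pi> ` U" and zero_Q: "\<zero>\<^bsub>Q\<^esub> = \<pi> \<zero>\<^bsub>V\<^esub>"
  by (simp_all add: quotient_module_def)

lemma add_\<pi>:
  assumes "x \<in> U" "y \<in> U" shows "\<pi> x \<oplus>\<^bsub>Q\<^esub> \<pi> y = \<pi> (x \<oplus>\<^bsub>V\<^esub> y)"
proof -
  let ?x = "representative U M (\<pi> x)" and ?y = "representative U M (\<pi> y)"
  have "(?x \<oplus>\<^bsub>V\<^esub> ?y) \<ominus>\<^bsub>V\<^esub> (x \<oplus>\<^bsub>V\<^esub> y) = (?x \<ominus>\<^bsub>V\<^esub> x) \<oplus>\<^bsub>V\<^esub> (?y \<ominus>\<^bsub>V\<^esub> y)"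
    using assms representative UV by (simp add: a_minus_def M.minus_add M.a_ac)
  then have "(?x \<oplus>\<^bsub>V\<^esub> ?y) \<ominus>\<^bsub>V\<^esub> (x \<oplus>\<^bsub>V\<^esub> y) \<in> M"
    using representative assms submoduleE(5)[OF subM] by simp
  then show ?thesis
    using assms representative submoduleE(5)[OF subU] by (simp add: quotient_module_def \<pi>_eq)
qed

lemma smult_\<pi>:
  assumes "c \<in> carrier K" "x \<in> U" shows "c \<odot>\<^bsub>Q\<^esub> \<pi> x = \<pi> (c \<odot>\<^bsub>V\<^esub> x)"
proof -
  let ?x = "representative U M (\<pi> x)"
  have "(c \<odot>\<^bsub>V\<^esub> ?x) \<ominus>\<^bsub>V\<^esub> (c \<odot>\<^bsub>V\<^esub> x) = c \<odot>\<^bsub>V\<^esub> (?x \<ominus>\<^bsub>V\<^esub> x)"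
    using assms representative UV by (simp add: a_minus_def smult_r_distr smult_r_minus)
  then have "(c \<odot>\<^bsub>V\<^esub> ?x) \<ominus>\<^bsub>V\<^esub> (c \<odot>\<^bsub>V\<^esub> x) \<in> M"
    using representative assms submoduleE(4)[OF subM] by simp
  then show ?thesis
    using assms representative submoduleE(4)[OF subU] by (simp add: quotient_module_def \<pi>_eq)
qed

lemma act_\<pi>:
  assumes "g \<in> carrier G" "x \<in> U" shows "\<psi> g (\<pi> x) = \<pi> (\<phi> g x)"
proof -
  let ?x = "representative U M (\<pi> x)"
  have "\<phi> g ?x \<ominus>\<^bsub>V\<^esub> \<phi> g x = \<phi> g (?x \<ominus>\<^bsub>V\<^esub> x)"
    using assms representative UV by (simp add: linear_op_diff[OF linear_op_act])
  then have "\<phi> g ?x \<ominus>\<^bsub>V\<^esub> \<phi> g x \<in> M"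
    using representative assms actM by simp
  then show ?thesis
    using assms representative actU by (simp add: quotient_action_def \<pi>_eq)
qed

lemma quotient_representation: "group_representation K G Q \<psi>"
proof -
  have U0: "\<zero>\<^bsub>V\<^esub> \<in> U" using subU by (rule submodule_zero_mem)
  note clU = submoduleE(3,4,5)[OF subU]
  have "abelian_group Q"
  proof (rule abelian_groupI)
    fix Y assume "Y \<in> carrier Q"
    then obtain x where x: "x \<in> U" "Y = \<pi> x" by (auto simp: carrier_Q)
    show "\<zero>\<^bsub>Q\<^esub> \<oplus>\<^bsub>Q\<^esub> Y = Y" using x U0 UV by (simp add: zero_Q add_\<pi>)
    have "\<pi> (\<ominus>\<^bsub>V\<^esub> x) \<oplus>\<^bsub>Q\<^esub> Y = \<zero>\<^bsub>Q\<^esub>" using x clU UV by (simp add: zero_Q add_\<pi> M.l_neg)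
    then show "\<exists>Z\<in>carrier Q. Z \<oplus>\<^bsub>Q\<^esub> Y = \<zero>\<^bsub>Q\<^esub>" using x clU by (auto simp: carrier_Q)
  next
    fix Y1 Y2 assume "Y1 \<in> carrier Q" "Y2 \<in> carrier Q"
    then obtain x y where "x \<in> U" "Y1 = \<pi> x" "y \<in> U" "Y2 = \<pi> y" by (auto simp: carrier_Q)
    then show "Y1 \<oplus>\<^bsub>Q\<^esub> Y2 \<in> carrier Q" "Y1 \<oplus>\<^bsub>Q\<^esub> Y2 = Y2 \<oplus>\<^bsub>Q\<^esub> Y1"
      using clU UV by (auto simp: carrier_Q add_\<pi> M.a_comm)
  next
    fix Y1 Y2 Y3 assume "Y1 \<in> carrier Q" "Y2 \<in> carrier Q" "Y3 \<in> carrier Q"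
    then obtain x y z where "x \<in> U" "Y1 = \<pi> x" "y \<in> U" "Y2 = \<pi> y" "z \<in> U" "Y3 = \<pi> z"
      by (auto simp: carrier_Q)
    then show "Y1 \<oplus>\<^bsub>Q\<^esub> Y2 \<oplus>\<^bsub>Q\<^esub> Y3 = Y1 \<oplus>\<^bsub>Q\<^esub> (Y2 \<oplus>\<^bsub>Q\<^esub> Y3)"
      using clU UV by (simp add: add_\<pi> M.a_assoc)
  qed (use U0 in \<open>simp add: carrier_Q zero_Q\<close>)
  then have "module K Q"
  proof (intro moduleI is_cring)
    show "a \<odot>\<^bsub>Q\<^esub> Y \<in> carrier Q" if "a \<in> carrier K" "Y \<in> carrier Q" for a Y
      using that clU by (auto simp: carrier_Q smult_\<pi>)
    show "\<one> \<odot>\<^bsub>Q\<^esub> Y = Y" if "Y \<in> carrier Q" for Y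
      using that UV by (auto simp: carrier_Q smult_\<pi>)
  next
    fix a b Y assume ab: "a \<in> carrier K" "b \<in> carrier K" and "Y \<in> carrier Q"
    then obtain x where x: "x \<in> U" "Y = \<pi> x" by (auto simp: carrier_Q)
    show "(a \<oplus> b) \<odot>\<^bsub>Q\<^esub> Y = a \<odot>\<^bsub>Q\<^esub> Y \<oplus>\<^bsub>Q\<^esub> b \<odot>\<^bsub>Q\<^esub> Y"
      using ab x clU UV by (simp add: smult_\<pi> add_\<pi> smult_l_distr)
    show "(a \<otimes> b) \<odot>\<^bsub>Q\<^esub> Y = a \<odot>\<^bsub>Q\<^esub> (b \<odot>\<^bsub>Q\<^esub> Y)"
      using ab x clU UV by (simp add: smult_\<pi> smult_assoc1)
  next
    fix a Y1 Y2 assume a: "a \<in> carrier K" and "Y1 \<in> carrier Q" "Y2 \<in> carrier Q"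
    then obtain x y where "x \<in> U" "Y1 = \<pi> x" "y \<in> U" "Y2 = \<pi> y" by (auto simp: carrier_Q)
    then show "a \<odot>\<^bsub>Q\<^esub> (Y1 \<oplus>\<^bsub>Q\<^esub> Y2) = a \<odot>\<^bsub>Q\<^esub> Y1 \<oplus>\<^bsub>Q\<^esub> a \<odot>\<^bsub>Q\<^esub> Y2"
      using a clU UV by (simp add: smult_\<pi> add_\<pi> smult_r_distr)
  qed
  moreover have "group_action G (carrier Q) \<psi>"
  proof (rule group_actionI[OF G.is_group])
    show "\<psi> g \<in> extensional (carrier Q)" for g by (simp add: quotient_action_def carrier_Q)
    show "\<psi> g Y \<in> carrier Q" if "g \<in> carrier G" "Y \<in> carrier Q" for g Y
      using that actU by (auto simp: carrier_Q act_\<pi>)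
    show "\<psi> \<one>\<^bsub>G\<^esub> Y = Y" if "Y \<in> carrier Q" for Y
      using that UV by (auto simp: carrier_Q act_\<pi> act_one)
    show "\<psi> (g \<otimes>\<^bsub>G\<^esub> h) Y = \<psi> g (\<psi> h Y)" if "g \<in> carrier G" "h \<in> carrier G" "Y \<in> carrier Q" for g h Y
      using that actU UV by (auto simp: carrier_Q act_\<pi> composition_rule)
  qed
  moreover have "group_representation_axioms K G Q \<psi>"
    using actU clU UV
    by unfold_locales (auto simp: carrier_Q act_\<pi> add_\<pi> smult_\<pi> rep_add rep_smult)
  ultimately show ?thesis
    by (intro group_representation.intro field_axioms)
qed

lemma quotient_irreducible:
  assumes proper: "M \<noteq> U" and max: "\<And>W. subrep W K G V \<phi> \<Longrightarrow> M \<subset> W \<Longrightarrow> W \<subseteq> U \<Longrightarrow> W = U"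
  shows "irreducible_rep K G Q \<psi>"
proof -
  interpret Q: group_representation K G Q \<psi> by (rule quotient_representation)
  have U0: "\<zero>\<^bsub>V\<^esub> \<in> U" using subU by (rule submodule_zero_mem)
  note clU = submoduleE(3,4,5)[OF subU]
  have zero_iff: "\<pi> x = \<zero>\<^bsub>Q\<^esub> \<longleftrightarrow> x \<in> M" if "x \<in> U" for x
    using that U0 UV by (simp add: zero_Q \<pi>_eq diff_zero)
  have "carrier Q \<noteq> {\<zero>\<^bsub>Q\<^esub>}"
    using proper MU zero_iff by (auto simp: carrier_Q)
  moreover have "W = {\<zero>\<^bsub>Q\<^esub>} \<or> W = carrier Q" if W: "subrep W K G Q \<psi>" for W
  proof -
    have sW: "submodule W K Q" and aW: "\<And>g Y. g \<in> carrier G \<Longrightarrow> Y \<in> W \<Longrightarrow> \<psi> g Y \<in> W"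
      using W by (auto simp: subrep_def)
    have WQ: "W \<subseteq> \<pi> ` U" using Q.submoduleE(1)[OF sW] by (simp add: carrier_Q)
    define W' where "W' = {x \<in> U. \<pi> x \<in> W}"
    have img: "W = \<pi> ` W'" using WQ by (auto simp: W'_def)
    have "submodule W' K V"
    proof (rule submoduleI)
      show "W' \<subseteq> carrier V" using UV by (auto simp: W'_def)
      show "\<zero>\<^bsub>V\<^esub> \<in> W'" using U0 Q.submodule_zero_mem[OF sW] by (simp add: W'_def zero_Q)
      show add: "a \<oplus>\<^bsub>V\<^esub> b \<in> W'" if "a \<in> W'" "b \<in> W'" for a b
        using that clU Q.submoduleE(5)[OF sW, of "\<pi> a" "\<pi> b"] by (auto simp: W'_def add_\<pi>)
      show smult: "c \<odot>\<^bsub>V\<^esub> a \<in> W'" if "c \<in> carrier K" "a \<in> W'" for c a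
        using that clU Q.submoduleE(4)[OF sW, of c "\<pi> a"] by (auto simp: W'_def smult_\<pi>)
      show "\<ominus>\<^bsub>V\<^esub> a \<in> W'" if "a \<in> W'" for a
        using smult[of "\<ominus> \<one>" a] that UV[of a] by (simp add: W'_def smult_l_minus)
    qed
    moreover have "\<phi> g x \<in> W'" if "g \<in> carrier G" "x \<in> W'" for g x
      using that actU aW[of g "\<pi> x"] by (auto simp: W'_def act_\<pi>)
    ultimately have W': "subrep W' K G V \<phi>" by (simp add: subrep_def)
    have "M \<subseteq> W'"
    proof
      fix x assume "x \<in> M"
      then have "x \<in> U" "\<pi> x = \<zero>\<^bsub>Q\<^esub>" using MU zero_iff by auto
      then show "x \<in> W'" using Q.submodule_zero_mem[OF sW] by (simp add: W'_def)
    qed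
    then consider "W' = M" | "W' = U" using max[OF W'] by (auto simp: W'_def)
    then show ?thesis
    proof cases
      case 1
      have "\<pi> ` M = {\<zero>\<^bsub>Q\<^esub>}" using zero_iff MU submodule_zero_mem[OF subM]
        by (auto simp: subset_iff intro!: image_eqI[of _ _ "\<zero>\<^bsub>V\<^esub>"])
      then show ?thesis using img 1 by simp
    next
      case 2
      then show ?thesis using img by (simp add: carrier_Q)
    qed
  qed
  ultimately show ?thesis by (simp add: irreducible_rep_def)
qed

end

text \<open>Take \<open>M\<close> maximal among the invariant subspaces that contain \<open>L\<close> and avoid \<open>u\<close>, and let \<open>U\<close> be the
smallest invariant subspace that contains \<open>M\<close> and \<open>u\<close>.  An invariant subspace strictly between them would
contain \<open>u\<close>, so \<open>U/M\<close> is irreducible.  Using a quotient of \<open>U\<close> rather than of \<open>V\<close> makes the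
construction work when \<open>V\<close> is not generated by \<open>u\<close>.\<close>
theorem (in group_representation) ex_irreducible_quotient:
  assumes L: "subrep L K G V \<phi>" and u: "u \<in> carrier V" "u \<notin> L"
  obtains M and Q :: "('k, 'v set) module" and \<psi> where
    "subrep M K G V \<phi>" "L \<subseteq> M" "u \<notin> M"
    "group_representation K G Q \<psi>" "irreducible_rep K G Q \<psi>"
    "\<And>g. g \<in> carrier G \<Longrightarrow> \<forall>x\<in>carrier Q. \<psi> g x = x \<Longrightarrow> shift g u \<in> M"
proof -
  obtain M where hM: "subrep M K G V \<phi>" "L \<subseteq> M" "u \<notin> M"
    "\<And>W. subrep W K G V \<phi> \<Longrightarrow> M \<subset> W \<Longrightarrow> u \<in> W"
    using L u(2) by (rule subrep_maximal_avoiding) blast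
  let ?\<W> = "{W. subrep W K G V \<phi> \<and> M \<subseteq> W \<and> u \<in> W}"
  define U where "U = \<Inter>?\<W>"
  have MV: "M \<subseteq> carrier V" using hM(1) submoduleE(1) by (auto simp: subrep_def)
  have "subrep (carrier V) K G V \<phi>"
    by (simp add: subrep_def carrier_is_submodule act_closed)
  then have "carrier V \<in> ?\<W>" using MV u(1) by simp
  then have U: "subrep U K G V \<phi>" unfolding U_def by (intro subrep_Inter) auto
  have MU: "M \<subseteq> U" and uU: "u \<in> U" by (auto simp: U_def)
  interpret subrep_pair K G V \<phi> U M by unfold_locales (use U hM(1) MU in auto)
  have "irreducible_rep K G Q \<psi>"
  proof (rule quotient_irreducible)
    show "M \<noteq> U" using hM(3) uU by blast
    fix W assume W: "subrep W K G V \<phi>" "M \<subset> W" "W \<subseteq> U"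
    then have "W \<in> ?\<W>" using hM(4) by auto
    then have "U \<subseteq> W" unfolding U_def by blast
    then show "W = U" using W by blast
  qed
  moreover have "shift g u \<in> M" if g: "g \<in> carrier G" and triv: "\<forall>x\<in>carrier Q. \<psi> g x = x" for g
  proof -
    have "\<pi> (\<phi> g u) = \<pi> u" using triv uU g by (simp add: carrier_Q act_\<pi>)
    then show ?thesis using \<pi>_eq[OF actU[OF g uU] uU] by (simp add: shift_def)
  qed
  ultimately show ?thesis using that[OF hM(1-3) quotient_representation] by blast
qed

section \<open>Functions on the group under translation\<close>

lemma (in group) ex_pow_prime_order_mod_subgroup:
  assumes tors: "torsion_group G" and C: "subgroup C G" and n: "n \<in> carrier G" "n \<notin> C"
  obtains p m :: nat where "Factorial_Ring.prime p" "n [^] m \<notin> C" "(n [^] m) [^] p \<in> C"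
proof -
  obtain e :: nat where e: "e > 0" "n [^] e = \<one>" using tors n by (auto simp: torsion_group_def)
  define k where "k = (LEAST k::nat. k > 0 \<and> n [^] k \<in> C)"
  have "e > 0 \<and> n [^] e \<in> C" using e subgroup.one_closed[OF C] by simp
  then have "k > 0 \<and> n [^] k \<in> C" unfolding k_def by (rule LeastI)
  then have k: "k > 0" "n [^] k \<in> C" by auto
  have "k \<noteq> 1" using k(2) n by auto
  then obtain p where p: "Factorial_Ring.prime p" "p dvd k" using prime_factor_nat by blast
  then obtain m where m: "k = p * m" by blast
  have "0 < m" "m < k" using k(1) prime_gt_1_nat[OF p(1)] by (auto simp: m)
  then have "n [^] m \<notin> C"
    using not_less_Least[of m "\<lambda>k::nat. k > 0 \<and> n [^] k \<in> C"] by (simp add: k_def)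
  moreover have "(n [^] m) [^] p \<in> C" using k(2) n by (simp add: nat_pow_pow m mult.commute)
  ultimately show ?thesis using that p(1) by blast
qed

lemma (in group) inv_mult_mem_subgroup_iff:
  assumes H: "subgroup H G" and a: "a \<in> H" and x: "x \<in> carrier G"
  shows "inv a \<otimes> x \<in> H \<longleftrightarrow> x \<in> H"
proof
  have aG: "a \<in> carrier G" using a subgroup.subset[OF H] by blast
  assume "inv a \<otimes> x \<in> H"
  then have "a \<otimes> (inv a \<otimes> x) \<in> H" by (rule subgroup.m_closed[OF H a])
  then show "x \<in> H" using aG x by (simp add: m_assoc[symmetric])
next
  assume "x \<in> H"
  with subgroup.m_inv_closed[OF H a] show "inv a \<otimes> x \<in> H" by (rule subgroup.m_closed[OF H])
qed

text \<open>All functions from \<open>G\<close> to \<open>K\<close>, with no condition on the support.  They vanish outside the carrier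
of \<open>G\<close>, so that a function is determined by its values on \<open>G\<close>.\<close>
definition fun_module :: "('k, 'm) ring_scheme \<Rightarrow> ('g, 'n) monoid_scheme \<Rightarrow> ('k, 'g \<Rightarrow> 'k) module" where
  "fun_module K G =
    \<lparr>carrier = {f. (\<forall>x. f x \<in> carrier K) \<and> (\<forall>x. x \<notin> carrier G \<longrightarrow> f x = \<zero>\<^bsub>K\<^esub>)},
     monoid.mult = undefined, one = undefined, ring.zero = (\<lambda>_. \<zero>\<^bsub>K\<^esub>),
     ring.add = (\<lambda>f h x. f x \<oplus>\<^bsub>K\<^esub> h x), smult = (\<lambda>c f x. c \<otimes>\<^bsub>K\<^esub> f x)\<rparr>"

definition translation :: "('k, 'm) ring_scheme \<Rightarrow> ('g, 'n) monoid_scheme \<Rightarrow> 'g \<Rightarrow> ('g \<Rightarrow> 'k) \<Rightarrow> 'g \<Rightarrow> 'k" where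
  "translation K G a =
     (\<lambda>f \<in> carrier (fun_module K G). \<lambda>x. if x \<in> carrier G then f (inv\<^bsub>G\<^esub> a \<otimes>\<^bsub>G\<^esub> x) else \<zero>\<^bsub>K\<^esub>)"

lemma fun_module_representation:
  assumes "field K" "group G"
  shows "group_representation K G (fun_module K G) (translation K G)"
proof -
  interpret K: field K by (rule assms)
  interpret G: group G by (rule assms)
  let ?V = "fun_module K G"
  have cV: "f \<in> carrier ?V \<longleftrightarrow> (\<forall>x. f x \<in> carrier K) \<and> (\<forall>x. x \<notin> carrier G \<longrightarrow> f x = \<zero>\<^bsub>K\<^esub>)" for f
    by (simp add: fun_module_def)
  have ops: "\<zero>\<^bsub>?V\<^esub> = (\<lambda>_. \<zero>\<^bsub>K\<^esub>)" "f \<oplus>\<^bsub>?V\<^esub> h = (\<lambda>x. f x \<oplus>\<^bsub>K\<^esub> h x)" "c \<odot>\<^bsub>?V\<^esub> f = (\<lambda>x. c \<otimes>\<^bsub>K\<^esub> f x)" for f h c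
    by (simp_all add: fun_module_def)
  have "abelian_group ?V"
  proof (rule abelian_groupI)
    fix f assume f: "f \<in> carrier ?V"
    have "(\<lambda>x. \<ominus>\<^bsub>K\<^esub> f x) \<in> carrier ?V" "(\<lambda>x. \<ominus>\<^bsub>K\<^esub> f x) \<oplus>\<^bsub>?V\<^esub> f = \<zero>\<^bsub>?V\<^esub>"
      using f by (auto simp: cV ops K.l_neg)
    then show "\<exists>h\<in>carrier ?V. h \<oplus>\<^bsub>?V\<^esub> f = \<zero>\<^bsub>?V\<^esub>" by blast
  qed (auto simp: cV ops K.a_ac)
  then have "module K ?V"
    by (intro moduleI K.is_cring) (auto simp: cV ops K.l_distr K.r_distr K.m_assoc)
  moreover have "group_action G (carrier ?V) (translation K G)"
  proof (rule group_actionI[OF assms(2)])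
    show "translation K G g f \<in> carrier ?V" if "g \<in> carrier G" "f \<in> carrier ?V" for g f
      using that by (auto simp: cV translation_def)
    then show "translation K G (g \<otimes>\<^bsub>G\<^esub> h) f = translation K G g (translation K G h f)"
      if "g \<in> carrier G" "h \<in> carrier G" "f \<in> carrier ?V" for g h f
      using that by (auto simp: translation_def G.inv_mult_group G.m_assoc)
    show "translation K G \<one>\<^bsub>G\<^esub> f = f" if "f \<in> carrier ?V" for f
      using that by (auto simp: translation_def cV)
  qed (auto simp: translation_def)
  moreover have "group_representation_axioms K G ?V (translation K G)"
  proof
    have cl: "f \<oplus>\<^bsub>?V\<^esub> h \<in> carrier ?V" "c \<odot>\<^bsub>?V\<^esub> f \<in> carrier ?V"
      if "f \<in> carrier ?V" "h \<in> carrier ?V" "c \<in> carrier K" for f h c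
      using that by (auto simp: cV ops)
    show "translation K G g (f \<oplus>\<^bsub>?V\<^esub> h) = translation K G g f \<oplus>\<^bsub>?V\<^esub> translation K G g h"
      if "g \<in> carrier G" "f \<in> carrier ?V" "h \<in> carrier ?V" for g f h
      using that cl(1)[OF that(2,3) K.zero_closed] by (auto simp: translation_def ops)
    show "translation K G g (c \<odot>\<^bsub>?V\<^esub> f) = c \<odot>\<^bsub>?V\<^esub> translation K G g f"
      if "g \<in> carrier G" "c \<in> carrier K" "f \<in> carrier ?V" for g f c
      using that cl(2)[OF that(3,3,2)] by (auto simp: translation_def ops)
  qed
  ultimately show ?thesis
    by (intro group_representation.intro assms)
qed

locale translated_functions = K: field K + G: group G
  for K :: "('k, 'm) ring_scheme" and G :: "('g, 'n) monoid_scheme" +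
  fixes A :: "'g set" and C :: "'g set"
  assumes subA: "subgroup A G" and subC: "subgroup C G" and CA: "C \<subseteq> A"
    and commA: "\<And>a b. a \<in> A \<Longrightarrow> b \<in> A \<Longrightarrow> a \<otimes>\<^bsub>G\<^esub> b = b \<otimes>\<^bsub>G\<^esub> a"
begin

abbreviation "V \<equiv> fun_module K G"
abbreviation "\<tau> \<equiv> translation K G"

sublocale R: group_representation K G V \<tau>
  by (rule fun_module_representation) unfold_locales

lemma AG: "a \<in> A \<Longrightarrow> a \<in> carrier G" using subgroup.subset[OF subA] by blast

lemma carrier_V: "f \<in> carrier V \<longleftrightarrow> (\<forall>x. f x \<in> carrier K) \<and> (\<forall>x. x \<notin> carrier G \<longrightarrow> f x = \<zero>\<^bsub>K\<^esub>)"
  and zero_V: "\<zero>\<^bsub>V\<^esub> = (\<lambda>_. \<zero>\<^bsub>K\<^esub>)"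
  and add_V: "f \<oplus>\<^bsub>V\<^esub> h = (\<lambda>x. f x \<oplus>\<^bsub>K\<^esub> h x)"
  and smult_V: "c \<odot>\<^bsub>V\<^esub> f = (\<lambda>x. c \<otimes>\<^bsub>K\<^esub> f x)"
  by (simp_all add: fun_module_def)

lemma \<tau>_apply: "f \<in> carrier V \<Longrightarrow> x \<in> carrier G \<Longrightarrow> \<tau> a f x = f (inv\<^bsub>G\<^esub> a \<otimes>\<^bsub>G\<^esub> x)"
  by (simp add: translation_def)

lemma neg_V: "f \<in> carrier V \<Longrightarrow> \<ominus>\<^bsub>V\<^esub> f = (\<lambda>x. \<ominus>\<^bsub>K\<^esub> f x)"
  by (rule R.M.minus_equality) (auto simp: carrier_V zero_V add_V K.l_neg)

lemma diff_V: "f \<in> carrier V \<Longrightarrow> h \<in> carrier V \<Longrightarrow> (f \<ominus>\<^bsub>V\<^esub> h) x = f x \<ominus>\<^bsub>K\<^esub> h x"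
  by (simp add: a_minus_def add_V neg_V)

text \<open>This function is fixed by \<open>C\<close>, and it generates a copy of the permutation module on the cosets of \<open>C\<close>.\<close>
definition indicator :: "'g \<Rightarrow> 'k" where
  "indicator = (\<lambda>x. if x \<in> C then \<one>\<^bsub>K\<^esub> else \<zero>\<^bsub>K\<^esub>)"

definition cut :: "('g \<Rightarrow> 'k) \<Rightarrow> 'g \<Rightarrow> 'k" where
  "cut f = (\<lambda>x. if x \<in> A then f x else \<zero>\<^bsub>K\<^esub>)"

lemma indicator_closed: "indicator \<in> carrier V"
  using CA AG by (auto simp: carrier_V indicator_def)

lemma linear_op_cut: "R.linear_op cut"
  using AG by (auto simp: R.linear_op_def cut_def carrier_V add_V smult_V)

lemma cut_indicator: "cut indicator = indicator"
  using CA by (auto simp: cut_def indicator_def fun_eq_iff)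

lemma cut_\<tau>:
  assumes "a \<in> A" "f \<in> carrier V" shows "cut (\<tau> a f) = \<tau> a (cut f)"
proof
  fix x
  have "cut f \<in> carrier V" using linear_op_cut assms(2) by (rule R.linear_op_closed)
  then show "cut (\<tau> a f) x = \<tau> a (cut f) x"
    using assms AG G.inv_mult_mem_subgroup_iff[OF subA assms(1), of x] by (auto simp: cut_def translation_def)
qed

lemma cut_shift:
  assumes "a \<in> A" "f \<in> carrier V" shows "cut (R.shift a f) = R.shift a (cut f)"
  using assms AG linear_op_cut
  by (simp add: R.shift_def R.linear_op_diff R.act_closed cut_\<tau>)

lemma \<tau>_indicator: "c \<in> C \<Longrightarrow> \<tau> c indicator = indicator"
proof
  fix x assume c: "c \<in> C"
  then show "\<tau> c indicator x = indicator x"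
    using indicator_closed CA AG G.inv_mult_mem_subgroup_iff[OF subC c, of x] by (auto simp: translation_def indicator_def)
qed

text \<open>Translates by elements of \<open>A\<close> of a function supported on \<open>C\<close> remain supported on \<open>A\<close>.\<close>
lemma power_sum_indicator_support:
  assumes d: "d \<in> A" and x: "x \<notin> A"
  shows "R.power_sum m d indicator x = \<zero>\<^bsub>K\<^esub>"
proof -
  let ?S = "{f \<in> carrier V. \<forall>x. x \<notin> A \<longrightarrow> f x = \<zero>\<^bsub>K\<^esub>}"
  have "submodule ?S K V"
    by (rule R.submoduleI) (auto simp: zero_V neg_V add_V smult_V carrier_V)
  moreover have "\<tau> a indicator \<in> ?S" if a: "a \<in> A" for a
  proof -
    have V: "\<tau> a indicator \<in> carrier V" using AG[OF a] indicator_closed by (rule R.act_closed)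
    have "\<tau> a indicator x = \<zero>\<^bsub>K\<^esub>" if "x \<notin> A" for x
    proof (cases "x \<in> carrier G")
      case True
      then have "inv\<^bsub>G\<^esub> a \<otimes>\<^bsub>G\<^esub> x \<notin> C"
        using that CA G.inv_mult_mem_subgroup_iff[OF subA a] by blast
      then show ?thesis using \<tau>_apply[OF indicator_closed True] by (simp add: indicator_def)
    qed (use V in \<open>simp add: carrier_V\<close>)
    then show ?thesis using V by blast
  qed
  moreover have "d [^]\<^bsub>G\<^esub> i \<in> A" for i :: nat
    using G.subgroup_int_pow_closed[OF subA d, of "int i"] by (simp add: int_pow_int)
  ultimately have "R.power_sum m d indicator \<in> ?S"
    unfolding R.power_sum_def by (intro R.submodule_finsum) auto
  then show ?thesis using x by blast
qed

end

text \<open>The element \<open>d p\<close> has order \<open>p\<close> modulo \<open>C\<close>.  If the power sums of all \<open>d p\<close> kill a nonzero vector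
and the primes \<open>p\<close> are invertible in \<open>K\<close>, then no \<open>d p\<close> fixes that vector.  So the indicator
function has to be separated from an invariant subspace that contains these power sums of it.\<close>
locale separated_indicator = translated_functions K G A C
  for K :: "('k, 'm) ring_scheme" and G :: "('g, 'n) monoid_scheme" and A C :: "'g set" +
  fixes P :: "nat set" and d :: "nat \<Rightarrow> 'g"
  assumes P: "\<And>p. p \<in> P \<Longrightarrow> Factorial_Ring.prime p"
    and dA: "\<And>p. p \<in> P \<Longrightarrow> d p \<in> A" and dC: "\<And>p. p \<in> P \<Longrightarrow> d p \<notin> C"
    and d_pow: "\<And>p. p \<in> P \<Longrightarrow> d p [^]\<^bsub>G\<^esub> p \<in> C"
begin

abbreviation "D p \<equiv> R.shift (d p)"

lemma commuting_ops_D: "R.commuting_ops D P"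
proof -
  have "R.commuting_ops R.shift A" using AG commA by (intro R.commuting_ops_shift) auto
  then show ?thesis using dA by (simp add: R.commuting_ops_def)
qed

text \<open>If \<open>h\<close> is nonzero on \<open>A\<close> with support in the elements whose \<open>m\<close>-th power lies in \<open>C\<close>, where \<open>m\<close> is a product of
primes other than \<open>q\<close>, then \<open>D q h\<close> is again nonzero: otherwise \<open>h\<close> would be invariant under \<open>d q\<close>, its
support would contain two elements that differ by \<open>d q\<close>, and the \<open>m\<close>-th power of \<open>d q\<close> would lie in \<open>C\<close>,
which is impossible for an element of order \<open>q\<close> modulo \<open>C\<close>.\<close>
lemma foldr_D_indicator:
  assumes "distinct ps" "set ps \<subseteq> P"
  shows "(\<exists>x\<in>A. foldr D ps indicator x \<noteq> \<zero>\<^bsub>K\<^esub>) \<and>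
    (\<forall>x\<in>A. foldr D ps indicator x \<noteq> \<zero>\<^bsub>K\<^esub> \<longrightarrow> x [^]\<^bsub>G\<^esub> prod_list ps \<in> C)"
  using assms
proof (induction ps)
  case Nil
  have "\<one>\<^bsub>G\<^esub> \<in> A" "\<one>\<^bsub>G\<^esub> \<in> C" using subA subC subgroup.one_closed by auto
  then show ?case using AG by (auto simp: indicator_def)
next
  case (Cons q ps)
  define h where "h = foldr D ps indicator"
  define m where "m = prod_list ps"
  have q: "Factorial_Ring.prime q" "q \<in> P" "q \<notin> set ps" "set ps \<subseteq> P" using Cons.prems P by auto
  obtain x0 where x0: "x0 \<in> A" "h x0 \<noteq> \<zero>\<^bsub>K\<^esub>"
    and supp: "\<And>x. x \<in> A \<Longrightarrow> h x \<noteq> \<zero>\<^bsub>K\<^esub> \<Longrightarrow> x [^]\<^bsub>G\<^esub> m \<in> C"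
    using Cons unfolding h_def m_def by auto
  have hV: "h \<in> carrier V"
    unfolding h_def using R.linear_op_closed[OF R.commuting_ops_foldr[OF commuting_ops_D q(4)] indicator_closed] .
  have dq: "d q \<in> A" "d q \<in> carrier G" "inv\<^bsub>G\<^esub> d q \<in> A" using dA[OF q(2)] AG subgroup.m_inv_closed[OF subA] by auto
  have Dh: "D q h x = h (inv\<^bsub>G\<^esub> d q \<otimes>\<^bsub>G\<^esub> x) \<ominus>\<^bsub>K\<^esub> h x" if "x \<in> A" for x
    using that AG hV dq by (simp add: R.shift_def diff_V R.act_closed \<tau>_apply)
  have pow: "(a \<otimes>\<^bsub>G\<^esub> b) [^]\<^bsub>G\<^esub> (n::nat) = a [^]\<^bsub>G\<^esub> n \<otimes>\<^bsub>G\<^esub> b [^]\<^bsub>G\<^esub> n" if "a \<in> A" "b \<in> A" for a b n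
    using that AG commA by (intro G.pow_mult_distrib) auto
  have invpow: "(inv\<^bsub>G\<^esub> d q) [^]\<^bsub>G\<^esub> (n::nat) = inv\<^bsub>G\<^esub> (d q [^]\<^bsub>G\<^esub> n)" for n
    using dq by (simp add: G.nat_pow_inv)
  have hK: "h x \<in> carrier K" for x using hV by (simp add: carrier_V)
  have "\<exists>x\<in>A. D q h x \<noteq> \<zero>\<^bsub>K\<^esub>"
  proof (rule ccontr)
    assume "\<not> ?thesis"
    then have "h (inv\<^bsub>G\<^esub> d q \<otimes>\<^bsub>G\<^esub> x0) \<ominus>\<^bsub>K\<^esub> h x0 = \<zero>\<^bsub>K\<^esub>" using x0 Dh by auto
    then have "h (inv\<^bsub>G\<^esub> d q \<otimes>\<^bsub>G\<^esub> x0) \<noteq> \<zero>\<^bsub>K\<^esub>" using hK x0(2) by simp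
    moreover have "inv\<^bsub>G\<^esub> d q \<otimes>\<^bsub>G\<^esub> x0 \<in> A" using dq x0 by (intro subgroup.m_closed[OF subA])
    ultimately have "(inv\<^bsub>G\<^esub> d q \<otimes>\<^bsub>G\<^esub> x0) [^]\<^bsub>G\<^esub> m \<in> C" using supp by blast
    then have "inv\<^bsub>G\<^esub> (d q [^]\<^bsub>G\<^esub> m) \<otimes>\<^bsub>G\<^esub> x0 [^]\<^bsub>G\<^esub> m \<in> C"
      using pow[OF dq(3) x0(1)] invpow by simp
    moreover have x0C: "x0 [^]\<^bsub>G\<^esub> m \<in> C" using supp x0 by blast
    ultimately have "(inv\<^bsub>G\<^esub> (d q [^]\<^bsub>G\<^esub> m) \<otimes>\<^bsub>G\<^esub> x0 [^]\<^bsub>G\<^esub> m) \<otimes>\<^bsub>G\<^esub> inv\<^bsub>G\<^esub> (x0 [^]\<^bsub>G\<^esub> m) \<in> C"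
      by (simp add: subgroup.m_closed[OF subC] subgroup.m_inv_closed[OF subC])
    then have "inv\<^bsub>G\<^esub> (d q [^]\<^bsub>G\<^esub> m) \<in> C" using dq x0 AG by (simp add: G.m_assoc)
    then have "inv\<^bsub>G\<^esub> (inv\<^bsub>G\<^esub> (d q [^]\<^bsub>G\<^esub> m)) \<in> C" by (rule subgroup.m_inv_closed[OF subC])
    then have dm: "d q [^]\<^bsub>G\<^esub> m \<in> C" using dq by simp
    have "\<not> q dvd m"
    proof
      assume "q dvd m"
      then obtain r where "r \<in> set ps" "q dvd r"
        using prime_dvd_prod_mset_iff[OF q(1), of "mset ps"] by (auto simp: m_def prod_mset_prod_list)
      then show False using q P primes_dvd_imp_eq by blast
    qed
    then have "coprime q m" using q(1) by (simp add: prime_imp_coprime)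
    then have "d q \<in> C" using G.subgroup_pow_coprime[OF subC dq(2) d_pow[OF q(2)] dm] by simp
    then show False using dC q(2) by blast
  qed
  moreover have "x [^]\<^bsub>G\<^esub> (q * m) \<in> C" if x: "x \<in> A" "D q h x \<noteq> \<zero>\<^bsub>K\<^esub>" for x
  proof (cases "h x = \<zero>\<^bsub>K\<^esub>")
    case False
    then have "x [^]\<^bsub>G\<^esub> m \<in> C" using supp x by blast
    then have "(x [^]\<^bsub>G\<^esub> m) [^]\<^bsub>G\<^esub> (int q) \<in> C" by (rule G.subgroup_int_pow_closed[OF subC])
    then show ?thesis using x AG by (simp add: int_pow_int G.nat_pow_pow mult.commute)
  next
    case True
    let ?y = "inv\<^bsub>G\<^esub> d q \<otimes>\<^bsub>G\<^esub> x"
    have "h ?y \<noteq> \<zero>\<^bsub>K\<^esub>" using x Dh True by (auto simp: a_minus_def K.minus_zero)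
    moreover have y: "?y \<in> A" using dq x by (intro subgroup.m_closed[OF subA])
    ultimately have "?y [^]\<^bsub>G\<^esub> m \<in> C" using supp by blast
    then have "(?y [^]\<^bsub>G\<^esub> m) [^]\<^bsub>G\<^esub> (int q) \<in> C" by (rule G.subgroup_int_pow_closed[OF subC])
    then have "?y [^]\<^bsub>G\<^esub> (q * m) \<in> C" using y AG by (simp add: int_pow_int G.nat_pow_pow mult.commute)
    then have yC: "inv\<^bsub>G\<^esub> (d q [^]\<^bsub>G\<^esub> (q * m)) \<otimes>\<^bsub>G\<^esub> x [^]\<^bsub>G\<^esub> (q * m) \<in> C"
      using pow[OF dq(3) x(1)] invpow by simp
    have "(d q [^]\<^bsub>G\<^esub> q) [^]\<^bsub>G\<^esub> (int m) \<in> C" using d_pow[OF q(2)] by (rule G.subgroup_int_pow_closed[OF subC])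
    then have "d q [^]\<^bsub>G\<^esub> (q * m) \<in> C" using dq by (simp add: int_pow_int G.nat_pow_pow)
    then show ?thesis
      using yC G.inv_mult_mem_subgroup_iff[OF subC, of "d q [^]\<^bsub>G\<^esub> (q * m)" "x [^]\<^bsub>G\<^esub> (q * m)"] x AG by simp
  qed
  ultimately show ?case by (simp add: h_def m_def)
qed

text \<open>An invariant subspace that contains the power sums of the indicator function, described by the
behaviour of all translates on \<open>A\<close> instead of by generators.  Quantifying over translates makes it
invariant under \<open>G\<close>, and cutting down to \<open>A\<close> is what confines the analysis to the commutative
group \<open>A\<close>.\<close>
definition split_subrep :: "('g \<Rightarrow> 'k) set" where
  "split_subrep = {f \<in> carrier V. \<forall>g\<in>carrier G. cut (\<tau> g f) \<in> R.eventual_kernel D P}"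

lemma subrep_split_subrep: "subrep split_subrep K G V \<tau>"
proof -
  let ?Z = "R.eventual_kernel D P"
  have Z: "submodule ?Z K V" using commuting_ops_D by (rule R.submodule_eventual_kernel)
  have lin: "R.linear_op (\<lambda>f. cut (\<tau> g f))" if "g \<in> carrier G" for g
    using linear_op_cut R.linear_op_act[OF that] by (simp add: R.linear_op_def)
  have "submodule split_subrep K V"
  proof (rule R.submoduleI)
    show "split_subrep \<subseteq> carrier V" by (auto simp: split_subrep_def)
    show "\<zero>\<^bsub>V\<^esub> \<in> split_subrep"
      using R.linear_op_zero[OF lin] R.submodule_zero_mem[OF Z] by (simp add: split_subrep_def)
    show "\<ominus>\<^bsub>V\<^esub> f \<in> split_subrep" if "f \<in> split_subrep" for f
      using that R.linear_op_neg[OF lin] R.submoduleE(3)[OF Z] by (simp add: split_subrep_def)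
    show "f \<oplus>\<^bsub>V\<^esub> h \<in> split_subrep" if "f \<in> split_subrep" "h \<in> split_subrep" for f h
      using that R.linear_op_add[OF lin] R.submoduleE(5)[OF Z] by (simp add: split_subrep_def)
    show "c \<odot>\<^bsub>V\<^esub> f \<in> split_subrep" if "c \<in> carrier K" "f \<in> split_subrep" for c f
      using that R.linear_op_smult[OF lin] R.submoduleE(4)[OF Z] by (simp add: split_subrep_def)
  qed
  moreover have "\<tau> a f \<in> split_subrep" if a: "a \<in> carrier G" and f: "f \<in> split_subrep" for a f
    using a f R.act_closed R.composition_rule[of f _ a, symmetric] by (auto simp: split_subrep_def)
  ultimately show ?thesis by (simp add: subrep_def)
qed

text \<open>A translate by an element of \<open>A\<close> is killed by \<open>d p - 1\<close>, because \<open>(d p)^p\<close> fixes the indicator function; a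
translate by any other element vanishes on \<open>A\<close>.\<close>
lemma power_sum_mem_split_subrep:
  assumes p: "p \<in> P"
  shows "R.power_sum p (d p) indicator \<in> split_subrep"
proof -
  let ?Z = "R.eventual_kernel D P" and ?f = "R.power_sum p (d p) indicator"
  have dG: "d p \<in> carrier G" using dA[OF p] AG by blast
  have fV: "?f \<in> carrier V" using dG indicator_closed by (rule R.power_sum_closed)
  have "cut (\<tau> g ?f) \<in> ?Z" if g: "g \<in> carrier G" for g
  proof (cases "g \<in> A")
    case True
    have gV: "\<tau> g ?f \<in> carrier V" using g fV by (rule R.act_closed)
    have "D p ?f = R.shift (d p [^]\<^bsub>G\<^esub> p) indicator" using dG indicator_closed by (rule R.shift_power_sum)
    also have "\<dots> = \<zero>\<^bsub>V\<^esub>"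
      using \<tau>_indicator[OF d_pow[OF p]] indicator_closed dG by (simp add: R.shift_eq_zero_iff)
    finally have "D p (\<tau> g ?f) = \<zero>\<^bsub>V\<^esub>"
      using R.act_shift[OF g dG fV] R.conj_commute[OF g dG commA[OF True dA[OF p]]]
        R.linear_op_zero[OF R.linear_op_act[OF g]] by simp
    then have "D p (cut (\<tau> g ?f)) = \<zero>\<^bsub>V\<^esub>"
      using cut_shift[OF dA[OF p] gV] R.linear_op_zero[OF linear_op_cut] by simp
    then show ?thesis
      using p R.linear_op_closed[OF linear_op_cut gV] by (intro R.eventual_kernel_mem[OF commuting_ops_D])
  next
    case False
    have "cut (\<tau> g ?f) = \<zero>\<^bsub>V\<^esub>"
    proof
      fix x
      have "inv\<^bsub>G\<^esub> g \<otimes>\<^bsub>G\<^esub> x \<notin> A" if x: "x \<in> A"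
      proof
        assume y: "inv\<^bsub>G\<^esub> g \<otimes>\<^bsub>G\<^esub> x \<in> A"
        have "x \<otimes>\<^bsub>G\<^esub> inv\<^bsub>G\<^esub> (inv\<^bsub>G\<^esub> g \<otimes>\<^bsub>G\<^esub> x) = g"
          using g AG[OF x] by (simp add: G.inv_mult_group G.m_assoc[symmetric])
        then have "g \<in> A"
          using subgroup.m_closed[OF subA x subgroup.m_inv_closed[OF subA y]] by simp
        then show False using False by blast
      qed
      then show "cut (\<tau> g ?f) x = \<zero>\<^bsub>V\<^esub> x"
        using AG fV power_sum_indicator_support[OF dA[OF p]] by (simp add: cut_def \<tau>_apply zero_V)
    qed
    then show ?thesis
      using R.submodule_zero_mem[OF R.submodule_eventual_kernel[OF commuting_ops_D]] by simp
  qed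
  then show ?thesis using fV by (simp add: split_subrep_def)
qed

text \<open>The eventual kernel would force a product of distinct \<open>D p\<close> to annihilate the indicator function.\<close>
lemma indicator_notin_split_subrep: "indicator \<notin> split_subrep"
proof
  assume "indicator \<in> split_subrep"
  then have "cut (\<tau> \<one>\<^bsub>G\<^esub> indicator) \<in> R.eventual_kernel D P" by (simp add: split_subrep_def)
  then have "indicator \<in> R.eventual_kernel D P"
    by (simp add: R.act_one[OF indicator_closed] cut_indicator)
  then obtain F where F: "finite F" "F \<subseteq> P"
    "\<And>ps. F \<subseteq> set ps \<Longrightarrow> set ps \<subseteq> P \<Longrightarrow> foldr D ps indicator = \<zero>\<^bsub>V\<^esub>"
    by (rule R.eventual_kernelE) blast
  obtain ps where "set ps = F" "distinct ps" using finite_distinct_list[OF F(1)] by blast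
  then show False using foldr_D_indicator[of ps] F(2) F(3)[of ps] by (simp add: zero_V)
qed

end

section \<open>The criterion for faithful irreducible representations\<close>

text \<open>The subspace \<open>M\<close> contains the power sum of \<open>d p\<close> applied to the indicator function, for each prime \<open>p\<close>
that is the order of an element of \<open>A/C\<close>.  An element of \<open>A\<close> outside \<open>C\<close> that fixes the indicator
function modulo \<open>M\<close> has a power of some prime order \<open>p\<close> modulo \<open>C\<close>.  As \<open>A/C\<close> is locally cyclic, \<open>d p\<close> lies in
the group generated by that power and \<open>C\<close>, so it fixes the indicator function too; its power sum
then acts as the nonzero scalar \<open>p\<close>, and the indicator function would lie in \<open>M\<close>.  So exactly the elements of \<open>C\<close>
fix it modulo \<open>M\<close>, the kernel of the representation meets \<open>A\<close> inside the core of \<open>C\<close>, and a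
normal subgroup that meets \<open>A\<close> trivially is trivial.\<close>
theorem core_free_imp_has_faithful_irreducible_rep:
  fixes K :: "('k, 'm) ring_scheme" and G :: "('g, 'n) monoid_scheme"
  assumes field: "field K" and group: "group G" and tors: "torsion_group G" and solv: "solvable G"
    and maxA: "maximal_abelian_normal_subgroup A G"
    and char: "ring_char K \<notin> prime_orders (G\<lparr>carrier := A\<rparr>)"
    and C: "subgroup C (G\<lparr>carrier := A\<rparr>)" and lc: "locally_cyclic (G\<lparr>carrier := A\<rparr> Mod C)"
    and core: "normal_core G C = {\<one>\<^bsub>G\<^esub>}"
  shows "has_faithful_irreducible_rep TYPE(('g \<Rightarrow> 'k) set) K G"
proof -
  interpret K: field K by (rule field)
  interpret G: group G by (rule group)
  let ?H = "G\<lparr>carrier := A\<rparr>"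
  have A: "abelian_normal_subgroup A G" using maxA by (simp add: maximal_abelian_normal_subgroup_def)
  interpret A: normal A G using A by (simp add: abelian_normal_subgroup_def)
  interpret H: comm_group ?H using A by (simp add: abelian_normal_subgroup_def)
  have subA: "subgroup A G" by (rule A.is_subgroup)
  have subC: "subgroup C G" using G.incl_subgroup[OF subA C] .
  have CA: "C \<subseteq> A" using subgroup.subset[OF C] by simp
  interpret Q: comm_group "?H Mod C" using C by (rule H.abelian_FactGroup)
  have root: "\<exists>i::int. b \<otimes>\<^bsub>G\<^esub> e [^]\<^bsub>G\<^esub> i \<in> C"
    if "Factorial_Ring.prime q" "e \<in> A" "e \<notin> C" "b \<in> A" "e [^]\<^bsub>G\<^esub> q \<in> C" "b [^]\<^bsub>G\<^esub> q \<in> C" for q :: nat and e b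
  proof -
    have "\<exists>i::int. b \<otimes>\<^bsub>?H\<^esub> e [^]\<^bsub>?H\<^esub> i \<in> C"
      using Q.locally_cyclic_imp_unique_prime_order_subgroups[OF lc] that
      unfolding H.unique_prime_order_subgroups_quotient_iff[OF C]
      by (simp add: G.nat_pow_consistent[symmetric])
    then show ?thesis using that G.int_pow_consistent[OF subA] by simp
  qed
  define P where "P = {p::nat. Factorial_Ring.prime p \<and> (\<exists>e\<in>A. e \<notin> C \<and> e [^]\<^bsub>G\<^esub> p \<in> C)}"
  then have "\<forall>p\<in>P. \<exists>e. e \<in> A \<and> e \<notin> C \<and> e [^]\<^bsub>G\<^esub> p \<in> C" by blast
  then obtain d where d: "\<forall>p\<in>P. d p \<in> A \<and> d p \<notin> C \<and> d p [^]\<^bsub>G\<^esub> p \<in> C" by metis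
  interpret separated_indicator K G A C P d
  proof (intro separated_indicator.intro translated_functions.intro translated_functions_axioms.intro
      separated_indicator_axioms.intro field group)
    show "subgroup A G" "subgroup C G" "C \<subseteq> A" by (fact subA subC CA)+
    show "a \<otimes>\<^bsub>G\<^esub> b = b \<otimes>\<^bsub>G\<^esub> a" if "a \<in> A" "b \<in> A" for a b
      using H.m_comm[of a b] that by simp
    show "Factorial_Ring.prime p" if "p \<in> P" for p using that by (simp add: P_def)
    show "d p \<in> A" "d p \<notin> C" "d p [^]\<^bsub>G\<^esub> p \<in> C" if "p \<in> P" for p using d that by blast+
  qed
  obtain M and Q :: "('k, ('g \<Rightarrow> 'k) set) module" and \<psi> where
    M: "subrep M K G V \<tau>" "split_subrep \<subseteq> M" "indicator \<notin> M"
    and rep: "group_representation K G Q \<psi>" and irr: "irreducible_rep K G Q \<psi>"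
    and triv: "\<And>g. g \<in> carrier G \<Longrightarrow> \<forall>x\<in>carrier Q. \<psi> g x = x \<Longrightarrow> R.shift g indicator \<in> M"
    using subrep_split_subrep indicator_closed indicator_notin_split_subrep
    by (rule R.ex_irreducible_quotient) blast
  interpret Q: group_representation K G Q \<psi> by (rule rep)
  have MA: "subrep M K ?H V \<tau>" using M(1) A.subset by (auto simp: subrep_def)
  have sM: "submodule M K V" using M(1) by (simp add: subrep_def)
  \<comment> \<open>The subgroup \<open>I\<close> will turn out to be \<open>C\<close>.\<close>
  define I where "I = R.inertia A M indicator"
  have subI: "subgroup I G"
    unfolding I_def using subA MA indicator_closed by (rule R.subgroup_inertia)
  have CI: "C \<subseteq> I"
  proof
    fix c assume c: "c \<in> C"
    then have "R.shift c indicator = \<zero>\<^bsub>V\<^esub>"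
      using \<tau>_indicator[OF c] indicator_closed CA A.subset by (subst R.shift_eq_zero_iff) auto
    then show "c \<in> I" using c CA R.submodule_zero_mem[OF sM] by (auto simp: I_def R.inertia_def)
  qed
  have IC: "I \<subseteq> C"
  proof (rule ccontr)
    assume "\<not> I \<subseteq> C"
    then obtain n where n: "n \<in> I" "n \<notin> C" by blast
    have nG: "n \<in> carrier G" using n subgroup.subset[OF subI] by blast
    obtain p m :: nat where p: "Factorial_Ring.prime p" and m: "n [^]\<^bsub>G\<^esub> m \<notin> C" "(n [^]\<^bsub>G\<^esub> m) [^]\<^bsub>G\<^esub> p \<in> C"
      using G.ex_pow_prime_order_mod_subgroup[OF tors subC nG n(2)] .
    define e where "e = n [^]\<^bsub>G\<^esub> m"
    have eI: "e \<in> I" using G.subgroup_int_pow_closed[OF subI n(1), of "int m"] by (simp add: e_def int_pow_int)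
    then have eA: "e \<in> A" by (simp add: I_def R.inertia_def)
    have eC: "e \<notin> C" "e [^]\<^bsub>G\<^esub> p \<in> C" using m by (simp_all add: e_def)
    have pP: "p \<in> P" using p eA eC by (auto simp: P_def)
    obtain i :: int where i: "d p \<otimes>\<^bsub>G\<^esub> e [^]\<^bsub>G\<^esub> i \<in> C"
      using root[OF p eA eC(1) dA[OF pP] eC(2) d_pow[OF pP]] by blast
    have c: "d p \<in> carrier G" "e \<in> carrier G" using dA[OF pP] eA A.subset by auto
    have "e [^]\<^bsub>G\<^esub> i \<in> I" using eI by (rule G.subgroup_int_pow_closed[OF subI])
    then have "(d p \<otimes>\<^bsub>G\<^esub> e [^]\<^bsub>G\<^esub> i) \<otimes>\<^bsub>G\<^esub> inv\<^bsub>G\<^esub> (e [^]\<^bsub>G\<^esub> i) \<in> I"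
      using i CI subgroup.m_closed[OF subI] subgroup.m_inv_closed[OF subI] by blast
    then have "d p \<in> I" using c by (simp add: G.m_assoc)
    then have sh: "R.shift (d p) indicator \<in> M" by (simp add: I_def R.inertia_def)
    have "p \<in> prime_orders ?H"
      using G.prime_order_in_quotient_imp_prime_order[OF tors subC subA eA eC p] .
    then have "[p] \<cdot>\<^bsub>K\<^esub> \<one>\<^bsub>K\<^esub> \<noteq> \<zero>\<^bsub>K\<^esub>"
      using char K.add_pow_prime_one_eq_zero_iff[OF p] by metis
    then have "indicator \<in> M"
      using R.power_sum_cancel[OF subA MA dA[OF pP] indicator_closed sh, of p]
        power_sum_mem_split_subrep[OF pP] M(2) by blast
    then show False using M(3) by blast
  qed
  define N where "N = {g \<in> carrier G. \<forall>x\<in>carrier Q. \<psi> g x = x}"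
  have conjN: "g \<otimes>\<^bsub>G\<^esub> n \<otimes>\<^bsub>G\<^esub> inv\<^bsub>G\<^esub> g \<in> N" if "g \<in> carrier G" "n \<in> N" for g n
    using that Q.act_conj[of g n] Q.act_closed Q.composition_rule Q.act_one
      Q.composition_rule[of _ g "inv\<^bsub>G\<^esub> g"]
    by (auto simp: N_def)
  have "subgroup N G"
  proof (rule G.subgroupI)
    show "N \<noteq> {}" using Q.act_one by (auto simp: N_def)
    show "inv\<^bsub>G\<^esub> a \<in> N" if "a \<in> N" for a
      using that Q.composition_rule[of _ "inv\<^bsub>G\<^esub> a" a] Q.act_one by (auto simp: N_def)
    show "a \<otimes>\<^bsub>G\<^esub> b \<in> N" if "a \<in> N" "b \<in> N" for a b
      using that by (auto simp: N_def Q.composition_rule)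
  qed (auto simp: N_def)
  then have N: "N \<lhd> G" using conjN by (intro G.normal_invI)
  interpret N: normal N G by (rule N)
  have "N \<inter> A \<subseteq> {\<one>\<^bsub>G\<^esub>}"
  proof
    fix n assume n: "n \<in> N \<inter> A"
    have "inv\<^bsub>G\<^esub> g \<otimes>\<^bsub>G\<^esub> n \<otimes>\<^bsub>G\<^esub> g \<in> C" if g: "g \<in> carrier G" for g
    proof -
      let ?n = "inv\<^bsub>G\<^esub> g \<otimes>\<^bsub>G\<^esub> n \<otimes>\<^bsub>G\<^esub> g"
      have "?n \<in> N" "?n \<in> A" using n g N.inv_op_closed1 A.inv_op_closed1 by auto
      then have "?n \<in> carrier G" "\<forall>x\<in>carrier Q. \<psi> ?n x = x" unfolding N_def by blast+
      then have "R.shift ?n indicator \<in> M" by (rule triv)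
      then have "?n \<in> I" using \<open>?n \<in> A\<close> by (simp add: I_def R.inertia_def)
      then show ?thesis using IC by blast
    qed
    then have "n \<in> normal_core G C"
      using n A.subset G.mem_normal_core_iff[OF subgroup.subset[OF subC], of n] by blast
    then show "n \<in> {\<one>\<^bsub>G\<^esub>}" using core by simp
  qed
  then have "N = {\<one>\<^bsub>G\<^esub>}" using G.maximal_abelian_normal_meets_normal[OF solv maxA N] by simp
  have "faithful_rep G Q \<psi>"
    unfolding faithful_rep_def
  proof (intro ballI impI)
    fix g assume "g \<in> carrier G" "\<forall>x\<in>carrier Q. \<psi> g x = x"
    then have "g \<in> N" unfolding N_def by blast
    then show "g = \<one>\<^bsub>G\<^esub>" unfolding \<open>N = {\<one>\<^bsub>G\<^esub>}\<close> by (rule singletonD)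
  qed
  then show ?thesis using rep irr unfolding has_faithful_irreducible_rep_def by blast
qed

theorem theorem1p5:
  fixes K :: "('k, 'm) ring_scheme" and G :: "('g, 'n) monoid_scheme"
  assumes "field K" and "group G" and "torsion_group G" and "solvable G"
  shows "(has_faithful_irreducible_rep TYPE('v) K G \<longrightarrow>
           (\<forall>A. abelian_normal_subgroup A G \<longrightarrow>
              ring_char K \<notin> prime_orders (G\<lparr>carrier := A\<rparr>) \<and>
              (\<exists>C. subgroup C (G\<lparr>carrier := A\<rparr>) \<and>
                   locally_cyclic (G\<lparr>carrier := A\<rparr> Mod C) \<and>
                   normal_core G C = {\<one>\<^bsub>G\<^esub>})))
       \<and> ((\<exists>A. maximal_abelian_normal_subgroup A G \<and>
              ring_char K \<notin> prime_orders (G\<lparr>carrier := A\<rparr>) \<and>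
              (\<exists>C. subgroup C (G\<lparr>carrier := A\<rparr>) \<and>
                   locally_cyclic (G\<lparr>carrier := A\<rparr> Mod C) \<and>
                   normal_core G C = {\<one>\<^bsub>G\<^esub>}))
           \<longrightarrow> has_faithful_irreducible_rep TYPE(('g \<Rightarrow> 'k) set) K G)"
proof (intro conjI impI allI)
  fix A
  assume "has_faithful_irreducible_rep TYPE('v) K G" and A: "abelian_normal_subgroup A G"
  then obtain V :: "('k, 'v) module" and \<phi> where
    rep: "group_representation K G V \<phi>" and faith: "faithful_rep G V \<phi>" and irr: "irreducible_rep K G V \<phi>"
    unfolding has_faithful_irreducible_rep_def by blast
  interpret group_representation K G V \<phi> by (rule rep)
  have "locally_finite_subset G (carrier G)"
    using assms(3,4) by (rule G.torsion_solvable_imp_locally_finite)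
  then show char: "ring_char K \<notin> prime_orders (G\<lparr>carrier := A\<rparr>)"
    using irr faith A by (intro irreducible_imp_char_notin_prime_orders)
  show "\<exists>C. subgroup C (G\<lparr>carrier := A\<rparr>) \<and> locally_cyclic (G\<lparr>carrier := A\<rparr> Mod C) \<and>
      normal_core G C = {\<one>\<^bsub>G\<^esub>}"
    using irr faith assms(3) A char by (rule irreducible_imp_core_free_locally_cyclic_quotient)
qed (blast intro: core_free_imp_has_faithful_irreducible_rep[OF assms])

end
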